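(* Let $H$ be a Hopf algebra with invertible antipode over a field $\Bbbk$, equipped with a Woronowicz differential calculus $(\Omega^\bullet,\wedge,\mathrm d)$ such that $\Omega^1$ is finitely generated as a right $H$-module and $\overline\sigma^{\mathcal W}_{\Omega^1,\Omega^1}$ is diagonalisable with $1$ among its eigenvalues. Let $\mathbf g\in\mathfrak X^{\vee2}$ be a pseudo-Riemannian metric. If $\Phi_{\mathbf g}\colon\mathrm{Hom}_H(\Omega^1,\Omega^1\vee\Omega^1)\to\mathrm{Hom}_H(\Omega^1\vee\Omega^1,\Omega^1)$ is an isomorphism of vector spaces, then $$\nabla^{\mathrm{LC}}:=\nabla^c+\Phi_{\mathbf g}^{-1}\Big(\big(\mathrm d\circ\langle\mathbf g,\cdot\otimes_H\cdot\rangle-\langle\mathbf g,\nabla^c(\cdot\otimes_H\cdot)\rangle\big)\big|_{\Omega^1\vee\Omega^1}\Big)$$ is the unique Levi-Civita connection for $\mathbf g$. Surjectivity of $\Phi_{\mathbf g}$ provides existence of a Levi-Civita connection, while injectivity of $\Phi_{\mathbf g}$ ensures uniqueness of the Levi-Civita connection.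
   Context: Hopf algebra notation: $\otimes=\otimes_\Bbbk$, $\Delta(h)=h_1\otimes h_2$, counit $\epsilon$, $\overline S=S^{-1}$; right/left coactions $m\mapsto m_0\otimes m_1$, $m\mapsto m_{-1}\otimes m_0$, iterated in Sweedler notation. A bicovariant bimodule is an $H$-bimodule $M$ with commuting right and left coactions $\delta_M,\lambda_M$ satisfying $\delta_M(amb)=\Delta(a)\delta_M(m)\Delta(b)$, $\lambda_M(amb)=\Delta(a)\lambda_M(m)\Delta(b)$; $M\otimes_HN$ is one with diagonal coactions. The Woronowicz braiding is $\sigma^{\mathcal W}_{M,N}\colon M\otimes_HN\to N\otimes_HM$, $m\otimes_Hn\mapsto m_{-2}n_0S(n_1)\otimes_HS(m_{-1})m_0n_2$, an isomorphism of bicovariant bimodules; its inverse is denoted $\overline\sigma^{\mathcal W}_{N,M}\colon N\otimes_HM\to M\otimes_HN$. Subscripts $12,23$ indicate the tensor factors acted on. Calculus: a differential calculus on $H$ is a differential graded algebra $(\Omega^\bullet,\wedge,\mathrm d)$ with $\Omega^0=H$ and $\Omega^k$ spanned by $a^0\mathrm da^1\wedge\dots\wedge\mathrm da^k$; it is bicovariant if $\Omega^\bullet$ is a graded $H$-bicomodule algebra (extending $\Delta$ on $H$) with $\mathrm d$ bicolinear. It is a Woronowicz calculus if $\Omega^\bullet$ is the braided exterior algebra of $\Omega^1$, i.e. the tensor algebra of $\Omega^1$ over $H$ modulo in each degree $n$ the kernel of $A_n=\sum_{p}\mathrm{sign}(p)\Pi_p$, where $\Pi_p$ is obtained from a reduced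 decomposition of the permutation $p$ into nearest neighbour transpositions by replacing each transposition by $\overline\sigma^{\mathcal W}_{\Omega^1,\Omega^1}$ on the corresponding neighbours. In particular $\Omega^2\cong\mathrm{Im}(\mathrm{id}-\overline\sigma^{\mathcal W}_{\Omega^1,\Omega^1})$ with $\wedge=\mathrm{id}-\overline\sigma^{\mathcal W}_{\Omega^1,\Omega^1}$ on $\Omega^1\otimes_H\Omega^1$. Symmetric tensors: $\Omega^1\vee\Omega^1\subseteq\Omega^1\otimes_H\Omega^1$ is the eigenspace of $\overline\sigma^{\mathcal W}_{\Omega^1,\Omega^1}$ for eigenvalue $1$, $\Omega^1\wedge\Omega^1$ is the sum of the other eigenspaces, and $\pi_\vee\colon\Omega^1\otimes_H\Omega^1\to\Omega^1\vee\Omega^1$ is the projection along $\Omega^1\wedge\Omega^1$. $\mathfrak X=\mathrm{Hom}_H(\Omega^1,H)$ (right $H$-linear maps) is a bicovariant bimodule with $(aXb)(\omega)=aX(b\omega)$, $X_0(\omega)\otimes X_1=X(\omega_0)_0\otimes X(\omega_0)_1S(\omega_1)$, $X_{-1}\otimes X_0(\omega)=X(\omega_0)_{-1}\overline S(\omega_{-1})\otimes X(\omega_0)_0$; $\langle X,\omega\rangle=X(\omega)$. $\mathfrak X^{\vee2}=\mathfrak X\vee\mathfrak X=\{\mathbf g\in\mathfrak X\otimes_H\mathfrak X:\sigma^{\mathcal W}_{\mathfrak X,\mathfrak X}(\mathbf g)=\mathbf g\}$. Metrics: for $\mathbf g=\mathbf g^{a}\otimes_H\mathbf g_{a}\in\mathfrak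 X\otimes_H\mathfrak X$ (finite sum) put $\langle\mathbf g,\omega\otimes_H\eta\rangle=\langle\mathbf g^a\langle\mathbf g_a,\omega\rangle,\eta\rangle\in H$ and $\langle\mathbf g,\omega\otimes_H\eta\otimes_H\rho\rangle=\langle\mathbf g,\omega\otimes_H\eta\rangle\rho\in\Omega^1$. $\mathbf g$ is a (pseudo-Riemannian) metric if $\mathbf g\in\mathfrak X^{\vee2}$ and $\mathbf g^\sharp=\mathbf g^a\langle\mathbf g_a,\cdot\rangle\colon\Omega^1\to\mathfrak X$ is an isomorphism of right $H$-modules. Connections: a right connection on a right $H$-module $M$ is a linear $\nabla\colon M\to M\otimes_H\Omega^1$ with $\nabla(ma)=\nabla(m)a+m\otimes_H\mathrm da$. For a right connection or right $H$-linear map $\phi\colon\Omega^1\to\Omega^1\otimes_H\Omega^1$, the prescription $\phi_{-1}\otimes\phi_0(m)=\phi(m_0)_{-1}\overline S(m_{-1})\otimes\phi(m_0)_0$ defines an element $\phi_{-1}\otimes\phi_0\in H\otimes\mathrm{Hom}_\Bbbk(\Omega^1,\Omega^1\otimes_H\Omega^1)$, with iteration $\phi_{-2}\otimes\phi_{-1}\otimes\phi_0$, and one defines $\phi\oplus\phi\colon\Omega^1\otimes_H\Omega^1\to\Omega^1\otimes_H\Omega^1\otimes_H\Omega^1$ by $(\phi\oplus\phi)(m\otimes_Hn)=\sigma^{\mathcal W}_{23}(\phi(m_0S(m_1))\otimes_Hm_2n)+\phi_{-2}m_0S(\phi_{-1}m_1)\otimes_H\phi_0(m_2n)$. If $\phi$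 is a connection, $\phi\oplus\phi$ is a right connection, also written $\phi(\cdot\otimes_H\cdot)$; if $\phi$ is right $H$-linear so is $\phi\oplus\phi$. Put $\phi_\vee=(\pi_\vee\otimes_H\mathrm{id}_{\Omega^1})\circ(\phi\oplus\phi)|_{\Omega^1\vee\Omega^1}$. A right connection $\nabla$ on $\Omega^1$ is compatible with a metric $\mathbf g$ if $\langle\mathbf g,\nabla_\vee(\cdot)\rangle=\mathrm d\circ\langle\mathbf g,\cdot\rangle$ as maps $\Omega^1\vee\Omega^1\to\Omega^1$; it is torsion-free if $\wedge\circ\nabla+\mathrm d=0\colon\Omega^1\to\Omega^2$; it is a Levi-Civita connection for $\mathbf g$ if it is torsion-free and compatible with $\mathbf g$. The map $\Phi_{\mathbf g}$ is $\Phi_{\mathbf g}(\phi)=\langle\mathbf g,\cdot\otimes_H\cdot\rangle\circ\phi_\vee$ for right $H$-linear $\phi\colon\Omega^1\to\Omega^1\vee\Omega^1\subseteq\Omega^1\otimes_H\Omega^1$ (with $\langle\mathbf g,\cdot\rangle$ pairing the first two of three factors). The structure constants connection $\nabla^c$: let $\{\omega^i\}$ be a (finite) basis of the left coinvariants ${}^{\mathrm{co}H}\Omega^1=\{\omega:\omega_{-1}\otimes\omega_0=1\otimes\omega\}$ (a basis of the free right $H$-module $\Omega^1$); define functionals $\chi_i\colon H\to\Bbbk$ by $\mathrm da=\omega^ia_1\chi_i(a_2)$, choose $x^i\in\ker\epsilon$ with $\chi_j(x^i)=\delta^i_j$, and put $C^i_{kj}=\chi_k(x^i_1)\chi_j(x^i_2)\in\Bbbk$,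 so that $\mathrm d\omega^i=C^i_{kj}\omega^j\wedge\omega^k$. Then $\nabla^c$ is the right connection on $\Omega^1$ with $\nabla^c(\omega^i)=-\omega^j\otimes_H\omega^kC^i_{kj}$ (repeated indices summed). *)

theory Defs
  imports
    Complex_Main
    "HOL-Library.Poly_Mapping"
    "HOL-Library.Function_Algebras"
    "HOL-Combinatorics.Permutations"
begin

section \<open>Formal linear combinations and quotients of vector spaces\<close>

text \<open>Vector spaces over the field \<open>'k\<close> that need not exhaust their type. The type \<open>'x \<Rightarrow>\<^sub>0 'k\<close>
  is the vector space with basis \<open>'x\<close>.\<close>

record ('k, 'v) vspace =
  carr :: "'v set"
  scl :: "'k \<Rightarrow> 'v \<Rightarrow> 'v"

definition lin_map :: "('k, 'v::ab_group_add, 'p) vspace_scheme \<Rightarrow>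
    ('k, 'u::ab_group_add, 'q) vspace_scheme \<Rightarrow> ('v \<Rightarrow> 'u) \<Rightarrow> bool" where
  "lin_map V U f \<longleftrightarrow> (\<forall>x\<in>carr V. f x \<in> carr U) \<and>
     (\<forall>x\<in>carr V. \<forall>y\<in>carr V. f (x + y) = f x + f y) \<and>
     (\<forall>c. \<forall>x\<in>carr V. f (scl V c x) = scl U c (f x))"

definition vs_iso :: "('k, 'v::ab_group_add, 'p) vspace_scheme \<Rightarrow>
    ('k, 'u::ab_group_add, 'q) vspace_scheme \<Rightarrow> ('v \<Rightarrow> 'u) \<Rightarrow> bool" where
  "vs_iso V U f \<longleftrightarrow> lin_map V U f \<and> bij_betw f (carr V) (carr U)"

definition eigenspace :: "('k, 'v, 'p) vspace_scheme \<Rightarrow> ('v \<Rightarrow> 'v) \<Rightarrow> 'k \<Rightarrow> 'v set" where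
  "eigenspace V f c = {x \<in> carr V. f x = scl V c x}"

definition diagonalisable :: "('k::field, 'v::ab_group_add, 'p) vspace_scheme \<Rightarrow> ('v \<Rightarrow> 'v) \<Rightarrow> bool" where
  "diagonalisable V f \<longleftrightarrow> module.span (scl V) (\<Union>c. eigenspace V f c) = carr V"

definition pscale :: "'k::field \<Rightarrow> ('x \<Rightarrow>\<^sub>0 'k) \<Rightarrow> ('x \<Rightarrow>\<^sub>0 'k)" where
  "pscale c t = Poly_Mapping.map ((*) c) t"

text \<open>\<open>lin_ext s t f\<close> is the value at \<open>t\<close> of the linear extension of \<open>f\<close>. With \<open>t = \<Delta>(a)\<close> and
  \<open>f = (\<lambda>(a1, a2). \<dots>)\<close> it is what Sweedler notation abbreviates.\<close>

definition lin_ext :: "('k \<Rightarrow> 'v \<Rightarrow> 'v) \<Rightarrow> ('x \<Rightarrow>\<^sub>0 'k::field) \<Rightarrow> ('x \<Rightarrow> 'v::ab_group_add) \<Rightarrow> 'v" where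
  "lin_ext s t f = (\<Sum>x\<in>Poly_Mapping.keys t. s (Poly_Mapping.lookup t x) (f x))"

abbreviation plin :: "('x \<Rightarrow>\<^sub>0 'k::field) \<Rightarrow> ('x \<Rightarrow> ('y \<Rightarrow>\<^sub>0 'k)) \<Rightarrow> ('y \<Rightarrow>\<^sub>0 'k)" where
  "plin \<equiv> lin_ext pscale"

text \<open>The quotient by a subspace \<open>R\<close> is realised on a complement of \<open>R\<close>: \<open>qmap R\<close> is a linear
  projection with kernel \<open>R\<close>, and the class of \<open>t\<close> is represented by \<open>qmap R t\<close>. Hence every
  element \<open>q\<close> of a quotient is itself a formal sum in its own class, so that the map
  induced on the quotient by \<open>f\<close> (assumed to respect \<open>R\<close>) is \<open>q \<mapsto> lin_ext s q f\<close>.\<close>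

definition qmap :: "('x \<Rightarrow>\<^sub>0 'k::field) set \<Rightarrow> ('x \<Rightarrow>\<^sub>0 'k) \<Rightarrow> ('x \<Rightarrow>\<^sub>0 'k)" where
  "qmap R = (SOME p. Vector_Spaces.linear pscale pscale p \<and> (\<forall>t. p t - t \<in> R) \<and> (\<forall>r\<in>R. p r = 0))"

lemma lookup_pscale: "Poly_Mapping.lookup (pscale c t) x = c * Poly_Mapping.lookup t x"
  by (simp add: pscale_def Poly_Mapping.map.rep_eq when_def)

lemma vector_space_pscale: "vector_space (pscale :: 'k::field \<Rightarrow> ('x \<Rightarrow>\<^sub>0 'k) \<Rightarrow> _)"
  by unfold_locales
    (auto intro!: poly_mapping_eqI simp: lookup_pscale lookup_add algebra_simps)

lemma qmap:
  assumes "module.subspace pscale (R :: ('x \<Rightarrow>\<^sub>0 'k::field) set)"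
  shows "Vector_Spaces.linear pscale pscale (qmap R)" "qmap R t - t \<in> R" "r \<in> R \<Longrightarrow> qmap R r = 0"
proof -
  interpret vector_space_pair "pscale :: 'k \<Rightarrow> ('x \<Rightarrow>\<^sub>0 'k) \<Rightarrow> _" "pscale :: 'k \<Rightarrow> ('x \<Rightarrow>\<^sub>0 'k) \<Rightarrow> _"
    by (simp add: vector_space_pair_def vector_space_pscale)
  obtain B where B: "B \<subseteq> R" "vs1.independent B" "R \<subseteq> vs1.span B"
    using vs1.maximal_independent_subset[of R] by blast
  have RB: "vs1.span B = R"
    using B assms by (simp add: vs1.span_minimal subset_antisym)
  define E where "E = vs1.extend_basis B"
  have E: "vs1.independent E" "vs1.span E = UNIV" "B \<subseteq> E"
    unfolding E_def using B(2) by (auto simp: vs1.independent_extend_basis vs1.extend_basis_superset)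
  obtain p where p: "Vector_Spaces.linear pscale pscale p" "\<And>b. b \<in> E \<Longrightarrow> p b = (if b \<in> B then 0 else b)"
    using linear_independent_extend[OF E(1), of "\<lambda>b. if b \<in> B then 0 else b"] by auto
  have z: "p r = 0" if "r \<in> R" for r
    by (rule linear_eq_0_on_span[OF p(1), of B]) (use that RB E(3) p(2) in auto)
  have "p t - t \<in> R" for t
  proof -
    have "t \<in> vs1.span E" using E by simp
    then show ?thesis
    proof (induction rule: vs1.span_induct_alt)
      case base
      then show ?case using linear_0[OF p(1)] vs1.subspace_0[OF assms] by simp
    next
      case (step c x y)
      have "p x - x \<in> R"
        using p(2)[OF step(1)] B(1) vs1.subspace_0[OF assms] vs1.subspace_neg[OF assms] by auto
      then have "pscale c (p x - x) + (p y - y) \<in> R"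
        using step assms by (simp add: vs1.subspace_add vs1.subspace_scale)
      then show ?case
        using p(1) by (simp add: linear_add linear_scale vs1.scale_right_diff_distrib algebra_simps)
    qed
  qed
  with p(1) z have "\<exists>p. Vector_Spaces.linear pscale pscale p \<and> (\<forall>t. p t - t \<in> R) \<and> (\<forall>r\<in>R. p r = 0)"
    by blast
  from someI_ex[OF this, folded qmap_def]
  show "Vector_Spaces.linear pscale pscale (qmap R)" "qmap R t - t \<in> R" "r \<in> R \<Longrightarrow> qmap R r = 0"
    by auto
qed

lemma qmap_eq_iff:
  assumes "module.subspace pscale (R :: ('x \<Rightarrow>\<^sub>0 'k::field) set)"
  shows "qmap R s = qmap R t \<longleftrightarrow> s - t \<in> R"
proof -
  interpret vector_space_pair "pscale :: 'k \<Rightarrow> ('x \<Rightarrow>\<^sub>0 'k) \<Rightarrow> _" "pscale :: 'k \<Rightarrow> ('x \<Rightarrow>\<^sub>0 'k) \<Rightarrow> _"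
    by (simp add: vector_space_pair_def vector_space_pscale)
  have "qmap R (s - t) = qmap R s - qmap R t"
    using qmap(1)[OF assms] by (rule linear_diff)
  moreover have "s - t \<in> R" if "qmap R (s - t) = 0"
    using qmap(2)[OF assms, of "s - t"] that vs1.subspace_neg[OF assms] by fastforce
  ultimately show ?thesis
    using qmap(3)[OF assms, of "s - t"] by auto
qed


section \<open>Tensor products over the ground field\<close>

definition trel :: "('k::field, 'v::ab_group_add, 'p) vspace_scheme \<Rightarrow>
    ('k, 'u::ab_group_add, 'q) vspace_scheme \<Rightarrow> ('v \<times> 'u \<Rightarrow>\<^sub>0 'k) set" where
  "trel V U =
     {Poly_Mapping.single (x + y, z) 1 - Poly_Mapping.single (x, z) 1 - Poly_Mapping.single (y, z) 1 | x y z.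
        x \<in> carr V \<and> y \<in> carr V \<and> z \<in> carr U} \<union>
     {Poly_Mapping.single (x, y + z) 1 - Poly_Mapping.single (x, y) 1 - Poly_Mapping.single (x, z) 1 | x y z.
        x \<in> carr V \<and> y \<in> carr U \<and> z \<in> carr U} \<union>
     {Poly_Mapping.single (scl V c x, y) 1 - Poly_Mapping.single (x, y) c | c x y. x \<in> carr V \<and> y \<in> carr U} \<union>
     {Poly_Mapping.single (x, scl U c y) 1 - Poly_Mapping.single (x, y) c | c x y. x \<in> carr V \<and> y \<in> carr U}"

definition ten :: "('k::field, 'v::ab_group_add, 'p) vspace_scheme \<Rightarrow>
    ('k, 'u::ab_group_add, 'q) vspace_scheme \<Rightarrow> 'v \<Rightarrow> 'u \<Rightarrow> ('v \<times> 'u \<Rightarrow>\<^sub>0 'k)" where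
  "ten V U x y = qmap (module.span pscale (trel V U)) (Poly_Mapping.single (x, y) 1)"

definition tsp :: "('k::field, 'v::ab_group_add, 'p) vspace_scheme \<Rightarrow>
    ('k, 'u::ab_group_add, 'q) vspace_scheme \<Rightarrow> ('k, 'v \<times> 'u \<Rightarrow>\<^sub>0 'k) vspace" where
  "tsp V U = \<lparr>carr = qmap (module.span pscale (trel V U)) ` {t. Poly_Mapping.keys t \<subseteq> carr V \<times> carr U},
     scl = pscale\<rparr>"


section \<open>Hopf algebras and comodules\<close>

text \<open>The algebra underlying a Hopf algebra is a whole type \<open>'h\<close> of class \<open>ring_1\<close>.\<close>

record (overloaded) ('k, 'h) hopf = "('k, 'h) vspace" +
  comult :: "'h \<Rightarrow> ('h \<times> 'h \<Rightarrow>\<^sub>0 'k)"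
  counit :: "'h \<Rightarrow> 'k"
  antipode :: "'h \<Rightarrow> 'h"

definition right_comodule :: "('k::field, 'h::ring_1) hopf \<Rightarrow>
    ('k, 'v::ab_group_add, 'p) vspace_scheme \<Rightarrow> ('v \<Rightarrow> ('v \<times> 'h \<Rightarrow>\<^sub>0 'k)) \<Rightarrow> bool" where
  "right_comodule H V \<delta> \<longleftrightarrow> lin_map V (tsp V H) \<delta> \<and>
     (\<forall>v\<in>carr V.
        plin (\<delta> v) (\<lambda>(v', h2). plin (\<delta> v') (\<lambda>(v0, h1). ten V (tsp H H) v0 (ten H H h1 h2))) =
        plin (\<delta> v) (\<lambda>(v0, h). plin (comult H h) (\<lambda>(h1, h2). ten V (tsp H H) v0 (ten H H h1 h2))) \<and>
        lin_ext (scl V) (\<delta> v) (\<lambda>(v0, h). scl V (counit H h) v0) = v)"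

definition left_comodule :: "('k::field, 'h::ring_1) hopf \<Rightarrow>
    ('k, 'v::ab_group_add, 'p) vspace_scheme \<Rightarrow> ('v \<Rightarrow> ('h \<times> 'v \<Rightarrow>\<^sub>0 'k)) \<Rightarrow> bool" where
  "left_comodule H V \<rho> \<longleftrightarrow> lin_map V (tsp H V) \<rho> \<and>
     (\<forall>v\<in>carr V.
        plin (\<rho> v) (\<lambda>(h1, v'). plin (\<rho> v') (\<lambda>(h2, v0). ten H (tsp H V) h1 (ten H V h2 v0))) =
        plin (\<rho> v) (\<lambda>(h, v0). plin (comult H h) (\<lambda>(h1, h2). ten H (tsp H V) h1 (ten H V h2 v0))) \<and>
        lin_ext (scl V) (\<rho> v) (\<lambda>(h, v0). scl V (counit H h) v0) = v)"

locale hopf_algebra =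
  fixes H :: "('k::field, 'h::ring_1) hopf"
  assumes carr_UNIV: "carr H = UNIV"
    and vector_space_H: "vector_space (scl H)"
    and scl_mult_left: "scl H c a * b = scl H c (a * b)"
    and scl_mult_right: "a * scl H c b = scl H c (a * b)"
    and coassoc_counit_right: "right_comodule H H (comult H)"
    and coassoc_counit_left: "left_comodule H H (comult H)"
    and comult_mult: "comult H (a * b) =
      plin (comult H a) (\<lambda>(a1, a2). plin (comult H b) (\<lambda>(b1, b2). ten H H (a1 * b1) (a2 * b2)))"
    and comult_one: "comult H 1 = ten H H 1 1"
    and counit_linear: "Vector_Spaces.linear (scl H) (*) (counit H)"
    and counit_mult: "counit H (a * b) = counit H a * counit H b"
    and counit_one: "counit H 1 = 1"
    and antipode_linear: "Vector_Spaces.linear (scl H) (scl H) (antipode H)"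
    and antipode_left: "lin_ext (scl H) (comult H a) (\<lambda>(a1, a2). antipode H a1 * a2) = scl H (counit H a) 1"
    and antipode_right: "lin_ext (scl H) (comult H a) (\<lambda>(a1, a2). a1 * antipode H a2) = scl H (counit H a) 1"


section \<open>Bimodules with coactions, tensor powers over \<open>H\<close> and the Woronowicz braiding\<close>

record (overloaded) ('k, 'h, 'm) bibimodule = "('k, 'm) vspace" +
  lact :: "'h \<Rightarrow> 'm \<Rightarrow> 'm"
  ract :: "'m \<Rightarrow> 'h \<Rightarrow> 'm"
  lcoact :: "'m \<Rightarrow> ('h \<times> 'm \<Rightarrow>\<^sub>0 'k)"
  rcoact :: "'m \<Rightarrow> ('m \<times> 'h \<Rightarrow>\<^sub>0 'k)"

text \<open>The \<open>n\<close>-fold tensor power of \<open>M\<close> over \<open>H\<close> (\<open>n \<ge> 1\<close>) is the quotient of the vector space on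
  the words of length \<open>n\<close> over \<open>M\<close> by multilinearity and \<open>H\<close>-balancing; iterated tensor
  products are thus flat and need no associators.\<close>

definition hrel :: "('k::field, 'h, 'm::ab_group_add) bibimodule \<Rightarrow> nat \<Rightarrow> ('m list \<Rightarrow>\<^sub>0 'k) set" where
  "hrel M n =
     {Poly_Mapping.single (u @ [x + y] @ v) 1 - Poly_Mapping.single (u @ [x] @ v) 1
        - Poly_Mapping.single (u @ [y] @ v) 1 | u x y v.
        length (u @ [x] @ v) = n \<and> set (u @ [x, y] @ v) \<subseteq> carr M} \<union>
     {Poly_Mapping.single (u @ [scl M c x] @ v) 1 - Poly_Mapping.single (u @ [x] @ v) c | u c x v.
        length (u @ [x] @ v) = n \<and> set (u @ [x] @ v) \<subseteq> carr M} \<union>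
     {Poly_Mapping.single (u @ [ract M x a, y] @ v) 1 - Poly_Mapping.single (u @ [x, lact M a y] @ v) 1 | u x a y v.
        length (u @ [x, y] @ v) = n \<and> set (u @ [x, y] @ v) \<subseteq> carr M}"

definition hten :: "('k::field, 'h, 'm::ab_group_add) bibimodule \<Rightarrow> 'm list \<Rightarrow> ('m list \<Rightarrow>\<^sub>0 'k)" where
  "hten M w = qmap (module.span pscale (hrel M (length w))) (Poly_Mapping.single w 1)"

definition hpow :: "('k::field, 'h, 'm::ab_group_add) bibimodule \<Rightarrow> nat \<Rightarrow> ('k, 'm list \<Rightarrow>\<^sub>0 'k) vspace" where
  "hpow M n = \<lparr>carr = qmap (module.span pscale (hrel M n)) `
       {t. Poly_Mapping.keys t \<subseteq> {w. length w = n \<and> set w \<subseteq> carr M}}, scl = pscale\<rparr>"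

definition hcat :: "('k::field, 'h, 'm::ab_group_add) bibimodule \<Rightarrow>
    ('m list \<Rightarrow>\<^sub>0 'k) \<Rightarrow> ('m list \<Rightarrow>\<^sub>0 'k) \<Rightarrow> ('m list \<Rightarrow>\<^sub>0 'k)" where
  "hcat M s t = plin s (\<lambda>u. plin t (\<lambda>v. hten M (u @ v)))"

definition hpow_ract :: "('k::field, 'h, 'm::ab_group_add) bibimodule \<Rightarrow>
    ('m list \<Rightarrow>\<^sub>0 'k) \<Rightarrow> 'h \<Rightarrow> ('m list \<Rightarrow>\<^sub>0 'k)" where
  "hpow_ract M t a = plin t (\<lambda>w. hten M (butlast w @ [ract M (last w) a]))"

text \<open>The diagonal left coaction on the tensor square.\<close>

definition lcoact2 :: "('k::field, 'h::ring_1) hopf \<Rightarrow> ('k, 'h, 'm::ab_group_add) bibimodule \<Rightarrow>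
    ('m list \<Rightarrow>\<^sub>0 'k) \<Rightarrow> ('h \<times> ('m list \<Rightarrow>\<^sub>0 'k) \<Rightarrow>\<^sub>0 'k)" where
  "lcoact2 H M t = plin t (\<lambda>w. plin (lcoact M (w ! 0)) (\<lambda>(h, m0). plin (lcoact M (w ! 1)) (\<lambda>(h', n0).
     ten H (hpow M 2) (h * h') (hten M [m0, n0]))))"

definition right_hom :: "'m::ab_group_add set \<Rightarrow> ('m \<Rightarrow> 'h \<Rightarrow> 'm) \<Rightarrow>
    'n::ab_group_add set \<Rightarrow> ('n \<Rightarrow> 'h \<Rightarrow> 'n) \<Rightarrow> ('m \<Rightarrow> 'n) set" where
  \<comment> \<open>right \<open>H\<close>-linear maps, extended by zero outside their domain so that \<open>=\<close> is equality of maps\<close>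
  "right_hom A ra B rb = {f. (\<forall>x\<in>A. f x \<in> B) \<and> (\<forall>x\<in>A. \<forall>y\<in>A. f (x + y) = f x + f y) \<and>
     (\<forall>x\<in>A. \<forall>a. f (ra x a) = rb (f x) a) \<and> (\<forall>x. x \<notin> A \<longrightarrow> f x = 0)}"

text \<open>In the braiding, \<open>m\<^sub>-\<^sub>2 \<otimes> m\<^sub>-\<^sub>1 \<otimes> m\<^sub>0\<close> is written \<open>h2, h1, m0\<close>.\<close>

definition braiding :: "('k::field, 'h::ring_1) hopf \<Rightarrow> ('k, 'h, 'm::ab_group_add) bibimodule \<Rightarrow>
    ('m list \<Rightarrow>\<^sub>0 'k) \<Rightarrow> ('m list \<Rightarrow>\<^sub>0 'k)" where
  "braiding H M t = plin t (\<lambda>w.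
     plin (lcoact M (w ! 0)) (\<lambda>(h, m0). plin (comult H h) (\<lambda>(h2, h1).
     plin (rcoact M (w ! 1)) (\<lambda>(n0, g). plin (comult H g) (\<lambda>(n1, n2).
       hten M [ract M (lact M h2 n0) (antipode H n1), ract M (lact M (antipode H h1) m0) n2])))))"

definition braiding_inv :: "('k::field, 'h::ring_1) hopf \<Rightarrow> ('k, 'h, 'm::ab_group_add) bibimodule \<Rightarrow>
    ('m list \<Rightarrow>\<^sub>0 'k) \<Rightarrow> ('m list \<Rightarrow>\<^sub>0 'k)" where
  "braiding_inv H M = inv_into (carr (hpow M 2)) (braiding H M)"

text \<open>\<open>at_factors M i f\<close> lets a map \<open>f\<close> on the tensor square act on the factors \<open>i, i + 1\<close>, counted from \<open>0\<close>.\<close>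

definition at_factors :: "('k::field, 'h, 'm::ab_group_add) bibimodule \<Rightarrow> nat \<Rightarrow>
    (('m list \<Rightarrow>\<^sub>0 'k) \<Rightarrow> ('m list \<Rightarrow>\<^sub>0 'k)) \<Rightarrow> ('m list \<Rightarrow>\<^sub>0 'k) \<Rightarrow> ('m list \<Rightarrow>\<^sub>0 'k)" where
  "at_factors M i f t = plin t (\<lambda>w. plin (f (hten M [w ! i, w ! Suc i]))
     (\<lambda>v. hten M (take i w @ v @ drop (i + 2) w)))"

definition perm_of_word :: "nat list \<Rightarrow> nat \<Rightarrow> nat" where
  "perm_of_word is = foldr (\<lambda>i q. transpose i (Suc i) \<circ> q) is id"

definition reduced_word :: "nat \<Rightarrow> (nat \<Rightarrow> nat) \<Rightarrow> nat list \<Rightarrow> bool" where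
  "reduced_word n p is \<longleftrightarrow> (\<forall>i\<in>set is. Suc i < n) \<and> perm_of_word is = p \<and>
     (\<forall>js. (\<forall>j\<in>set js. Suc j < n) \<and> perm_of_word js = p \<longrightarrow> length is \<le> length js)"

definition antisymmetriser :: "('k::field, 'h::ring_1) hopf \<Rightarrow> ('k, 'h, 'm::ab_group_add) bibimodule \<Rightarrow>
    nat \<Rightarrow> ('m list \<Rightarrow>\<^sub>0 'k) \<Rightarrow> ('m list \<Rightarrow>\<^sub>0 'k)" where
  "antisymmetriser H M n t = (\<Sum>p | p permutes {..<n}.
     pscale (of_int (sign p)) (foldr (\<lambda>i. at_factors M i (braiding_inv H M)) (SOME is. reduced_word n p is) t))"


section \<open>Differential calculi\<close>

text \<open>The differential graded algebra lives on a type \<open>'w\<close> of class \<open>ring_1\<close>, with \<open>\<and>\<close> the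
  multiplication of \<open>'w\<close>; \<open>emb\<close> is the identification of \<open>H\<close> with the forms of degree \<open>0\<close>. The
  coactions are given in each degree separately.\<close>

record (overloaded) ('k, 'h, 'w) calculus =
  grade :: "nat \<Rightarrow> 'w set"
  wscl :: "'k \<Rightarrow> 'w \<Rightarrow> 'w"
  emb :: "'h \<Rightarrow> 'w"
  dd :: "'w \<Rightarrow> 'w"
  wlcoact :: "nat \<Rightarrow> 'w \<Rightarrow> ('h \<times> 'w \<Rightarrow>\<^sub>0 'k)"
  wrcoact :: "nat \<Rightarrow> 'w \<Rightarrow> ('w \<times> 'h \<Rightarrow>\<^sub>0 'k)"

definition forms :: "('k, 'h, 'w) calculus \<Rightarrow> nat \<Rightarrow> ('k, 'w) vspace" where
  "forms C n = \<lparr>carr = grade C n, scl = wscl C\<rparr>"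

locale differential_calculus = hopf_algebra H
  for H :: "('k::field, 'h::ring_1) hopf" +
  fixes C :: "('k, 'h, 'w::ring_1) calculus"
  assumes vector_space_C: "vector_space (wscl C)"
    and wscl_mult_left: "wscl C c x * y = wscl C c (x * y)"
    and wscl_mult_right: "x * wscl C c y = wscl C c (x * y)"
    and grade_subspace: "module.subspace (wscl C) (grade C n)"
    and grade_direct_sum: "\<exists>!f :: nat \<Rightarrow>\<^sub>0 'w. (\<forall>n. Poly_Mapping.lookup f n \<in> grade C n) \<and>
          x = (\<Sum>n\<in>Poly_Mapping.keys f. Poly_Mapping.lookup f n)"
    and grade_mult: "x \<in> grade C m \<Longrightarrow> y \<in> grade C n \<Longrightarrow> x * y \<in> grade C (m + n)"
    and emb_linear: "Vector_Spaces.linear (scl H) (wscl C) (emb C)"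
    and emb_mult: "emb C (a * b) = emb C a * emb C b"
    and emb_one: "emb C 1 = 1"
    and emb_bij: "bij_betw (emb C) UNIV (grade C 0)"
    and dd_linear: "Vector_Spaces.linear (wscl C) (wscl C) (dd C)"
    and dd_grade: "x \<in> grade C n \<Longrightarrow> dd C x \<in> grade C (Suc n)"
    and dd_Leibniz: "x \<in> grade C n \<Longrightarrow> dd C (x * y) = dd C x * y + (- 1) ^ n * (x * dd C y)"
    and dd_dd: "dd C (dd C x) = 0"
    and grade_spanned: "grade C n = module.span (wscl C)
          {emb C a * prod_list (map (\<lambda>b. dd C (emb C b)) bs) | a bs. length bs = n}"

locale bicovariant_calculus = differential_calculus H C
  for H :: "('k::field, 'h::ring_1) hopf" and C :: "('k, 'h, 'w::ring_1) calculus" +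
  assumes wrcoact_comodule: "right_comodule H (forms C n) (wrcoact C n)"
    and wlcoact_comodule: "left_comodule H (forms C n) (wlcoact C n)"
    and coacts_commute: "x \<in> grade C n \<Longrightarrow>
          plin (wrcoact C n x) (\<lambda>(x', h). plin (wlcoact C n x') (\<lambda>(g, x0).
            ten H (tsp (forms C n) H) g (ten (forms C n) H x0 h))) =
          plin (wlcoact C n x) (\<lambda>(g, x'). plin (wrcoact C n x') (\<lambda>(x0, h).
            ten H (tsp (forms C n) H) g (ten (forms C n) H x0 h)))"
    and wrcoact_emb: "wrcoact C 0 (emb C a) = plin (comult H a) (\<lambda>(a1, a2). ten (forms C 0) H (emb C a1) a2)"
    and wlcoact_emb: "wlcoact C 0 (emb C a) = plin (comult H a) (\<lambda>(a1, a2). ten H (forms C 0) a1 (emb C a2))"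
    and wrcoact_mult: "x \<in> grade C m \<Longrightarrow> y \<in> grade C n \<Longrightarrow> wrcoact C (m + n) (x * y) =
          plin (wrcoact C m x) (\<lambda>(x0, x1). plin (wrcoact C n y) (\<lambda>(y0, y1).
            ten (forms C (m + n)) H (x0 * y0) (x1 * y1)))"
    and wlcoact_mult: "x \<in> grade C m \<Longrightarrow> y \<in> grade C n \<Longrightarrow> wlcoact C (m + n) (x * y) =
          plin (wlcoact C m x) (\<lambda>(x1, x0). plin (wlcoact C n y) (\<lambda>(y1, y0).
            ten H (forms C (m + n)) (x1 * y1) (x0 * y0)))"
    and wrcoact_dd: "x \<in> grade C n \<Longrightarrow> wrcoact C (Suc n) (dd C x) =
          plin (wrcoact C n x) (\<lambda>(x0, h). ten (forms C (Suc n)) H (dd C x0) h)"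
    and wlcoact_dd: "x \<in> grade C n \<Longrightarrow> wlcoact C (Suc n) (dd C x) =
          plin (wlcoact C n x) (\<lambda>(h, x0). ten H (forms C (Suc n)) h (dd C x0))"

definition Omega1 :: "('k, 'h, 'w::ring_1) calculus \<Rightarrow> ('k, 'h, 'w) bibimodule" where
  "Omega1 C = \<lparr>carr = grade C 1, scl = wscl C,
     lact = (\<lambda>a x. emb C a * x), ract = (\<lambda>x a. x * emb C a),
     lcoact = wlcoact C 1, rcoact = wrcoact C 1\<rparr>"

definition wedge :: "('k::field, 'h, 'w::ring_1) calculus \<Rightarrow> ('w list \<Rightarrow>\<^sub>0 'k) \<Rightarrow> 'w" where
  "wedge C t = lin_ext (wscl C) t prod_list"

text \<open>The canonical map from the \<open>n\<close>-th tensor power of the one-forms is onto the \<open>n\<close>-forms for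
  \<open>n \<ge> 1\<close>, since these are spanned by products of one-forms. So the calculus is the braided exterior
  algebra iff the kernel of this map is that of the antisymmetriser; degree \<open>0\<close> is \<open>H\<close> on both sides.\<close>

locale woronowicz_calculus = bicovariant_calculus H C
  for H :: "('k::field, 'h::ring_1) hopf" and C :: "('k, 'h, 'w::ring_1) calculus" +
  assumes braided_exterior: "n \<ge> 1 \<Longrightarrow> t \<in> carr (hpow (Omega1 C) n) \<Longrightarrow>
    wedge C t = 0 \<longleftrightarrow> antisymmetriser H (Omega1 C) n t = 0"

definition fin_gen_right :: "('k, 'h, 'm::ab_group_add) bibimodule \<Rightarrow> bool" where
  "fin_gen_right M \<longleftrightarrow> (\<exists>B\<subseteq>carr M. finite B \<and> (\<forall>m\<in>carr M. \<exists>a. m = (\<Sum>b\<in>B. ract M b (a b))))"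


section \<open>Symmetric tensors, vector fields and metrics\<close>

abbreviation Omega2T :: "('k::field, 'h, 'w::ring_1) calculus \<Rightarrow> ('k, 'w list \<Rightarrow>\<^sub>0 'k) vspace" where
  "Omega2T C \<equiv> hpow (Omega1 C) 2"

definition sym_forms :: "('k::field, 'h::ring_1) hopf \<Rightarrow> ('k, 'h, 'w::ring_1) calculus \<Rightarrow>
    ('w list \<Rightarrow>\<^sub>0 'k) set" where
  "sym_forms H C = eigenspace (Omega2T C) (braiding_inv H (Omega1 C)) 1"

definition asym_forms :: "('k::field, 'h::ring_1) hopf \<Rightarrow> ('k, 'h, 'w::ring_1) calculus \<Rightarrow>
    ('w list \<Rightarrow>\<^sub>0 'k) set" where
  "asym_forms H C = module.span pscale
     (\<Union>c\<in>-{1}. eigenspace (Omega2T C) (braiding_inv H (Omega1 C)) c)"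

definition sym_proj :: "('k::field, 'h::ring_1) hopf \<Rightarrow> ('k, 'h, 'w::ring_1) calculus \<Rightarrow>
    ('w list \<Rightarrow>\<^sub>0 'k) \<Rightarrow> ('w list \<Rightarrow>\<^sub>0 'k)" where
  "sym_proj H C t = (THE s. s \<in> sym_forms H C \<and> t - s \<in> asym_forms H C)"

definition dual_vspace :: "('k, 'h::ring_1) hopf \<Rightarrow> ('k, 'h, 'm::ab_group_add) bibimodule \<Rightarrow>
    ('k, 'm \<Rightarrow> 'h) vspace" where
  "dual_vspace H M = \<lparr>carr = right_hom (carr M) (ract M) UNIV (*), scl = (\<lambda>c X m. scl H c (X m))\<rparr>"

text \<open>The coactions of the dual are the tensors whose evaluation at every \<open>m\<close> is prescribed.\<close>

definition dual_bibimodule :: "('k::field, 'h::ring_1) hopf \<Rightarrow> ('k, 'h, 'm::ab_group_add) bibimodule \<Rightarrow>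
    ('k, 'h, 'm \<Rightarrow> 'h) bibimodule" where
  "dual_bibimodule H M = \<lparr>carr = carr (dual_vspace H M), scl = scl (dual_vspace H M),
     lact = (\<lambda>a X m. a * X m),
     ract = (\<lambda>X a m. if m \<in> carr M then X (lact M a m) else 0),
     lcoact = (\<lambda>X. THE t. t \<in> carr (tsp H (dual_vspace H M)) \<and> (\<forall>m\<in>carr M.
       plin t (\<lambda>(h, Y). ten H H h (Y m)) =
       plin (lcoact M m) (\<lambda>(mm1, m0). plin (comult H (X m0)) (\<lambda>(a1, a2).
         ten H H (a1 * inv (antipode H) mm1) a2)))),
     rcoact = (\<lambda>X. THE t. t \<in> carr (tsp (dual_vspace H M) H) \<and> (\<forall>m\<in>carr M.
       plin t (\<lambda>(Y, h). ten H H (Y m) h) =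
       plin (rcoact M m) (\<lambda>(m0, m1). plin (comult H (X m0)) (\<lambda>(a1, a2).
         ten H H a1 (a2 * antipode H m1)))))\<rparr>"

abbreviation VF :: "('k::field, 'h::ring_1) hopf \<Rightarrow> ('k, 'h, 'w::ring_1) calculus \<Rightarrow>
    ('k, 'h, 'w \<Rightarrow> 'h) bibimodule" where
  "VF H C \<equiv> dual_bibimodule H (Omega1 C)"

definition sym_fields :: "('k::field, 'h::ring_1) hopf \<Rightarrow> ('k, 'h, 'w::ring_1) calculus \<Rightarrow>
    (('w \<Rightarrow> 'h) list \<Rightarrow>\<^sub>0 'k) set" where
  "sym_fields H C = {g \<in> carr (hpow (VF H C) 2). braiding H (VF H C) g = g}"

definition pair2 :: "('k::field, 'h::ring_1) hopf \<Rightarrow> ('k, 'h, 'w::ring_1) calculus \<Rightarrow>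
    (('w \<Rightarrow> 'h) list \<Rightarrow>\<^sub>0 'k) \<Rightarrow> ('w list \<Rightarrow>\<^sub>0 'k) \<Rightarrow> 'h" where
  "pair2 H C g t = lin_ext (scl H) g (\<lambda>W. lin_ext (scl H) t (\<lambda>w.
     ract (VF H C) (W ! 0) ((W ! 1) (w ! 0)) (w ! 1)))"

definition pair3 :: "('k::field, 'h::ring_1) hopf \<Rightarrow> ('k, 'h, 'w::ring_1) calculus \<Rightarrow>
    (('w \<Rightarrow> 'h) list \<Rightarrow>\<^sub>0 'k) \<Rightarrow> ('w list \<Rightarrow>\<^sub>0 'k) \<Rightarrow> 'w" where
  "pair3 H C g t = lin_ext (wscl C) t (\<lambda>w.
     lact (Omega1 C) (pair2 H C g (hten (Omega1 C) [w ! 0, w ! 1])) (w ! 2))"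

definition sharp :: "('k::field, 'h::ring_1) hopf \<Rightarrow> ('k, 'h, 'w::ring_1) calculus \<Rightarrow>
    (('w \<Rightarrow> 'h) list \<Rightarrow>\<^sub>0 'k) \<Rightarrow> 'w \<Rightarrow> ('w \<Rightarrow> 'h)" where
  "sharp H C g x = lin_ext (scl (VF H C)) g (\<lambda>W. ract (VF H C) (W ! 0) ((W ! 1) x))"

definition is_metric :: "('k::field, 'h::ring_1) hopf \<Rightarrow> ('k, 'h, 'w::ring_1) calculus \<Rightarrow>
    (('w \<Rightarrow> 'h) list \<Rightarrow>\<^sub>0 'k) \<Rightarrow> bool" where
  "is_metric H C g \<longleftrightarrow> g \<in> sym_fields H C \<and>
     vs_iso (Omega1 C) (VF H C) (sharp H C g) \<and>
     (\<forall>x\<in>carr (Omega1 C). \<forall>a. sharp H C g (ract (Omega1 C) x a) = ract (VF H C) (sharp H C g x) a)"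


section \<open>Connections\<close>

definition right_connection :: "('k::field, 'h::ring_1) hopf \<Rightarrow> ('k, 'h, 'w::ring_1) calculus \<Rightarrow>
    ('w \<Rightarrow> ('w list \<Rightarrow>\<^sub>0 'k)) \<Rightarrow> bool" where
  \<comment> \<open>extended by zero outside the one-forms, like the maps in \<^const>\<open>right_hom\<close>\<close>
  "right_connection H C D \<longleftrightarrow> lin_map (Omega1 C) (Omega2T C) D \<and>
     (\<forall>m\<in>carr (Omega1 C). \<forall>a. D (ract (Omega1 C) m a) =
        hpow_ract (Omega1 C) (D m) a + hten (Omega1 C) [m, dd C (emb C a)]) \<and>
     (\<forall>m. m \<notin> carr (Omega1 C) \<longrightarrow> D m = 0)"

text \<open>\<open>map_lcoact H C \<phi> y\<close> is \<open>\<phi>\<^sub>-\<^sub>1 \<otimes> \<phi>\<^sub>0(y)\<close>. In the sum of maps below, only such evaluations occur.\<close>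

definition map_lcoact :: "('k::field, 'h::ring_1) hopf \<Rightarrow> ('k, 'h, 'w::ring_1) calculus \<Rightarrow>
    ('w \<Rightarrow> ('w list \<Rightarrow>\<^sub>0 'k)) \<Rightarrow> 'w \<Rightarrow> ('h \<times> ('w list \<Rightarrow>\<^sub>0 'k) \<Rightarrow>\<^sub>0 'k)" where
  "map_lcoact H C \<phi> y = plin (lcoact (Omega1 C) y) (\<lambda>(ym1, y0).
     plin (lcoact2 H (Omega1 C) (\<phi> y0)) (\<lambda>(h, s). ten H (Omega2T C) (h * inv (antipode H) ym1) s))"

text \<open>\<open>oplus H C \<phi>\<close> is \<open>\<phi> \<oplus> \<phi>\<close>; \<open>p2, p1\<close> stand for \<open>\<phi>\<^sub>-\<^sub>2, \<phi>\<^sub>-\<^sub>1\<close>.\<close>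

definition oplus :: "('k::field, 'h::ring_1) hopf \<Rightarrow> ('k, 'h, 'w::ring_1) calculus \<Rightarrow>
    ('w \<Rightarrow> ('w list \<Rightarrow>\<^sub>0 'k)) \<Rightarrow> ('w list \<Rightarrow>\<^sub>0 'k) \<Rightarrow> ('w list \<Rightarrow>\<^sub>0 'k)" where
  "oplus H C \<phi> t = (let M = Omega1 C in plin t (\<lambda>w. let m = w ! 0; n = w ! 1 in
     plin (rcoact M m) (\<lambda>(m0, h). plin (comult H h) (\<lambda>(m1, m2).
       at_factors M 1 (braiding H M) (hcat M (\<phi> (ract M m0 (antipode H m1))) (hten M [lact M m2 n])) +
       plin (map_lcoact H C \<phi> (lact M m2 n)) (\<lambda>(p, s). plin (comult H p) (\<lambda>(p2, p1).
         hcat M (hten M [ract M (lact M p2 m0) (antipode H (p1 * m1))]) s))))))"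

definition vee :: "('k::field, 'h::ring_1) hopf \<Rightarrow> ('k, 'h, 'w::ring_1) calculus \<Rightarrow>
    ('w \<Rightarrow> ('w list \<Rightarrow>\<^sub>0 'k)) \<Rightarrow> ('w list \<Rightarrow>\<^sub>0 'k) \<Rightarrow> ('w list \<Rightarrow>\<^sub>0 'k)" where
  "vee H C \<phi> t = (if t \<in> sym_forms H C then at_factors (Omega1 C) 0 (sym_proj H C) (oplus H C \<phi> t) else 0)"

definition torsion_free :: "('k::field, 'h::ring_1) hopf \<Rightarrow> ('k, 'h, 'w::ring_1) calculus \<Rightarrow>
    ('w \<Rightarrow> ('w list \<Rightarrow>\<^sub>0 'k)) \<Rightarrow> bool" where
  "torsion_free H C D \<longleftrightarrow> (\<forall>m\<in>carr (Omega1 C). wedge C (D m) + dd C m = 0)"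

definition metric_compatible :: "('k::field, 'h::ring_1) hopf \<Rightarrow> ('k, 'h, 'w::ring_1) calculus \<Rightarrow>
    (('w \<Rightarrow> 'h) list \<Rightarrow>\<^sub>0 'k) \<Rightarrow> ('w \<Rightarrow> ('w list \<Rightarrow>\<^sub>0 'k)) \<Rightarrow> bool" where
  "metric_compatible H C g D \<longleftrightarrow>
     (\<forall>t\<in>sym_forms H C. pair3 H C g (vee H C D t) = dd C (emb C (pair2 H C g t)))"

definition levi_civita :: "('k::field, 'h::ring_1) hopf \<Rightarrow> ('k, 'h, 'w::ring_1) calculus \<Rightarrow>
    (('w \<Rightarrow> 'h) list \<Rightarrow>\<^sub>0 'k) \<Rightarrow> ('w \<Rightarrow> ('w list \<Rightarrow>\<^sub>0 'k)) \<Rightarrow> bool" where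
  "levi_civita H C g D \<longleftrightarrow>
     right_connection H C D \<and> torsion_free H C D \<and> metric_compatible H C g D"

definition Hom_form_sym :: "('k::field, 'h::ring_1) hopf \<Rightarrow> ('k, 'h, 'w::ring_1) calculus \<Rightarrow>
    ('k, 'w \<Rightarrow> ('w list \<Rightarrow>\<^sub>0 'k)) vspace" where
  "Hom_form_sym H C = \<lparr>carr = right_hom (carr (Omega1 C)) (ract (Omega1 C))
       (sym_forms H C) (hpow_ract (Omega1 C)), scl = (\<lambda>c f x. pscale c (f x))\<rparr>"

definition Hom_sym_form :: "('k::field, 'h::ring_1) hopf \<Rightarrow> ('k, 'h, 'w::ring_1) calculus \<Rightarrow>
    ('k, ('w list \<Rightarrow>\<^sub>0 'k) \<Rightarrow> 'w) vspace" where
  "Hom_sym_form H C = \<lparr>carr = right_hom (sym_forms H C) (hpow_ract (Omega1 C))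
       (carr (Omega1 C)) (ract (Omega1 C)), scl = (\<lambda>c f x. wscl C c (f x))\<rparr>"

definition Phi :: "('k::field, 'h::ring_1) hopf \<Rightarrow> ('k, 'h, 'w::ring_1) calculus \<Rightarrow>
    (('w \<Rightarrow> 'h) list \<Rightarrow>\<^sub>0 'k) \<Rightarrow> ('w \<Rightarrow> ('w list \<Rightarrow>\<^sub>0 'k)) \<Rightarrow> (('w list \<Rightarrow>\<^sub>0 'k) \<Rightarrow> 'w)" where
  "Phi H C g \<phi> = (\<lambda>t. pair3 H C g (vee H C \<phi> t))"


section \<open>The structure constants connection\<close>

definition left_coinvariants :: "('k::field, 'h::ring_1) hopf \<Rightarrow> ('k, 'h, 'm::ab_group_add) bibimodule \<Rightarrow>
    'm set" where
  "left_coinvariants H M = {m \<in> carr M. lcoact M m = ten H M 1 m}"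

text \<open>\<open>\<omega> 0, \<dots>, \<omega> (n - 1)\<close> is a basis of the left coinvariant one-forms, with \<open>\<chi>\<close> and \<open>x\<close> as chosen
  for the definition of the structure constants.\<close>

definition structure_data :: "('k::field, 'h::ring_1) hopf \<Rightarrow> ('k, 'h, 'w::ring_1) calculus \<Rightarrow>
    nat \<Rightarrow> (nat \<Rightarrow> 'w) \<Rightarrow> (nat \<Rightarrow> 'h \<Rightarrow> 'k) \<Rightarrow> (nat \<Rightarrow> 'h) \<Rightarrow> bool" where
  "structure_data H C n \<omega> \<chi> x \<longleftrightarrow>
     inj_on \<omega> {..<n} \<and> \<not> module.dependent (wscl C) (\<omega> ` {..<n}) \<and>
     module.span (wscl C) (\<omega> ` {..<n}) = left_coinvariants H (Omega1 C) \<and>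
     (\<forall>i<n. Vector_Spaces.linear (scl H) (*) (\<chi> i)) \<and>
     (\<forall>a. dd C (emb C a) = (\<Sum>i<n. lin_ext (wscl C) (comult H a) (\<lambda>(a1, a2).
        wscl C (\<chi> i a2) (ract (Omega1 C) (\<omega> i) a1)))) \<and>
     (\<forall>i<n. counit H (x i) = 0) \<and>
     (\<forall>i<n. \<forall>j<n. \<chi> j (x i) = (if i = j then 1 else 0))"

definition structure_const :: "('k::field, 'h::ring_1) hopf \<Rightarrow>
    (nat \<Rightarrow> 'h \<Rightarrow> 'k) \<Rightarrow> (nat \<Rightarrow> 'h) \<Rightarrow> nat \<Rightarrow> nat \<Rightarrow> nat \<Rightarrow> 'k" where
  "structure_const H \<chi> x i k j = lin_ext (*) (comult H (x i)) (\<lambda>(x1, x2). \<chi> k x1 * \<chi> j x2)"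

definition structure_connection :: "('k::field, 'h::ring_1) hopf \<Rightarrow> ('k, 'h, 'w::ring_1) calculus \<Rightarrow>
    nat \<Rightarrow> (nat \<Rightarrow> 'w) \<Rightarrow> (nat \<Rightarrow> 'h \<Rightarrow> 'k) \<Rightarrow> (nat \<Rightarrow> 'h) \<Rightarrow> ('w \<Rightarrow> ('w list \<Rightarrow>\<^sub>0 'k))" where
  "structure_connection H C n \<omega> \<chi> x = (THE D. right_connection H C D \<and>
     (\<forall>i<n. D (\<omega> i) = - (\<Sum>j<n. \<Sum>k<n.
        hten (Omega1 C) [\<omega> j, wscl C (structure_const H \<chi> x i k j) (\<omega> k)])))"

text \<open>The right-hand side to which the inverse of \<open>\<Phi>\<close> is applied, for a given connection.\<close>

definition metric_defect :: "('k::field, 'h::ring_1) hopf \<Rightarrow> ('k, 'h, 'w::ring_1) calculus \<Rightarrow>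
    (('w \<Rightarrow> 'h) list \<Rightarrow>\<^sub>0 'k) \<Rightarrow> ('w \<Rightarrow> ('w list \<Rightarrow>\<^sub>0 'k)) \<Rightarrow> (('w list \<Rightarrow>\<^sub>0 'k) \<Rightarrow> 'w)" where
  "metric_defect H C g D = (\<lambda>t. if t \<in> sym_forms H C
     then dd C (emb C (pair2 H C g t)) - pair3 H C g (oplus H C D t) else 0)"

end

theory Submission
  imports Defs
begin

text \<open>
  Every map in the definition of a Levi-Civita connection depends linearly on the connection, so the
  theorem reduces to three facts. (1) Two torsion-free connections differ by a right linear map
  \<open>\<phi>\<close> with \<open>\<and> \<circ> \<phi> = 0\<close>, and for a Woronowicz calculus the kernel of \<open>\<and>\<close> in degree two is
  \<open>\<Omega>\<^sup>1 \<or> \<Omega>\<^sup>1\<close>. (2) \<open>D \<oplus> D\<close> is again a right connection, so the metric defect of \<open>D\<close> is right linear.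
  (3) \<open>\<^bold>g\<close> vanishes on \<open>\<Omega>\<^sup>1 \<and> \<Omega>\<^sup>1\<close>, so the projection \<open>\<pi>\<^sub>\<or>\<close> is invisible to \<open>\<^bold>g\<close>.

  The braiding is handled on the tensors \<open>\<omega> \<otimes> \<eta>k\<close> with \<open>\<omega>\<close> left and \<open>\<eta>\<close> right coinvariant, which span
  \<open>\<Omega>\<^sup>1 \<otimes> \<Omega>\<^sup>1\<close> and are sent to \<open>\<eta> \<otimes> \<omega>k\<close>; this gives its right linearity, its inverse, and
  \<open>\<langle>\<sigma>\<^bold>g, t\<rangle> = \<langle>\<^bold>g, \<sigma>t\<rangle>\<close>, from which (3) follows since \<open>\<sigma>\<^bold>g = \<^bold>g\<close>. Instead of a structure theorem for
  Hopf modules only dual bases are used: \<open>(\<^bold>g\<^sup>\<sharp>)\<^sup>-\<^sup>1(\<^bold>g\<^sup>a)\<close> and \<open>\<^bold>g\<^sub>a\<close> form one, and so do the \<open>\<omega>\<^sup>i\<close>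
  with the coefficients of \<open>m\<^sub>0S\<^sup>-\<^sup>1(m\<^sub>-\<^sub>1) m\<^sub>-\<^sub>2\<close>. For the latter the Maurer-Cartan equation
  \<open>d\<omega>\<^sup>i = C\<^sup>i\<^sub>k\<^sub>j \<omega>\<^sup>j \<and> \<omega>\<^sup>k\<close> follows from \<open>dd = 0\<close>.
\<close>

section \<open>Linear extension, tensor products and tensor powers\<close>

text \<open>Elements of a quotient are chosen representatives, hence formal sums, and the maps of
  the statement are formulas on formal sums. The descent of each formula to tensor products over
  \<open>H\<close> has to be proved, and many of the Sweedler computations below do just that; only
  then can maps be compared on a convenient spanning set. The coactions of vector fields raise a
  further obstacle: they are definite descriptions, about which nothing is known until a dual basis
  of one-forms shows that a tensor is determined by its evaluations. The metric supplies such a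
  basis without structure constants. The same basis gives a torsion-free connection for the
  surjectivity claim, where no structure data is at hand: since \<and> maps onto the two-forms,
  suitable values can be prescribed at the basis elements, and the Leibniz rule dictates the
  rest.\<close>

lemma lin_ext_superset:
  assumes "vector_space s" "finite A" "Poly_Mapping.keys t \<subseteq> A"
  shows "lin_ext s t f = (\<Sum>x\<in>A. s (Poly_Mapping.lookup t x) (f x))"
proof -
  interpret vector_space s by fact
  show ?thesis unfolding lin_ext_def
    by (rule sum.mono_neutral_left) (use assms in \<open>auto simp: in_keys_iff\<close>)
qed

lemma lin_ext_cong:
  "t = u \<Longrightarrow> (\<And>x. x \<in> Poly_Mapping.keys u \<Longrightarrow> f x = g x) \<Longrightarrow> lin_ext s t f = lin_ext s u g"
  by (simp add: lin_ext_def)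

lemma lin_ext_add:
  assumes "vector_space s"
  shows "lin_ext s (t + u) f = lin_ext s t f + lin_ext s u f"
proof -
  interpret vector_space s by fact
  let ?A = "Poly_Mapping.keys t \<union> Poly_Mapping.keys u"
  have "Poly_Mapping.keys (t + u) \<subseteq> ?A" by (rule Poly_Mapping.keys_add)
  then show ?thesis
    by (simp add: lin_ext_superset[OF assms, of ?A] lookup_add scale_left_distrib sum.distrib)
qed

lemma keys_pscale: "Poly_Mapping.keys (pscale c t) \<subseteq> Poly_Mapping.keys t"
  by (auto simp: in_keys_iff lookup_pscale)

lemma lin_ext_pscale:
  assumes "vector_space s"
  shows "lin_ext s (pscale c t) f = s c (lin_ext s t f)"
proof -
  interpret vector_space s by fact
  show ?thesis
    using keys_pscale[of c t]
    by (simp add: lin_ext_superset[OF assms, of "Poly_Mapping.keys t"] lookup_pscale scale_sum_right)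
qed

lemma lin_ext_single:
  assumes "vector_space s"
  shows "lin_ext s (Poly_Mapping.single x c) f = s c (f x)"
proof -
  interpret vector_space s by fact
  show ?thesis by (simp add: lin_ext_superset[OF assms, of "{x}"])
qed

lemma lin_ext_0 [simp]: "lin_ext s 0 f = 0"
  by (simp add: lin_ext_def)

lemma lin_ext_minus:
  assumes "vector_space s"
  shows "lin_ext s (t - u) f = lin_ext s t f - lin_ext s u f"
  using lin_ext_add[OF assms, of "t - u" u f] by simp

lemma lin_ext_uminus:
  assumes "vector_space s"
  shows "lin_ext s (- u) f = - lin_ext s u f"
  using lin_ext_minus[OF assms, of 0 u f] by simp

lemma lin_ext_sum:
  assumes "vector_space s"
  shows "lin_ext s (\<Sum>a\<in>A. t a) f = (\<Sum>a\<in>A. lin_ext s (t a) f)"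
  by (induction A rule: infinite_finite_induct) (simp_all add: lin_ext_add[OF assms])

lemma lin_ext_fun_add:
  assumes "vector_space s"
  shows "lin_ext s t (\<lambda>x. f x + g x) = lin_ext s t f + lin_ext s t g"
proof -
  interpret vector_space s by fact
  show ?thesis by (simp add: lin_ext_def scale_right_distrib sum.distrib)
qed

lemma lin_ext_fun_scale:
  assumes "vector_space s"
  shows "lin_ext s t (\<lambda>x. s c (f x)) = s c (lin_ext s t f)"
proof -
  interpret vector_space s by fact
  show ?thesis by (simp add: lin_ext_def scale_sum_right mult.commute)
qed

lemma lin_ext_fun_0:
  assumes "vector_space s"
  shows "lin_ext s t (\<lambda>x. 0) = 0"
proof -
  interpret vector_space s by fact
  show ?thesis by (simp add: lin_ext_def)
qed

lemma lin_ext_fun_diff: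
  assumes "vector_space s"
  shows "lin_ext s t (\<lambda>x. f x - g x) = lin_ext s t f - lin_ext s t g"
  using lin_ext_fun_add[OF assms, of t "\<lambda>x. f x - g x" g] by simp

lemma lin_ext_fun_sum:
  assumes "vector_space s"
  shows "lin_ext s t (\<lambda>x. \<Sum>a\<in>A. f a x) = (\<Sum>a\<in>A. lin_ext s t (f a))"
  by (induction A rule: infinite_finite_induct)
    (simp_all add: lin_ext_fun_add[OF assms] lin_ext_fun_0[OF assms])

section \<open>Subspaces of a vector space and maps that are linear on them\<close>

definition is_vs :: "('k::field, 'v::ab_group_add, 'p) vspace_scheme \<Rightarrow> bool" where
  "is_vs V \<longleftrightarrow> vector_space (scl V) \<and> module.subspace (scl V) (carr V)"

text \<open>Unlike \<open>lin_map\<close>, no carrier is prescribed for the values, so one notion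
  serves maps into tensor powers, into \<open>H\<close> and into forms; closure is proved
  separately.\<close>

definition linear_on :: "('k, 'v::ab_group_add, 'p) vspace_scheme \<Rightarrow> ('k \<Rightarrow> 'u::ab_group_add \<Rightarrow> 'u) \<Rightarrow> ('v \<Rightarrow> 'u) \<Rightarrow> bool"
  where "linear_on V s f \<longleftrightarrow> (\<forall>x\<in>carr V. \<forall>y\<in>carr V. f (x + y) = f x + f y) \<and>
    (\<forall>c. \<forall>x\<in>carr V. f (scl V c x) = s c (f x))"

lemma is_vsD:
  assumes "is_vs V"
  shows "vector_space (scl V)" "0 \<in> carr V" "x \<in> carr V \<Longrightarrow> y \<in> carr V \<Longrightarrow> x + y \<in> carr V"
    "x \<in> carr V \<Longrightarrow> scl V c x \<in> carr V" "x \<in> carr V \<Longrightarrow> y \<in> carr V \<Longrightarrow> x - y \<in> carr V"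
    "x \<in> carr V \<Longrightarrow> - x \<in> carr V"
proof -
  interpret vector_space "scl V" using assms by (simp add: is_vs_def)
  have s: "subspace (carr V)" using assms by (simp add: is_vs_def)
  show "vector_space (scl V)" by unfold_locales
  show "0 \<in> carr V" "x \<in> carr V \<Longrightarrow> y \<in> carr V \<Longrightarrow> x + y \<in> carr V"
    "x \<in> carr V \<Longrightarrow> scl V c x \<in> carr V" "x \<in> carr V \<Longrightarrow> y \<in> carr V \<Longrightarrow> x - y \<in> carr V"
    "x \<in> carr V \<Longrightarrow> - x \<in> carr V"
    using s by (simp_all add: subspace_0 subspace_add subspace_scale subspace_diff subspace_neg)
qed

lemma is_vs_sum: "is_vs V \<Longrightarrow> (\<And>a. a \<in> A \<Longrightarrow> f a \<in> carr V) \<Longrightarrow> (\<Sum>a\<in>A. f a) \<in> carr V"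
  by (induction A rule: infinite_finite_induct) (simp_all add: is_vsD)

lemma lin_ext_closed:
  assumes "is_vs V" "\<And>x. x \<in> Poly_Mapping.keys t \<Longrightarrow> f x \<in> carr V"
  shows "lin_ext (scl V) t f \<in> carr V"
  unfolding lin_ext_def by (intro is_vs_sum is_vsD assms)

lemma linear_on_0:
  assumes "is_vs V" "linear_on V s f"
  shows "f 0 = 0"
proof -
  have "f (0 + 0) = f 0 + f 0" using assms is_vsD(2)[OF assms(1)] unfolding linear_on_def by blast
  then show ?thesis by simp
qed

lemma linear_on_sum:
  assumes "is_vs V" "linear_on V s f" "\<And>a. a \<in> A \<Longrightarrow> g a \<in> carr V"
  shows "f (\<Sum>a\<in>A. g a) = (\<Sum>a\<in>A. f (g a))"
  using assms(3)
proof (induction A rule: infinite_finite_induct)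
  case (insert x F)
  then have "f (g x + (\<Sum>a\<in>F. g a)) = f (g x) + f (\<Sum>a\<in>F. g a)"
    using assms(1,2) is_vs_sum[OF assms(1), of F g] unfolding linear_on_def by blast
  with insert show ?case by simp
qed (simp_all add: linear_on_0[OF assms(1,2)])

lemma linear_on_diff:
  assumes "is_vs V" "linear_on V s f" "x \<in> carr V" "y \<in> carr V"
  shows "f (x - y) = f x - f y"
proof -
  have "f ((x - y) + y) = f (x - y) + f y"
    using assms is_vsD(5)[OF assms(1,3,4)] unfolding linear_on_def by blast
  then show ?thesis by simp
qed

lemma linear_on_lin_ext:
  assumes "is_vs V" "linear_on V s g" "\<And>x. x \<in> Poly_Mapping.keys t \<Longrightarrow> f x \<in> carr V"
  shows "g (lin_ext (scl V) t f) = lin_ext s t (\<lambda>x. g (f x))"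
proof -
  have "g (lin_ext (scl V) t f) = (\<Sum>x\<in>Poly_Mapping.keys t. g (scl V (Poly_Mapping.lookup t x) (f x)))"
    unfolding lin_ext_def by (rule linear_on_sum[OF assms(1,2)]) (simp add: assms is_vsD)
  also have "\<dots> = lin_ext s t (\<lambda>x. g (f x))"
    unfolding lin_ext_def using assms by (intro sum.cong) (auto simp: linear_on_def)
  finally show ?thesis .
qed

lemma lin_ext_plin:
  assumes "vector_space s"
  shows "lin_ext s (plin t f) g = lin_ext s t (\<lambda>x. lin_ext s (f x) g)"
  by (simp add: lin_ext_def[of pscale] lin_ext_sum[OF assms] lin_ext_pscale[OF assms])
    (simp add: lin_ext_def[of s t])

lemma lin_ext_swap:
  assumes "vector_space s"
  shows "lin_ext s t (\<lambda>x. lin_ext s u (\<lambda>y. f x y)) = lin_ext s u (\<lambda>y. lin_ext s t (\<lambda>x. f x y))"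
proof -
  interpret vector_space s by fact
  show ?thesis
    by (simp add: lin_ext_def scale_sum_right mult.commute) (rule sum.swap)
qed

lemma lin_ext_id:
  fixes t :: "'x \<Rightarrow>\<^sub>0 'k::field"
  shows "plin t (\<lambda>x. Poly_Mapping.single x 1) = t"
proof -
  have "pscale c (Poly_Mapping.single x 1) = Poly_Mapping.single x c" for c :: 'k and x :: 'x
    by (rule poly_mapping_eqI) (simp add: lookup_pscale lookup_single when_def)
  moreover have "(\<Sum>x\<in>Poly_Mapping.keys t. Poly_Mapping.single x (Poly_Mapping.lookup t x)) = t"
    by (rule poly_mapping_eqI)
      (auto simp: lookup_sum lookup_single when_def sum.If_cases in_keys_iff)
  ultimately show ?thesis by (simp add: lin_ext_def)
qed

section \<open>Quotients and their representatives\<close>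

lemma qmap_plin:
  assumes "module.subspace pscale R"
  shows "qmap R (plin t f) = plin t (\<lambda>x. qmap R (f x))"
proof -
  interpret q: Vector_Spaces.linear pscale pscale "qmap R" by (rule qmap(1)[OF assms])
  show ?thesis by (simp add: lin_ext_def q.sum q.scale)
qed

lemma subspace_span_pscale: "module.subspace pscale (module.span pscale (S :: ('x \<Rightarrow>\<^sub>0 'k::field) set))"
proof -
  interpret vector_space "pscale :: 'k \<Rightarrow> ('x \<Rightarrow>\<^sub>0 'k) \<Rightarrow> _" by (rule vector_space_pscale)
  show ?thesis by (rule subspace_span)
qed

lemma lin_ext_vanish_span:
  fixes S :: "('x \<Rightarrow>\<^sub>0 'k::field) set"
  assumes "vector_space s" "\<And>r. r \<in> S \<Longrightarrow> lin_ext s r f = 0" "t \<in> module.span pscale S"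
  shows "lin_ext s t f = 0"
proof -
  interpret vector_space "pscale :: 'k \<Rightarrow> ('x \<Rightarrow>\<^sub>0 'k) \<Rightarrow> _" by (rule vector_space_pscale)
  interpret s: vector_space s by fact
  show ?thesis using assms(3)
    by (induction rule: span_induct_alt)
      (simp_all add: lin_ext_add[OF assms(1)] lin_ext_pscale[OF assms(1)] assms(2))
qed

text \<open>A representative differs from the original sum by relations only, so an extension that
  kills the generating relations cannot see which representative was chosen. The universal
  properties of the tensor products rest on this fact.\<close>

lemma lin_ext_qmap:
  fixes S :: "('x \<Rightarrow>\<^sub>0 'k::field) set"
  assumes "vector_space s" "\<And>r. r \<in> S \<Longrightarrow> lin_ext s r f = 0"
  shows "lin_ext s (qmap (module.span pscale S) t) f = lin_ext s t f"
proof -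
  have "lin_ext s (qmap (module.span pscale S) t - t) f = 0"
    by (rule lin_ext_vanish_span[OF assms(1) assms(2) qmap(2)[OF subspace_span_pscale]])
  then show ?thesis by (simp add: lin_ext_minus[OF assms(1)])
qed

lemma keys_span:
  fixes S :: "('x \<Rightarrow>\<^sub>0 'k::field) set"
  assumes "\<And>r. r \<in> S \<Longrightarrow> Poly_Mapping.keys r \<subseteq> K" "t \<in> module.span pscale S"
  shows "Poly_Mapping.keys t \<subseteq> K"
proof -
  interpret vector_space "pscale :: 'k \<Rightarrow> ('x \<Rightarrow>\<^sub>0 'k) \<Rightarrow> _" by (rule vector_space_pscale)
  show ?thesis using assms(2)
  proof (induction rule: span_induct_alt)
    case (step c x y)
    have "Poly_Mapping.keys (pscale c x + y) \<subseteq> Poly_Mapping.keys (pscale c x) \<union> Poly_Mapping.keys y"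
      by (rule Poly_Mapping.keys_add)
    then show ?case using step assms(1)[OF step(1)] keys_pscale[of c x] by blast
  qed simp
qed

text \<open>The projection \<open>qmap\<close> is an arbitrary choice, yet it changes a sum only by
  relations, which involve basis elements from \<open>K\<close> alone. This keeps representatives
  supported on the carrier, where the module laws hold.\<close>

lemma keys_qmap:
  fixes S :: "('x \<Rightarrow>\<^sub>0 'k::field) set"
  assumes "\<And>r. r \<in> S \<Longrightarrow> Poly_Mapping.keys r \<subseteq> K" "Poly_Mapping.keys t \<subseteq> K"
  shows "Poly_Mapping.keys (qmap (module.span pscale S) t) \<subseteq> K"
proof -
  have "Poly_Mapping.keys (qmap (module.span pscale S) t - t) \<subseteq> K"
    by (rule keys_span[OF assms(1) qmap(2)[OF subspace_span_pscale]])
  then have "Poly_Mapping.keys ((qmap (module.span pscale S) t - t) + t) \<subseteq> K"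
    using assms(2) Poly_Mapping.keys_add[of "qmap (module.span pscale S) t - t" t] by blast
  then show ?thesis by simp
qed

lemma qmap_idem:
  assumes "module.subspace pscale (R :: ('x \<Rightarrow>\<^sub>0 'k::field) set)"
  shows "qmap R (qmap R t) = qmap R t"
  by (simp add: qmap_eq_iff[OF assms] qmap(2)[OF assms])

lemma is_vs_quotient:
  fixes R :: "('x \<Rightarrow>\<^sub>0 'k::field) set"
  assumes "module.subspace pscale R"
  shows "is_vs \<lparr>carr = qmap R ` {t. Poly_Mapping.keys t \<subseteq> K}, scl = pscale\<rparr>"
proof -
  interpret vector_space "pscale :: 'k \<Rightarrow> ('x \<Rightarrow>\<^sub>0 'k) \<Rightarrow> _" by (rule vector_space_pscale)
  interpret q: Vector_Spaces.linear pscale pscale "qmap R" by (rule qmap(1)[OF assms])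
  have "subspace (qmap R ` {t. Poly_Mapping.keys t \<subseteq> K})"
  proof (intro q.subspace_image subspaceI CollectI)
    fix a b :: "'x \<Rightarrow>\<^sub>0 'k" and c :: 'k
    assume a: "a \<in> {t. Poly_Mapping.keys t \<subseteq> K}"
    then show "Poly_Mapping.keys (pscale c a) \<subseteq> K"
      using keys_pscale[of c a] by blast
    assume "b \<in> {t. Poly_Mapping.keys t \<subseteq> K}"
    with a show "Poly_Mapping.keys (a + b) \<subseteq> K"
      using Poly_Mapping.keys_add[of a b] by blast
  qed simp
  then show ?thesis by (simp add: is_vs_def vector_space_pscale)
qed

section \<open>Tensor products over the ground field\<close>

lemma trel_keys:
  assumes "is_vs V" "is_vs U" "r \<in> trel V U"
  shows "Poly_Mapping.keys r \<subseteq> carr V \<times> carr U"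
  using assms(3) unfolding trel_def
  by (auto dest!: subsetD[OF Poly_Mapping.keys_diff] simp: is_vsD[OF assms(1)] is_vsD[OF assms(2)] split: if_splits)

lemma tsp_is_vs [simp]: "is_vs (tsp V U)"
  unfolding tsp_def by (rule is_vs_quotient[OF subspace_span_pscale])

lemma scl_tsp [simp]: "scl (tsp V U) = pscale" by (simp add: tsp_def)

lemma ten_closed [simp]: "x \<in> carr V \<Longrightarrow> y \<in> carr U \<Longrightarrow> ten V U x y \<in> carr (tsp V U)"
  unfolding tsp_def ten_def by (auto intro!: imageI)

lemma tsp_keys:
  assumes "is_vs V" "is_vs U" "t \<in> carr (tsp V U)"
  shows "Poly_Mapping.keys t \<subseteq> carr V \<times> carr U"
proof -
  obtain u where "t = qmap (module.span pscale (trel V U)) u" "Poly_Mapping.keys u \<subseteq> carr V \<times> carr U"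
    using assms(3) by (auto simp: tsp_def)
  then show ?thesis using keys_qmap[OF trel_keys[OF assms(1,2)]] by simp
qed

text \<open>An element of the quotient is a fixed point of \<open>qmap\<close> and thereby a formal
  sum in its own class; replacing each basis pair by its simple tensor returns it.\<close>

lemma tsp_expand:
  assumes "t \<in> carr (tsp V U)"
  shows "plin t (\<lambda>(x, y). ten V U x y) = t"
proof -
  let ?q = "qmap (module.span pscale (trel V U))"
  have t: "?q t = t" using assms qmap_idem[OF subspace_span_pscale] by (auto simp: tsp_def)
  have "plin t (\<lambda>(x, y). ten V U x y) = plin t (\<lambda>p. ?q (Poly_Mapping.single p 1))"
    by (rule lin_ext_cong) (auto simp: ten_def)
  also have "\<dots> = t" by (simp add: qmap_plin[OF subspace_span_pscale, symmetric] lin_ext_id t)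
  finally show ?thesis .
qed

text \<open>The universal property: the four families in \<open>trel\<close> are exactly what
  bilinearity kills.\<close>

lemma lin_ext_ten:
  assumes s: "vector_space s" and "\<And>y. y \<in> carr U \<Longrightarrow> linear_on V s (\<lambda>x. f x y)"
    "\<And>x. x \<in> carr V \<Longrightarrow> linear_on U s (f x)" "x \<in> carr V" "y \<in> carr U"
  shows "lin_ext s (ten V U x y) (\<lambda>(x, y). f x y) = f x y"
proof -
  interpret vector_space s by fact
  have "lin_ext s (ten V U x y) (\<lambda>(x, y). f x y) = lin_ext s (Poly_Mapping.single (x, y) 1) (\<lambda>(x, y). f x y)"
    unfolding ten_def
    by (rule lin_ext_qmap[OF s])
      (use assms in \<open>auto simp: trel_def lin_ext_minus lin_ext_single linear_on_def\<close>)
  then show ?thesis by (simp add: lin_ext_single[OF s])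
qed

lemma qmap_span_eqI:
  fixes S :: "('x \<Rightarrow>\<^sub>0 'k::field) set"
  assumes "a - b \<in> S"
  shows "qmap (module.span pscale S) a = qmap (module.span pscale S) b"
proof -
  interpret vector_space "pscale :: 'k \<Rightarrow> ('x \<Rightarrow>\<^sub>0 'k) \<Rightarrow> _" by (rule vector_space_pscale)
  show ?thesis unfolding qmap_eq_iff[OF subspace_span_pscale] by (rule span_base[OF assms])
qed

lemma qmap_add:
  assumes "module.subspace pscale (R :: ('x \<Rightarrow>\<^sub>0 'k::field) set)"
  shows "qmap R (a + b) = qmap R a + qmap R b" "qmap R (pscale c a) = pscale c (qmap R a)"
proof -
  interpret q: Vector_Spaces.linear pscale pscale "qmap R" by (rule qmap(1)[OF assms])
  show "qmap R (a + b) = qmap R a + qmap R b" "qmap R (pscale c a) = pscale c (qmap R a)"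
    by (simp_all add: q.add q.scale)
qed

lemma pscale_single: "pscale c (Poly_Mapping.single x d) = Poly_Mapping.single x (c * d)"
  by (rule poly_mapping_eqI) (simp add: lookup_pscale lookup_single when_def)

lemma ten_add_left:
  assumes "x \<in> carr V" "y \<in> carr V" "z \<in> carr U"
  shows "ten V U (x + y) z = ten V U x z + ten V U y z"
  unfolding ten_def qmap_add[OF subspace_span_pscale, symmetric]
  by (rule qmap_span_eqI) (use assms in \<open>force simp: trel_def diff_diff_eq\<close>)

lemma ten_add_right:
  assumes "x \<in> carr V" "y \<in> carr U" "z \<in> carr U"
  shows "ten V U x (y + z) = ten V U x y + ten V U x z"
  unfolding ten_def qmap_add[OF subspace_span_pscale, symmetric]
  by (rule qmap_span_eqI) (use assms in \<open>force simp: trel_def diff_diff_eq\<close>)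

lemma ten_scale_left:
  assumes "x \<in> carr V" "z \<in> carr U"
  shows "ten V U (scl V c x) z = pscale c (ten V U x z)"
  unfolding ten_def qmap_add[OF subspace_span_pscale, symmetric]
  by (rule qmap_span_eqI) (use assms in \<open>auto simp: trel_def pscale_single\<close>)

lemma ten_scale_right:
  assumes "x \<in> carr V" "z \<in> carr U"
  shows "ten V U x (scl U c z) = pscale c (ten V U x z)"
  unfolding ten_def qmap_add[OF subspace_span_pscale, symmetric]
  by (rule qmap_span_eqI) (use assms in \<open>auto simp: trel_def pscale_single\<close>)

section \<open>Tensor powers over \<open>H\<close>\<close>

lemma scl_hpow [simp]: "scl (hpow M n) = pscale" by (simp add: hpow_def)

lemma hpow_is_vs [simp]: "is_vs (hpow M n)"
  unfolding hpow_def by (rule is_vs_quotient[OF subspace_span_pscale])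

lemma hten_closed: "set w \<subseteq> carr M \<Longrightarrow> n = length w \<Longrightarrow> hten M w \<in> carr (hpow M n)"
  unfolding hpow_def hten_def by (auto intro!: imageI)

definition words :: "('k::field, 'h, 'm::ab_group_add) bibimodule \<Rightarrow> nat \<Rightarrow> 'm list set" where
  "words M n = {w. length w = n \<and> set w \<subseteq> carr M}"

lemma words_2: "w \<in> words M 2 \<longleftrightarrow> (\<exists>x\<in>carr M. \<exists>y\<in>carr M. w = [x, y])"
  by (auto simp: words_def length_Suc_conv numeral_2_eq_2)

lemma words_3: "w \<in> words M 3 \<longleftrightarrow> (\<exists>x\<in>carr M. \<exists>y\<in>carr M. \<exists>z\<in>carr M. w = [x, y, z])"
  by (auto simp: words_def length_Suc_conv numeral_3_eq_3)

lemma hpow_fix: "t \<in> carr (hpow M n) \<Longrightarrow> qmap (module.span pscale (hrel M n)) t = t"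
  using qmap_idem[OF subspace_span_pscale] by (auto simp: hpow_def)

lemma lin_ext_hten:
  assumes s: "vector_space s" and "\<And>r. r \<in> hrel M (length w) \<Longrightarrow> lin_ext s r f = 0"
  shows "lin_ext s (hten M w) f = f w"
proof -
  interpret vector_space s by fact
  have "lin_ext s (hten M w) f = lin_ext s (Poly_Mapping.single w 1) f"
    unfolding hten_def by (rule lin_ext_qmap[OF s]) (rule assms(2))
  then show ?thesis by (simp add: lin_ext_single[OF s])
qed

lemma lin_ext_hten1:
  assumes s: "vector_space s" and "linear_on M s (\<lambda>x. f [x])"
  shows "lin_ext s (hten M [x]) f = f [x]"
proof (rule lin_ext_hten[OF s])
  interpret vector_space s by fact
  have e1: "length (u @ [a] @ v) = length [x] \<longleftrightarrow> u = [] \<and> v = []" for u v and a :: 'b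
    by (auto simp: length_Suc_conv)
  fix r assume "r \<in> hrel M (length [x])"
  then show "lin_ext s r f = 0"
    unfolding hrel_def e1 using assms
    by (auto simp: lin_ext_minus lin_ext_single linear_on_def)
qed

text \<open>The universal property of the tensor square over \<open>H\<close>, with bilinearity and
  balancing asked on the carrier. The facts \<open>e1\<close> and \<open>e2\<close> list the
  positions at which a relation can occur in a word of length two.\<close>

lemma lin_ext_hten2:
  fixes M :: "('k::field, 'h, 'm::ab_group_add) bibimodule"
  assumes s: "vector_space s" and "\<And>y. y \<in> carr M \<Longrightarrow> linear_on M s (\<lambda>x. f [x, y])"
    "\<And>x. x \<in> carr M \<Longrightarrow> linear_on M s (\<lambda>y. f [x, y])"
    "\<And>x y a. x \<in> carr M \<Longrightarrow> y \<in> carr M \<Longrightarrow> f [ract M x a, y] = f [x, lact M a y]"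
  shows "lin_ext s (hten M [x, y]) f = f [x, y]"
proof (rule lin_ext_hten[OF s])
  interpret vector_space s by fact
  have e1: "length (u @ [a] @ v) = length [x, y] \<longleftrightarrow> (\<exists>z. u = [] \<and> v = [z] \<or> u = [z] \<and> v = [])" for u v and a :: 'm
    by (cases u) (auto simp: length_Suc_conv)
  have e2: "length (u @ [a, b] @ v) = length [x, y] \<longleftrightarrow> u = [] \<and> v = []" for u v and a b :: 'm
    by (cases u) (auto simp: length_Suc_conv)
  fix r assume "r \<in> hrel M (length [x, y])"
  then show "lin_ext s r f = 0"
    unfolding hrel_def e1 e2 using assms
    by (auto simp: lin_ext_minus lin_ext_single linear_on_def)
qed

lemma lin_ext_hten3:
  fixes M :: "('k::field, 'h, 'm::ab_group_add) bibimodule"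
  assumes s: "vector_space s" and "\<And>y z. y \<in> carr M \<Longrightarrow> z \<in> carr M \<Longrightarrow> linear_on M s (\<lambda>x. f [x, y, z])"
    "\<And>x z. x \<in> carr M \<Longrightarrow> z \<in> carr M \<Longrightarrow> linear_on M s (\<lambda>y. f [x, y, z])"
    "\<And>x y. x \<in> carr M \<Longrightarrow> y \<in> carr M \<Longrightarrow> linear_on M s (\<lambda>z. f [x, y, z])"
    "\<And>x y z a. x \<in> carr M \<Longrightarrow> y \<in> carr M \<Longrightarrow> z \<in> carr M \<Longrightarrow> f [ract M x a, y, z] = f [x, lact M a y, z]"
    "\<And>x y z a. x \<in> carr M \<Longrightarrow> y \<in> carr M \<Longrightarrow> z \<in> carr M \<Longrightarrow> f [x, ract M y a, z] = f [x, y, lact M a z]"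
  shows "lin_ext s (hten M [x, y, z]) f = f [x, y, z]"
proof (rule lin_ext_hten[OF s])
  interpret vector_space s by fact
  have e1: "length (u @ [a] @ v) = length [x, y, z] \<longleftrightarrow>
    (\<exists>b c. u = [] \<and> v = [b, c] \<or> u = [b] \<and> v = [c] \<or> u = [b, c] \<and> v = [])" for u v and a :: 'm
    by (cases u; cases "tl u") (auto simp: length_Suc_conv)
  have e2: "length (u @ [a, b] @ v) = length [x, y, z] \<longleftrightarrow> (\<exists>c. u = [] \<and> v = [c] \<or> u = [c] \<and> v = [])" for u v and a b :: 'm
    by (cases u) (auto simp: length_Suc_conv)
  fix r assume "r \<in> hrel M (length [x, y, z])"
  then show "lin_ext s r f = 0"
    unfolding hrel_def e1 e2 using assms
    by (auto simp: lin_ext_minus lin_ext_single linear_on_def)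
qed

lemma hten_add:
  assumes "set u \<subseteq> carr M" "set v \<subseteq> carr M" "x \<in> carr M" "y \<in> carr M"
  shows "hten M (u @ [x + y] @ v) = hten M (u @ [x] @ v) + hten M (u @ [y] @ v)"
proof -
  have "Poly_Mapping.single (u @ [x + y] @ v) 1 -
     (Poly_Mapping.single (u @ [x] @ v) 1 + Poly_Mapping.single (u @ [y] @ v) 1) \<in> hrel M (length (u @ [x + y] @ v))"
    unfolding hrel_def
    by (intro UnI1 CollectI exI[of _ u] exI[of _ x] exI[of _ y] exI[of _ v]) (use assms in \<open>auto simp: diff_diff_eq\<close>)
  from qmap_span_eqI[OF this] show ?thesis
    by (simp add: hten_def qmap_add[OF subspace_span_pscale])
qed

lemma hten_scale:
  assumes "set u \<subseteq> carr M" "set v \<subseteq> carr M" "x \<in> carr M"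
  shows "hten M (u @ [scl M c x] @ v) = pscale c (hten M (u @ [x] @ v))"
proof -
  have "Poly_Mapping.single (u @ [scl M c x] @ v) 1 -
     pscale c (Poly_Mapping.single (u @ [x] @ v) 1) \<in> hrel M (length (u @ [scl M c x] @ v))"
    unfolding hrel_def pscale_single
    by (rule UnI1, rule UnI2, intro CollectI exI[of _ u] exI[of _ x] exI[of _ c] exI[of _ v]) (use assms in auto)
  from qmap_span_eqI[OF this] show ?thesis
    by (simp add: hten_def qmap_add[OF subspace_span_pscale])
qed

lemma hten_balanced:
  assumes "set u \<subseteq> carr M" "set v \<subseteq> carr M" "x \<in> carr M" "y \<in> carr M"
  shows "hten M (u @ [ract M x a, y] @ v) = hten M (u @ [x, lact M a y] @ v)"
proof -
  have "Poly_Mapping.single (u @ [ract M x a, y] @ v) 1 -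
     Poly_Mapping.single (u @ [x, lact M a y] @ v) 1 \<in> hrel M (length (u @ [ract M x a, y] @ v))"
    unfolding hrel_def
    by (rule UnI2, intro CollectI exI[of _ u] exI[of _ x] exI[of _ y] exI[of _ a] exI[of _ v]) (use assms in auto)
  from qmap_span_eqI[OF this] show ?thesis
    unfolding hten_def by simp
qed

text \<open>The general laws speak of \<open>u @ [x] @ v\<close>, which does not match a list
  literal; hence one instance for each position in words of length up to three.\<close>

lemmas hten_simps =
  hten_add[of "[]" _ "[]", simplified] hten_add[of "[]" _ "[b]" for b, simplified]
  hten_add[of "[b]" _ "[]" for b, simplified] hten_add[of "[]" _ "[b, c]" for b c, simplified]
  hten_add[of "[b]" _ "[c]" for b c, simplified] hten_add[of "[b, c]" _ "[]" for b c, simplified]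
  hten_scale[of "[]" _ "[]", simplified] hten_scale[of "[]" _ "[b]" for b, simplified]
  hten_scale[of "[b]" _ "[]" for b, simplified] hten_scale[of "[]" _ "[b, c]" for b c, simplified]
  hten_scale[of "[b]" _ "[c]" for b c, simplified] hten_scale[of "[b, c]" _ "[]" for b c, simplified]

lemmas hten_moves =
  hten_balanced[of "[]" _ "[]", simplified] hten_balanced[of "[b]" _ "[]" for b, simplified]
  hten_balanced[of "[]" _ "[b]" for b, simplified]

lemma hpow_expand:
  assumes "t \<in> carr (hpow M n)" "Poly_Mapping.keys t \<subseteq> words M n"
  shows "plin t (hten M) = t"
proof -
  let ?q = "qmap (module.span pscale (hrel M n))"
  have "plin t (hten M) = plin t (\<lambda>p. ?q (Poly_Mapping.single p 1))"
    by (rule lin_ext_cong) (use assms in \<open>auto simp: hten_def words_def\<close>)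
  also have "\<dots> = t"
    by (simp add: qmap_plin[OF subspace_span_pscale, symmetric] lin_ext_id hpow_fix[OF assms(1)])
  finally show ?thesis .
qed

lemma hpow_keys:
  assumes "is_vs M" "\<And>x a. x \<in> carr M \<Longrightarrow> ract M x a \<in> carr M" "\<And>x a. x \<in> carr M \<Longrightarrow> lact M a x \<in> carr M"
    "t \<in> carr (hpow M n)"
  shows "Poly_Mapping.keys t \<subseteq> words M n"
proof -
  have "Poly_Mapping.keys r \<subseteq> words M n" if "r \<in> hrel M n" for r
    using that unfolding hrel_def words_def
    by (auto dest!: subsetD[OF Poly_Mapping.keys_diff] simp: is_vsD[OF assms(1)] assms(2,3) split: if_splits)
  moreover obtain u where "t = qmap (module.span pscale (hrel M n)) u" "Poly_Mapping.keys u \<subseteq> words M n"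
    using assms(4) by (auto simp: hpow_def words_def)
  ultimately show ?thesis using keys_qmap by blast
qed

lemma linear_on_lin_ext_arg:
  assumes "vector_space s" "scl V = pscale"
  shows "linear_on V s (\<lambda>t. lin_ext s t f)"
  by (simp add: linear_on_def assms lin_ext_add lin_ext_pscale)

lemma vs_pscale [simp]: "vector_space pscale" by (rule vector_space_pscale)

text \<open>Comodule axioms are equations between nested tensors. Applying this evaluation of a
  trilinear \<open>f\<close> to both sides turns coassociativity into a Sweedler identity.\<close>

lemma lin_ext_ten3:
  assumes s: "vector_space s" and vs: "is_vs V" "is_vs U" "is_vs W"
    and "\<And>y z. y \<in> carr U \<Longrightarrow> z \<in> carr W \<Longrightarrow> linear_on V s (\<lambda>x. f x y z)"
    and "\<And>x z. x \<in> carr V \<Longrightarrow> z \<in> carr W \<Longrightarrow> linear_on U s (\<lambda>y. f x y z)"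
    and "\<And>x y. x \<in> carr V \<Longrightarrow> y \<in> carr U \<Longrightarrow> linear_on W s (\<lambda>z. f x y z)"
    and "x \<in> carr V" "y \<in> carr U" "z \<in> carr W"
  shows "lin_ext s (ten V (tsp U W) x (ten U W y z)) (\<lambda>(x, T). lin_ext s T (\<lambda>(y, z). f x y z)) = f x y z"
proof -
  have "lin_ext s (ten V (tsp U W) x (ten U W y z)) (\<lambda>(x, T). lin_ext s T (\<lambda>(y, z). f x y z)) =
    lin_ext s (ten U W y z) (\<lambda>(y, z). f x y z)"
  proof (rule lin_ext_ten[OF s])
    fix T assume "T \<in> carr (tsp U W)"
    then have K: "p \<in> Poly_Mapping.keys T \<Longrightarrow> fst p \<in> carr U \<and> snd p \<in> carr W" for p
      using tsp_keys[OF vs(2,3), of T] by (cases p) auto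
    show "linear_on V s (\<lambda>x. lin_ext s T (\<lambda>(y, z). f x y z))"
      unfolding linear_on_def lin_ext_fun_add[OF s, symmetric] lin_ext_fun_scale[OF s, symmetric]
      using assms(5) K by (auto intro!: lin_ext_cong simp: linear_on_def)
  next
    show "linear_on (tsp U W) s (\<lambda>T. lin_ext s T (\<lambda>(y, z). f x y z))" for x
      by (simp add: linear_on_def lin_ext_add[OF s] lin_ext_pscale[OF s])
  qed (simp_all add: assms)
  also have "\<dots> = f x y z"
    by (rule lin_ext_ten[OF s]) (simp_all add: assms)
  finally show ?thesis .
qed

section \<open>Diagonalisable maps\<close>

lemma eigenspace_closed:
  assumes V: "is_vs V" and l: "linear_on V (scl V) F"
  shows "0 \<in> eigenspace V F c" "x \<in> eigenspace V F c \<Longrightarrow> scl V a x \<in> eigenspace V F c"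
    "x \<in> eigenspace V F c \<Longrightarrow> y \<in> eigenspace V F c \<Longrightarrow> x + y \<in> eigenspace V F c"
proof -
  interpret vector_space "scl V" using is_vsD(1)[OF V] .
  show "0 \<in> eigenspace V F c" "x \<in> eigenspace V F c \<Longrightarrow> scl V a x \<in> eigenspace V F c"
    "x \<in> eigenspace V F c \<Longrightarrow> y \<in> eigenspace V F c \<Longrightarrow> x + y \<in> eigenspace V F c"
    using l linear_on_0[OF V l] is_vsD(2-4)[OF V]
    by (auto simp: eigenspace_def linear_on_def scale_right_distrib mult.commute)
qed

text \<open>Each eigenvector in a linear combination is put into one of two groups, according to
  whether its eigenvalue is \<open>c\<close>.\<close>

lemma diagonalisable_decomp:
  assumes V: "is_vs V" and l: "linear_on V (scl V) F" and d: "diagonalisable V F" and t: "t \<in> carr V"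
  shows "\<exists>u\<in>eigenspace V F c. t - u \<in> module.span (scl V) (\<Union>d\<in>-{c}. eigenspace V F d)"
proof -
  interpret vector_space "scl V" using is_vsD(1)[OF V] .
  let ?A = "\<Union>d\<in>-{c}. eigenspace V F d"
  have "t \<in> span (\<Union>c. eigenspace V F c)" using d t by (simp add: diagonalisable_def)
  then show ?thesis
  proof (induction rule: span_induct_alt)
    case base
    show ?case using eigenspace_closed(1)[OF V l, of c] by (auto intro!: bexI[of _ 0] simp: span_zero)
  next
    case (step a x y)
    then obtain b u where x: "x \<in> eigenspace V F b" and u: "u \<in> eigenspace V F c" "y - u \<in> span ?A" by blast
    show ?case
    proof (cases "b = c")
      case True
      then have "scl V a x + u \<in> eigenspace V F c" using x u eigenspace_closed[OF V l] by blast
      then show ?thesis using u by (auto intro!: bexI[of _ "scl V a x + u"])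
    next
      case False
      then have "scl V a x \<in> span ?A" using x by (blast intro: span_base span_scale)
      then have "scl V a x + (y - u) \<in> span ?A" using u span_add by blast
      then show ?thesis using u by (auto intro!: bexI[of _ u] simp: algebra_simps)
    qed
  qed
qed

text \<open>A sum of eigenvectors for eigenvalues \<open>d\<^sub>1, \<dots>, d\<^sub>r \<noteq> c\<close> is killed by \<open>\<Prod>(F - d\<^sub>i)\<close>, which acts
  on the \<open>c\<close>-eigenspace as the non-zero scalar \<open>\<Prod>(c - d\<^sub>i)\<close>.\<close>

lemma eigenspace_independent:
  assumes V: "is_vs V" and l: "linear_on V (scl V) F" and cl: "\<And>x. x \<in> carr V \<Longrightarrow> F x \<in> carr V"
    and u: "u \<in> eigenspace V F c" "u \<in> module.span (scl V) (\<Union>d\<in>-{c}. eigenspace V F d)"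
  shows "u = 0"
proof -
  interpret vector_space "scl V" using is_vsD(1)[OF V] .
  define P where "P ds x = foldr (\<lambda>d x. F x - scl V d x) ds x" for ds x
  have P: "P [] x = x" "P (d # ds) x = F (P ds x) - scl V d (P ds x)" for d ds x
    by (simp_all add: P_def)
  have eig: "\<exists>r. P ds x = scl V r x \<and> (b \<notin> set ds \<longrightarrow> r \<noteq> 0)" if x: "x \<in> eigenspace V F b" for x b ds
  proof (induction ds)
    case Nil
    show ?case by (auto simp: P intro!: exI[of _ 1])
  next
    case (Cons d ds)
    then obtain r where r: "P ds x = scl V r x" "b \<notin> set ds \<longrightarrow> r \<noteq> 0" by blast
    have "P (d # ds) x = scl V ((b - d) * r) x"
      using eigenspace_closed(2)[OF V l x, of r] by (simp add: P r eigenspace_def scale_left_diff_distrib left_diff_distrib)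
    with r(2) show ?case by (auto intro!: exI[of _ "(b - d) * r"])
  qed
  have "\<exists>ds. c \<notin> set ds \<and> P ds u = 0 \<and> u \<in> carr V"
    using u(2)
  proof (induction rule: span_induct_alt)
    case base
    show ?case by (rule exI[of _ "[]"]) (simp add: P is_vsD(2)[OF V])
  next
    case (step a x y)
    then obtain b ds where b: "b \<noteq> c" and x: "x \<in> eigenspace V F b" and ds: "c \<notin> set ds" "P ds y = 0" "y \<in> carr V"
      by blast
    have ax: "scl V a x \<in> eigenspace V F b" using eigenspace_closed(2)[OF V l x] .
    obtain r where r: "P ds (scl V a x) = scl V r (scl V a x)" using eig[OF ax, of ds] by blast
    have Pc: "P ds z \<in> carr V \<and> P ds (z + y) = P ds z + P ds y" if "z \<in> carr V" for z
    proof -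
      have "P es z \<in> carr V \<and> P es y \<in> carr V \<and> P es (z + y) = P es z + P es y" for es
        using that ds(3) l cl
        by (induction es) (simp_all add: P is_vsD[OF V] linear_on_def scale_right_distrib)
      then show ?thesis by blast
    qed
    have "P (b # ds) (scl V a x + y) = 0"
      using Pc[of "scl V a x"] ax ds r eigenspace_closed(2)[OF V l ax, of r] by (simp add: P eigenspace_def)
    moreover have "scl V a x + y \<in> carr V" using ax ds is_vsD(3)[OF V] by (simp add: eigenspace_def)
    ultimately show ?case using b ds(1) by (intro exI[of _ "b # ds"]) simp
  qed
  then obtain ds where "c \<notin> set ds" "P ds u = 0" by blast
  then show "u = 0" using eig[OF u(1), of ds] by auto
qed

section \<open>Sweedler calculus in a Hopf algebra\<close>

context hopf_algebra
begin

abbreviation S :: "'h \<Rightarrow> 'h" where "S \<equiv> antipode H"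
abbreviation eps :: "'h \<Rightarrow> 'k" where "eps \<equiv> counit H"

text \<open>\<open>csum s a (\<lambda>a1 a2. F a1 a2)\<close> is \<open>F a\<^sub>1 a\<^sub>2\<close> in Sweedler notation.\<close>

definition csum :: "('k \<Rightarrow> 'v::ab_group_add \<Rightarrow> 'v) \<Rightarrow> 'h \<Rightarrow> ('h \<Rightarrow> 'h \<Rightarrow> 'v) \<Rightarrow> 'v" where
  "csum s a f = lin_ext s (comult H a) (\<lambda>(x, y). f x y)"

lemma in_carr_H [simp]: "x \<in> carr H"
  by (simp add: carr_UNIV)

lemma vs_H [simp]: "vector_space (scl H)" by (rule vector_space_H)

lemma is_vs_H [simp]: "is_vs H"
proof -
  interpret vector_space "scl H" by simp
  show ?thesis by (simp add: is_vs_def carr_UNIV)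
qed

lemma linear_on_H:
  "linear_on H s f \<longleftrightarrow> (\<forall>x y. f (x + y) = f x + f y) \<and> (\<forall>c x. f (scl H c x) = s c (f x))"
  by (simp add: linear_on_def carr_UNIV)

lemma comult_add: "comult H (a + b) = comult H a + comult H b"
  and comult_scale: "comult H (scl H c a) = pscale c (comult H a)"
  and comult_closed [simp]: "comult H a \<in> carr (tsp H H)"
  using coassoc_counit_right by (auto simp: right_comodule_def lin_map_def)

lemma csum_arg:
  assumes "vector_space s"
  shows "csum s (a + b) f = csum s a f + csum s b f" "csum s (scl H c a) f = s c (csum s a f)"
  using assms by (simp_all add: csum_def comult_add comult_scale lin_ext_add lin_ext_pscale)

lemma csum_fun:
  assumes "vector_space s"
  shows "csum s a (\<lambda>x y. f x y + g x y) = csum s a f + csum s a g"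
    "csum s a (\<lambda>x y. s c (f x y)) = s c (csum s a f)"
  using lin_ext_fun_add[OF assms, of _ "\<lambda>(x, y). f x y" "\<lambda>(x, y). g x y"]
    lin_ext_fun_scale[OF assms, of _ c "\<lambda>(x, y). f x y"]
  by (simp_all add: csum_def split_def)

lemma csum_fun_sum:
  assumes "vector_space s"
  shows "csum s a (\<lambda>x y. \<Sum>i\<in>I. f i x y) = (\<Sum>i\<in>I. csum s a (f i))"
  using lin_ext_fun_sum[OF assms, of _ "\<lambda>i (x, y). f i x y" I]
  by (simp_all add: csum_def split_def)

lemma csum_lin_ext_swap:
  assumes "vector_space s"
  shows "csum s a (\<lambda>x y. lin_ext s t (\<lambda>p. f x y p)) = lin_ext s t (\<lambda>p. csum s a (\<lambda>x y. f x y p))"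
  using lin_ext_swap[OF assms, of _ t "\<lambda>(x, y) p. f x y p"]
  by (simp add: csum_def split_def)

lemma csum_swap:
  assumes "vector_space s"
  shows "csum s a (\<lambda>x y. csum s b (\<lambda>u v. f x y u v)) = csum s b (\<lambda>u v. csum s a (\<lambda>x y. f x y u v))"
  using csum_lin_ext_swap[OF assms, of a "comult H b" "\<lambda>x y (u, v). f x y u v"]
  by (simp add: csum_def[of s b] split_def)

lemma linear_on_csum:
  assumes "is_vs V" "linear_on V s g" "\<And>x y. f x y \<in> carr V"
  shows "g (csum (scl V) a f) = csum s a (\<lambda>x y. g (f x y))"
  unfolding csum_def using assms(3) by (subst linear_on_lin_ext[OF assms(1,2)]) (auto simp: split_def)

lemma lin_ext_csum:
  assumes "vector_space s"
  shows "lin_ext s (csum pscale a f) g = csum s a (\<lambda>x y. lin_ext s (f x y) g)"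
  by (simp add: csum_def lin_ext_plin[OF assms] split_def)

lemma linear_on_csum_H:
  assumes "linear_on H s g"
  shows "g (csum (scl H) a f) = csum s a (\<lambda>x y. g (f x y))"
  by (rule linear_on_csum) (simp_all add: assms)

lemma lin_ext_ten_H:
  assumes "vector_space s" "\<And>y. linear_on H s (\<lambda>x. f x y)" "\<And>x. linear_on H s (f x)"
  shows "lin_ext s (ten H H x y) (\<lambda>(x, y). f x y) = f x y"
  by (rule lin_ext_ten) (simp_all add: assms)

lemma csum_mult:
  assumes "vector_space s" "\<And>y. linear_on H s (\<lambda>x. f x y)" "\<And>x. linear_on H s (f x)"
  shows "csum s (a * b) f = csum s a (\<lambda>a1 a2. csum s b (\<lambda>b1 b2. f (a1 * b1) (a2 * b2)))"
  by (simp add: csum_def comult_mult lin_ext_plin[OF assms(1)] split_def lin_ext_ten_H[OF assms, unfolded split_def])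

lemma csum_one:
  assumes "vector_space s" "\<And>y. linear_on H s (\<lambda>x. f x y)" "\<And>x. linear_on H s (f x)"
  shows "csum s 1 f = f 1 1"
  by (simp add: csum_def comult_one lin_ext_ten_H[OF assms])

lemma csum_coassoc:
  assumes s: "vector_space s" and "\<And>y z. linear_on H s (\<lambda>x. f x y z)" "\<And>x z. linear_on H s (\<lambda>y. f x y z)"
    "\<And>x y. linear_on H s (f x y)"
  shows "csum s a (\<lambda>x y. csum s x (\<lambda>u v. f u v y)) = csum s a (\<lambda>x y. csum s y (\<lambda>u v. f x u v))"
proof -
  let ?L = "\<lambda>t. lin_ext s t (\<lambda>(x, T). lin_ext s T (\<lambda>(y, z). f x y z))"
  note e = lin_ext_ten3[of s H H H f, OF s is_vs_H is_vs_H is_vs_H assms(2-4) in_carr_H in_carr_H in_carr_H]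
  have "?L (plin (comult H a) (\<lambda>(v', h2). plin (comult H v') (\<lambda>(v0, h1). ten H (tsp H H) v0 (ten H H h1 h2)))) =
    ?L (plin (comult H a) (\<lambda>(v0, h). plin (comult H h) (\<lambda>(h1, h2). ten H (tsp H H) v0 (ten H H h1 h2))))"
    using coassoc_counit_right by (simp add: right_comodule_def)
  then show ?thesis
    by (simp add: lin_ext_plin[OF s] split_def csum_def e[unfolded split_def])
qed

lemma csum_counit_right:
  assumes "linear_on H s f"
  shows "csum s a (\<lambda>x y. s (eps y) (f x)) = f a"
proof -
  have "f (csum (scl H) a (\<lambda>x y. scl H (eps y) x)) = f a"
    using coassoc_counit_right by (simp add: right_comodule_def csum_def)
  then show ?thesis using assms by (simp add: linear_on_csum_H) (simp add: linear_on_H)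
qed

lemma csum_counit_left:
  assumes "linear_on H s f"
  shows "csum s a (\<lambda>x y. s (eps x) (f y)) = f a"
proof -
  have "f (csum (scl H) a (\<lambda>x y. scl H (eps x) y)) = f a"
    using coassoc_counit_left by (simp add: left_comodule_def csum_def)
  then show ?thesis using assms by (simp add: linear_on_csum_H) (simp add: linear_on_H)
qed

lemma csum_antipode_left:
  assumes "linear_on H s f"
  shows "csum s a (\<lambda>x y. f (S x * y)) = s (eps a) (f 1)"
proof -
  have "f (csum (scl H) a (\<lambda>x y. S x * y)) = f (scl H (eps a) 1)"
    by (simp add: csum_def antipode_left)
  then show ?thesis using assms by (simp add: linear_on_csum_H) (simp add: linear_on_H)
qed

lemma csum_antipode_right:
  assumes "linear_on H s f"
  shows "csum s a (\<lambda>x y. f (x * S y)) = s (eps a) (f 1)"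
proof -
  have "f (csum (scl H) a (\<lambda>x y. x * S y)) = f (scl H (eps a) 1)"
    by (simp add: csum_def antipode_right)
  then show ?thesis using assms by (simp add: linear_on_csum_H) (simp add: linear_on_H)
qed

lemma S_add [simp]: "S (a + b) = S a + S b" and S_scale [simp]: "S (scl H c a) = scl H c (S a)"
proof -
  interpret Vector_Spaces.linear "scl H" "scl H" S by (rule antipode_linear)
  show "S (a + b) = S a + S b" "S (scl H c a) = scl H c (S a)" by (simp_all add: add scale)
qed

lemma eps_add [simp]: "eps (a + b) = eps a + eps b" and eps_scale [simp]: "eps (scl H c a) = c * eps a"
proof -
  interpret Vector_Spaces.linear "scl H" "(*)" eps by (rule counit_linear)
  show "eps (a + b) = eps a + eps b" "eps (scl H c a) = c * eps a" by (simp_all add: add scale)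
qed

lemma vs_scale_simps:
  assumes "vector_space s"
  shows "s c (x + y) = s c x + s c y" "s (c + d) x = s c x + s d x" "s c (s d x) = s (c * d) x" "s 1 x = x"
    "s c 0 = 0" "s 0 x = 0"
proof -
  interpret vector_space s by fact
  show "s c (x + y) = s c x + s c y" "s (c + d) x = s c x + s d x" "s c (s d x) = s (c * d) x" "s 1 x = x"
   "s c 0 = 0" "s 0 x = 0"
    by (simp_all add: scale_right_distrib scale_left_distrib)
qed

lemmas csum_lin = csum_arg csum_fun vs_scale_simps

text \<open>Instances are needed because the rewrite rules in \<open>csum_lin\<close> are not higher-order patterns for
  a schematic scaling.\<close>

lemmas lin = linear_on_H csum_lin[OF vs_H] csum_lin[OF vs_pscale] scl_mult_left scl_mult_right
  distrib_left distrib_right mult.assoc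

lemma S_one [simp]: "S 1 = 1"
proof -
  have "csum (scl H) 1 (\<lambda>x y. S x * y) = S 1"
    by (subst csum_one) (simp_all add: lin)
  moreover have "csum (scl H) 1 (\<lambda>x y. S x * y) = 1"
    using csum_antipode_left[of "scl H" "\<lambda>x. x" 1] by (simp add: lin counit_one)
  ultimately show ?thesis by simp
qed

text \<open>Coassociativity brings the two legs joined by \<open>P\<close> next to each other, after
  which they collapse to the counit. Keeping \<open>P\<close> abstract covers S(a_1)a_2 and
  a_1S(a_2), and later S^{-1}(a_2)a_1 and a_2S^{-1}(a_1).\<close>

lemma csum_convolution:
  assumes "vector_space s"
    and inv: "\<And>f a. linear_on H s f \<Longrightarrow> csum s a (\<lambda>x y. f (P x y)) = s (eps a) (f 1)"
    and "\<And>y. linear_on H (scl H) (\<lambda>x. P x y)" "\<And>x. linear_on H (scl H) (P x)"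
    and "\<And>y. linear_on H s (\<lambda>x. F x y)" "\<And>x. linear_on H s (F x)"
  shows "csum s a (\<lambda>x y. csum s y (\<lambda>u v. F (P x u) v)) = F 1 a"
    and "csum s a (\<lambda>x y. csum s x (\<lambda>u v. F u (P v y))) = F a 1"
proof -
  have "csum s a (\<lambda>x y. csum s y (\<lambda>u v. F (P x u) v)) = csum s a (\<lambda>x y. csum s x (\<lambda>u v. F (P u v) y))"
    by (rule csum_coassoc[symmetric]) (use assms in \<open>simp_all add: lin csum_lin[OF assms(1)]\<close>)
  also have "\<dots> = csum s a (\<lambda>x y. s (eps x) (F 1 y))"
    by (subst inv) (simp_all add: assms)
  also have "\<dots> = F 1 a"
    by (rule csum_counit_left) (simp add: assms)
  finally show "csum s a (\<lambda>x y. csum s y (\<lambda>u v. F (P x u) v)) = F 1 a" .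
  have "csum s a (\<lambda>x y. csum s x (\<lambda>u v. F u (P v y))) = csum s a (\<lambda>x y. csum s y (\<lambda>u v. F x (P u v)))"
    by (rule csum_coassoc) (use assms in \<open>simp_all add: lin csum_lin[OF assms(1)]\<close>)
  also have "\<dots> = csum s a (\<lambda>x y. s (eps y) (F x 1))"
    by (subst inv) (simp_all add: assms)
  also have "\<dots> = F a 1"
    by (rule csum_counit_right) (simp add: assms)
  finally show "csum s a (\<lambda>x y. csum s x (\<lambda>u v. F u (P v y))) = F a 1" .
qed

lemma csum_cancel_S_left:
  assumes "vector_space s" "\<And>y. linear_on H s (\<lambda>x. F x y)" "\<And>x. linear_on H s (F x)"
  shows "csum s a (\<lambda>x y. csum s y (\<lambda>u v. F (S x * u) v)) = F 1 a"
    and "csum s a (\<lambda>x y. csum s x (\<lambda>u v. F u (S v * y))) = F a 1"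
  by (rule csum_convolution[where P = "\<lambda>x y. S x * y"], use assms in \<open>simp_all add: lin csum_antipode_left\<close>)+

lemma csum_cancel_S_right:
  assumes "vector_space s" "\<And>y. linear_on H s (\<lambda>x. F x y)" "\<And>x. linear_on H s (F x)"
  shows "csum s a (\<lambda>x y. csum s y (\<lambda>u v. F (x * S u) v)) = F 1 a"
    and "csum s a (\<lambda>x y. csum s x (\<lambda>u v. F u (v * S y))) = F a 1"
  by (rule csum_convolution[where P = "\<lambda>x y. x * S y"], use assms in \<open>simp_all add: lin csum_antipode_right\<close>)+

text \<open>Among maps from H \<otimes> H to H, both sides are convolution inverses of the
  multiplication. The term \<open>?T\<close>, which is S(a_1b_1)a_2b_2S(b_3)S(a_3), is collapsed
  once from the right and once from the left.\<close>

lemma S_mult: "S (a * b) = S b * S a"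
proof -
  let ?s = "csum (scl H)"
  let ?T = "?s a (\<lambda>a1 ar. ?s b (\<lambda>b1 br. ?s ar (\<lambda>a2 a3. ?s br (\<lambda>b2 b3. S (a1 * b1) * (a2 * (b2 * S b3) * S a3)))))"
  have "?T = ?s a (\<lambda>a1 ar. ?s b (\<lambda>b1 br. ?s ar (\<lambda>a2 a3. scl H (eps br) (S (a1 * b1) * (a2 * S a3)))))"
    by (subst csum_antipode_right[of "scl H" "\<lambda>z. S (x * y) * (u * z * S v)" for x y u v]) (simp_all add: lin)
  also have "\<dots> = ?s a (\<lambda>a1 ar. ?s b (\<lambda>b1 br. scl H (eps br) (scl H (eps ar) (S (a1 * b1)))))"
    by (subst csum_antipode_right[of "scl H" "\<lambda>z. scl H c (S (x * y) * z)" for x y c]) (simp_all add: lin mult.commute)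
  also have "\<dots> = ?s a (\<lambda>a1 ar. scl H (eps ar) (S (a1 * b)))"
    by (subst csum_counit_right) (simp_all add: lin mult.commute)
  also have "\<dots> = S (a * b)"
    by (subst csum_counit_right) (simp_all add: lin mult.commute)
  finally have 1: "?T = S (a * b)" .
  \<comment> \<open>Regrouping until a_1b_1 and a_2b_2 are the two legs of the coproduct of a single
    product.\<close>
  have "?T = ?s a (\<lambda>a1 ar. ?s ar (\<lambda>a2 a3. ?s b (\<lambda>b1 br. ?s br (\<lambda>b2 b3. S (a1 * b1) * (a2 * b2 * S b3 * S a3)))))"
    by (subst (2) csum_swap) (simp_all add: mult.assoc)
  also have "\<dots> = ?s a (\<lambda>al a3. ?s al (\<lambda>a1 a2. ?s b (\<lambda>b1 br. ?s br (\<lambda>b2 b3. S (a1 * b1) * (a2 * b2 * S b3 * S a3)))))"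
    by (rule csum_coassoc[symmetric]) (simp_all add: lin)
  also have "\<dots> = ?s a (\<lambda>al a3. ?s al (\<lambda>a1 a2. ?s b (\<lambda>bl b3. ?s bl (\<lambda>b1 b2. S (a1 * b1) * (a2 * b2 * S b3 * S a3)))))"
    by (subst csum_coassoc[of _ "\<lambda>b1 b2 b3. S (x * b1) * (y * b2 * S b3 * S z)" for x y z]) (simp_all add: lin)
  also have "\<dots> = ?s a (\<lambda>al a3. ?s b (\<lambda>bl b3. ?s al (\<lambda>a1 a2. ?s bl (\<lambda>b1 b2. S (a1 * b1) * (a2 * b2) * (S b3 * S a3)))))"
    by (subst (2) csum_swap) (simp_all add: mult.assoc)
  also have "\<dots> = ?s a (\<lambda>al a3. ?s b (\<lambda>bl b3. ?s (al * bl) (\<lambda>x y. S x * y * (S b3 * S a3))))"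
    by (subst csum_mult[of _ "\<lambda>x y. S x * y * z" for z]) (simp_all add: lin)
  also have "\<dots> = ?s a (\<lambda>al a3. ?s b (\<lambda>bl b3. scl H (eps bl) (scl H (eps al) (S b3 * S a3))))"
    by (subst csum_antipode_left[of _ "\<lambda>x. x * z" for z]) (simp_all add: lin counit_mult mult.commute)
  also have "\<dots> = ?s a (\<lambda>al a3. scl H (eps al) (S b * S a3))"
    by (subst csum_counit_left) (simp_all add: lin mult.commute)
  also have "\<dots> = S b * S a"
    by (subst csum_counit_left) (simp_all add: lin)
  finally show ?thesis using 1 by simp
qed

text \<open>The maps \<Delta>S and (S \<otimes> S)\<Delta> followed by the flip are both convolution
  inverses of \<Delta>. Here \<open>?T\<close> is \<Delta>(S(a_1))\<Delta>(a_2)(S(a_4) \<otimes>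
  S(a_3)), evaluated under \<open>f\<close>.\<close>

lemma csum_S:
  assumes s: "vector_space s" and f: "\<And>y. linear_on H s (\<lambda>x. f x y)" "\<And>x. linear_on H s (f x)"
  shows "csum s (S a) f = csum s a (\<lambda>u v. f (S v) (S u))"
proof -
  note l = lin csum_lin[OF s] f[unfolded linear_on_H]
  let ?T = "csum s a (\<lambda>a1 ar. csum s (S a1) (\<lambda>p q. csum s ar (\<lambda>a2 br. csum s a2 (\<lambda>u v. csum s br (\<lambda>a3 a4. f (p * u * S a4) (q * v * S a3))))))"
  have "?T = csum s a (\<lambda>a1 ar. csum s (S a1) (\<lambda>p q. csum s ar (\<lambda>u cr. csum s cr (\<lambda>v br. csum s br (\<lambda>a3 a4. f (p * u * S a4) (q * (v * S a3)))))))"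
    by (subst csum_coassoc[of s "\<lambda>u v br. csum s br (\<lambda>a3 a4. f (p * u * S a4) (q * (v * S a3)))" for p q, symmetric])
      (simp_all add: l s)
  also have "\<dots> = csum s a (\<lambda>a1 ar. csum s (S a1) (\<lambda>p q. csum s ar (\<lambda>u cr. f (p * (u * S cr)) q)))"
    by (subst csum_cancel_S_right(1)[of s "\<lambda>x a4. f (p * u * S a4) (q * x)" for p q u]) (simp_all add: l s)
  also have "\<dots> = csum s a (\<lambda>a1 ar. s (eps ar) (csum s (S a1) (\<lambda>p q. f p q)))"
    by (subst csum_antipode_right[of s "\<lambda>x. f (p * x) q" for p q]) (simp_all add: l s)
  also have "\<dots> = csum s (S a) f"
    by (rule csum_counit_right) (simp_all add: l s)
  finally have 1: "?T = csum s (S a) f" .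
  \<comment> \<open>From the left, \<Delta>(S(a_1)) and \<Delta>(a_2) combine into
    \<Delta>(S(a_1)a_2), which collapses to \<Delta>(1).\<close>
  have "?T = csum s a (\<lambda>a1 ar. csum s ar (\<lambda>a2 br. csum s br (\<lambda>a3 a4. csum s (S a1) (\<lambda>p q. csum s a2 (\<lambda>u v. f (p * u * S a4) (q * v * S a3))))))"
    by (simp add: csum_swap[OF s, of "S x" for x]) (simp add: csum_swap[OF s, of _ "S x" for x] csum_swap[OF s, of _ y "\<lambda>u v a3 a4. f (p * u * S a4) (q * v * S a3)" for p q y])
  also have "\<dots> = csum s a (\<lambda>a1 ar. csum s ar (\<lambda>a2 br. csum s br (\<lambda>a3 a4. csum s (S a1 * a2) (\<lambda>p q. f (p * S a4) (q * S a3)))))"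
    by (subst csum_mult[of s "\<lambda>p q. f (p * x) (q * y)" for x y]) (simp_all add: l s)
  also have "\<dots> = csum s a (\<lambda>a3 a4. csum s 1 (\<lambda>p q. f (p * S a4) (q * S a3)))"
    by (rule csum_cancel_S_left(1)[of s "\<lambda>x br. csum s br (\<lambda>a3 a4. csum s x (\<lambda>p q. f (p * S a4) (q * S a3)))"])
      (simp_all add: l s)
  also have "\<dots> = csum s a (\<lambda>u v. f (S v) (S u))"
    by (subst csum_one) (simp_all add: l s)
  finally show ?thesis using 1 by simp
qed

end

section \<open>The inverse of the antipode\<close>

locale hopf_algebra_bij = hopf_algebra +
  assumes bij_antipode: "bij (antipode H)"
begin

abbreviation Si :: "'b \<Rightarrow> 'b" where "Si \<equiv> inv (antipode H)"

lemma S_Si [simp]: "S (Si a) = a" and Si_S [simp]: "Si (S a) = a"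
  using bij_antipode by (simp_all add: bij_is_surj surj_f_inv_f bij_is_inj)

lemma Si_eqI: "S a = b \<Longrightarrow> Si b = a" by auto

lemma Si_add [simp]: "Si (a + b) = Si a + Si b"
  and Si_scale [simp]: "Si (scl H c a) = scl H c (Si a)"
  and Si_mult: "Si (a * b) = Si b * Si a"
  and Si_one [simp]: "Si 1 = 1"
  by (rule Si_eqI; simp add: S_mult)+

text \<open>\<open>Si\<close> reverses products, so applying it to S(a_1)a_2 yields S^{-1}(a_2)a_1:
  the inverse antipode satisfies the antipode axioms with the legs of the coproduct
  exchanged.\<close>

lemma csum_antipode_inv_left:
  assumes "linear_on H s f"
  shows "csum s a (\<lambda>x y. f (Si y * x)) = s (eps a) (f 1)"
proof -
  have "csum s a (\<lambda>x y. f (Si (S x * y))) = s (eps a) (f (Si 1))"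
    by (rule csum_antipode_left) (use assms in \<open>simp add: linear_on_H\<close>)
  then show ?thesis by (simp add: Si_mult)
qed

lemma csum_antipode_inv_right:
  assumes "linear_on H s f"
  shows "csum s a (\<lambda>x y. f (y * Si x)) = s (eps a) (f 1)"
proof -
  have "csum s a (\<lambda>x y. f (Si (x * S y))) = s (eps a) (f (Si 1))"
    by (rule csum_antipode_right) (use assms in \<open>simp add: linear_on_H\<close>)
  then show ?thesis by (simp add: Si_mult)
qed

lemma csum_cancel_Si_left:
  assumes "vector_space s" "\<And>y. linear_on H s (\<lambda>x. F x y)" "\<And>x. linear_on H s (F x)"
  shows "csum s a (\<lambda>x y. csum s y (\<lambda>u v. F (Si u * x) v)) = F 1 a"
    and "csum s a (\<lambda>x y. csum s x (\<lambda>u v. F u (Si y * v))) = F a 1"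
  by (rule csum_convolution[where P = "\<lambda>x y. Si y * x"], use assms in \<open>simp_all add: lin csum_antipode_inv_left\<close>)+

lemma csum_cancel_Si_right:
  assumes "vector_space s" "\<And>y. linear_on H s (\<lambda>x. F x y)" "\<And>x. linear_on H s (F x)"
  shows "csum s a (\<lambda>x y. csum s y (\<lambda>u v. F (u * Si x) v)) = F 1 a"
    and "csum s a (\<lambda>x y. csum s x (\<lambda>u v. F u (y * Si v))) = F a 1"
  by (rule csum_convolution[where P = "\<lambda>x y. y * Si x"], use assms in \<open>simp_all add: lin csum_antipode_inv_right\<close>)+

lemma csum_Si:
  assumes s: "vector_space s" and f: "\<And>y. linear_on H s (\<lambda>x. f x y)" "\<And>x. linear_on H s (f x)"
  shows "csum s (Si a) f = csum s a (\<lambda>u v. f (Si v) (Si u))"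
proof -
  have "csum s (S (Si a)) (\<lambda>u v. f (Si v) (Si u)) = csum s (Si a) (\<lambda>u v. f (Si (S u)) (Si (S v)))"
    by (rule csum_S[OF s]) (use f in \<open>simp_all add: linear_on_H\<close>)
  then show ?thesis by simp
qed

end

section \<open>Permutations of two letters and their reduced words\<close>

lemma permutes_lessThan_2: "{p. p permutes {..<2::nat}} = {id, transpose 0 1}"
proof -
  have 2: "{..<2::nat} = {0, 1}" by auto
  have "p = id \<or> p = transpose 0 1" if p: "p permutes {0, 1}" for p :: "nat \<Rightarrow> nat"
  proof -
    have i: "p 0 \<in> {0, 1}" "p 1 \<in> {0, 1}" "p 0 \<noteq> p 1"
      using permutes_in_image[OF p] inj_eq[OF permutes_inj[OF p]] by auto
    have o: "p x = x" if "x \<notin> {0, 1}" for x using permutes_not_in[OF p that] .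
    show ?thesis
    proof (cases "p 0 = 0")
      case True
      then have "p = id" using i o by (intro ext) (metis id_apply insertE singletonD)
      then show ?thesis ..
    next
      case False
      then have "p 0 = 1" "p 1 = 0" using i by auto
      then have "p = transpose 0 1" using o by (intro ext) (auto simp: transpose_def)
      then show ?thesis ..
    qed
  qed
  moreover have "transpose 0 1 permutes {0, 1::nat}" by (rule permutes_swap_id) auto
  ultimately show ?thesis by (auto simp: 2 permutes_id)
qed

text \<open>For two letters the reduced words are unique, so the choice made in
  \<open>antisymmetriser\<close> is determined in degree two.\<close>

lemma Eps_reduced_word: "Eps (reduced_word 2 id) = []" "Eps (reduced_word 2 (transpose 0 (Suc 0))) = [0]"
proof -
  have ne: "transpose 0 (Suc 0) \<noteq> id" by (metis id_apply transpose_apply_first n_not_Suc_n)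
  have "reduced_word 2 id []" by (simp add: reduced_word_def perm_of_word_def)
  moreover have "is = []" if "reduced_word 2 id is" for "is"
  proof -
    have "length is \<le> length ([] :: nat list)"
      using that unfolding reduced_word_def by (elim conjE allE[of _ "[]"]) (simp add: perm_of_word_def)
    then show ?thesis by simp
  qed
  ultimately show "Eps (reduced_word 2 id) = []" by (rule some_equality)
  have w: "(\<forall>i\<in>set [0]. Suc i < 2) \<and> perm_of_word [0] = transpose 0 (Suc 0)"
    by (simp add: perm_of_word_def)
  have n: "perm_of_word [] \<noteq> transpose 0 (Suc 0)" using ne by (simp add: perm_of_word_def)
  have "reduced_word 2 (transpose 0 (Suc 0)) [0]"
    unfolding reduced_word_def using w n by (auto simp: Suc_le_eq)
  moreover have "is = [0]" if "reduced_word 2 (transpose 0 (Suc 0)) is" for "is"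
  proof -
    have r: "\<forall>i\<in>set is. Suc i < 2" "perm_of_word is = transpose 0 (Suc 0)"
      using that unfolding reduced_word_def by blast+
    have "length is \<le> length [0::nat]"
      using that w unfolding reduced_word_def by (elim conjE allE[of _ "[0]"]) blast
    moreover have "is \<noteq> []" using r(2) n by auto
    moreover have "\<forall>i\<in>set is. i = 0" using r(1) by auto
    ultimately have "length is \<le> 1" "is \<noteq> []" "\<forall>i\<in>set is. i = 0" by simp_all
    then show ?thesis by (cases "is") auto
  qed
  ultimately show "Eps (reduced_word 2 (transpose 0 (Suc 0))) = [0]" by (rule some_equality)
qed

section \<open>Bicovariant bimodules\<close>

text \<open>Meant for the one-forms. Vector fields are handled through evaluation at one-forms
  instead, because their coactions are specified only in that way.\<close>

locale bicovariant_bimodule = hopf_algebra_bij H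
  for H :: "('k::field, 'h::ring_1) hopf" +
  fixes M :: "('k, 'h, 'm::ab_group_add) bibimodule"
  assumes is_vs_M [simp]: "is_vs M"
    and lact_closed [simp]: "m \<in> carr M \<Longrightarrow> lact M a m \<in> carr M"
    and ract_closed [simp]: "m \<in> carr M \<Longrightarrow> ract M m a \<in> carr M"
    and lact_add: "m \<in> carr M \<Longrightarrow> lact M (a + b) m = lact M a m + lact M b m"
      "m \<in> carr M \<Longrightarrow> n \<in> carr M \<Longrightarrow> lact M a (m + n) = lact M a m + lact M a n"
    and ract_add: "m \<in> carr M \<Longrightarrow> ract M m (a + b) = ract M m a + ract M m b"
      "m \<in> carr M \<Longrightarrow> n \<in> carr M \<Longrightarrow> ract M (m + n) a = ract M m a + ract M n a"
    and lact_scale: "m \<in> carr M \<Longrightarrow> lact M (scl H c a) m = scl M c (lact M a m)"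
      "m \<in> carr M \<Longrightarrow> lact M a (scl M c m) = scl M c (lact M a m)"
    and ract_scale: "m \<in> carr M \<Longrightarrow> ract M m (scl H c a) = scl M c (ract M m a)"
      "m \<in> carr M \<Longrightarrow> ract M (scl M c m) a = scl M c (ract M m a)"
    and lact_lact: "m \<in> carr M \<Longrightarrow> lact M a (lact M b m) = lact M (a * b) m"
    and ract_ract: "m \<in> carr M \<Longrightarrow> ract M (ract M m a) b = ract M m (a * b)"
    and lact_ract: "m \<in> carr M \<Longrightarrow> ract M (lact M a m) b = lact M a (ract M m b)"
    and lact_one [simp]: "m \<in> carr M \<Longrightarrow> lact M 1 m = m"
    and ract_one [simp]: "m \<in> carr M \<Longrightarrow> ract M m 1 = m"
    and lcomodule: "left_comodule H M (lcoact M)"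
    and rcomodule: "right_comodule H M (rcoact M)"
    and lcoact_lact: "m \<in> carr M \<Longrightarrow> lcoact M (lact M a m) =
      plin (comult H a) (\<lambda>(a1, a2). plin (lcoact M m) (\<lambda>(h, x). ten H M (a1 * h) (lact M a2 x)))"
    and lcoact_ract: "m \<in> carr M \<Longrightarrow> lcoact M (ract M m a) =
      plin (lcoact M m) (\<lambda>(h, x). plin (comult H a) (\<lambda>(a1, a2). ten H M (h * a1) (ract M x a2)))"
    and rcoact_lact: "m \<in> carr M \<Longrightarrow> rcoact M (lact M a m) =
      plin (comult H a) (\<lambda>(a1, a2). plin (rcoact M m) (\<lambda>(x, h). ten M H (lact M a1 x) (a2 * h)))"
    and rcoact_ract: "m \<in> carr M \<Longrightarrow> rcoact M (ract M m a) =
      plin (rcoact M m) (\<lambda>(x, h). plin (comult H a) (\<lambda>(a1, a2). ten M H (ract M x a1) (h * a2)))"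
begin

abbreviation lmul :: "'h \<Rightarrow> 'm \<Rightarrow> 'm" (infixr "\<rhd>" 75) where "a \<rhd> m \<equiv> lact M a m"
abbreviation rmul :: "'m \<Rightarrow> 'h \<Rightarrow> 'm" (infixl "\<lhd>" 75) where "m \<lhd> a \<equiv> ract M m a"

text \<open>Sweedler notation for coactions: \<open>lsum s m f\<close> is f m_{-1} m_0, and
  \<open>rsum s m f\<close> is f m_0 m_1.\<close>

definition lsum :: "('k \<Rightarrow> 'v::ab_group_add \<Rightarrow> 'v) \<Rightarrow> 'm \<Rightarrow> ('h \<Rightarrow> 'm \<Rightarrow> 'v) \<Rightarrow> 'v" where
  "lsum s m f = lin_ext s (lcoact M m) (\<lambda>(h, x). f h x)"

definition rsum :: "('k \<Rightarrow> 'v::ab_group_add \<Rightarrow> 'v) \<Rightarrow> 'm \<Rightarrow> ('m \<Rightarrow> 'h \<Rightarrow> 'v) \<Rightarrow> 'v" where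
  "rsum s m f = lin_ext s (rcoact M m) (\<lambda>(x, h). f x h)"

lemma vs_M [simp]: "vector_space (scl M)" using is_vs_M by (rule is_vsD)

lemmas closedM [simp] = is_vsD(2-6)[OF is_vs_M]

lemma coact_arg:
  assumes "m \<in> carr M" "n \<in> carr M"
  shows "lcoact M (m + n) = lcoact M m + lcoact M n" "rcoact M (m + n) = rcoact M m + rcoact M n"
  using lcomodule rcomodule assms by (auto simp: left_comodule_def right_comodule_def lin_map_def)

lemma coact_scale:
  assumes "m \<in> carr M"
  shows "lcoact M (scl M c m) = pscale c (lcoact M m)" "rcoact M (scl M c m) = pscale c (rcoact M m)"
    "lcoact M m \<in> carr (tsp H M)" "rcoact M m \<in> carr (tsp M H)"
  using lcomodule rcomodule assms by (auto simp: left_comodule_def right_comodule_def lin_map_def)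

lemma keys_lcoact: "m \<in> carr M \<Longrightarrow> (h, x) \<in> Poly_Mapping.keys (lcoact M m) \<Longrightarrow> x \<in> carr M"
  and keys_rcoact: "m \<in> carr M \<Longrightarrow> (x, h) \<in> Poly_Mapping.keys (rcoact M m) \<Longrightarrow> x \<in> carr M"
  using tsp_keys[OF is_vs_H is_vs_M coact_scale(3)] tsp_keys[OF is_vs_M is_vs_H coact_scale(4)] by auto

lemma lsum_cong:
  assumes "m = m'" "m' \<in> carr M" "\<And>h x. x \<in> carr M \<Longrightarrow> f h x = g h x"
  shows "lsum s m f = lsum s m' g"
  unfolding lsum_def using assms keys_lcoact by (intro lin_ext_cong) auto

lemma rsum_cong:
  assumes "m = m'" "m' \<in> carr M" "\<And>h x. x \<in> carr M \<Longrightarrow> f x h = g x h"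
  shows "rsum s m f = rsum s m' g"
  unfolding rsum_def using assms keys_rcoact by (intro lin_ext_cong) auto

lemma lsum_arg:
  assumes "vector_space s"
  shows "m \<in> carr M \<Longrightarrow> n \<in> carr M \<Longrightarrow> lsum s (m + n) f = lsum s m f + lsum s n f"
    "m \<in> carr M \<Longrightarrow> lsum s (scl M c m) f = s c (lsum s m f)"
    "m \<in> carr M \<Longrightarrow> n \<in> carr M \<Longrightarrow> rsum s (m + n) f' = rsum s m f' + rsum s n f'"
    "m \<in> carr M \<Longrightarrow> rsum s (scl M c m) f' = s c (rsum s m f')"
  using assms by (simp_all add: lsum_def rsum_def coact_arg coact_scale lin_ext_add lin_ext_pscale)

lemma lsum_fun:
  assumes "vector_space s"
  shows "lsum s m (\<lambda>h x. f h x + g h x) = lsum s m f + lsum s m g"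
    "lsum s m (\<lambda>h x. s c (f h x)) = s c (lsum s m f)"
    "rsum s m (\<lambda>x h. f' x h + g' x h) = rsum s m f' + rsum s m g'"
    "rsum s m (\<lambda>x h. s c (f' x h)) = s c (rsum s m f')"
  using lin_ext_fun_add[OF assms, of _ "\<lambda>(x, y). f x y" "\<lambda>(x, y). g x y"]
    lin_ext_fun_scale[OF assms, of _ c "\<lambda>(x, y). f x y"]
    lin_ext_fun_add[OF assms, of _ "\<lambda>(x, y). f' x y" "\<lambda>(x, y). g' x y"]
    lin_ext_fun_scale[OF assms, of _ c "\<lambda>(x, y). f' x y"]
  by (simp_all add: lsum_def rsum_def split_def)

lemma lsum_fun_sum:
  assumes "vector_space s"
  shows "lsum s m (\<lambda>x y. \<Sum>i\<in>I. f i x y) = (\<Sum>i\<in>I. lsum s m (f i))"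
    "rsum s m (\<lambda>x y. \<Sum>i\<in>I. f' i x y) = (\<Sum>i\<in>I. rsum s m (f' i))"
  using lin_ext_fun_sum[OF assms, of _ "\<lambda>i (x, y). f i x y" I]
    lin_ext_fun_sum[OF assms, of _ "\<lambda>i (x, y). f' i x y" I]
  by (simp_all add: lsum_def rsum_def split_def)

lemma sum_lin_ext_swap:
  assumes "vector_space s"
  shows "lsum s m (\<lambda>x y. lin_ext s t (\<lambda>p. f x y p)) = lin_ext s t (\<lambda>p. lsum s m (\<lambda>x y. f x y p))"
    "rsum s m (\<lambda>x y. lin_ext s t (\<lambda>p. f' x y p)) = lin_ext s t (\<lambda>p. rsum s m (\<lambda>x y. f' x y p))"
  using lin_ext_swap[OF assms, of _ t "\<lambda>(x, y) p. f x y p"] lin_ext_swap[OF assms, of _ t "\<lambda>(x, y) p. f' x y p"]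
  by (simp_all add: lsum_def rsum_def split_def)

lemma sum_csum_swap:
  assumes "vector_space s"
  shows "lsum s m (\<lambda>x y. csum s a (\<lambda>u v. f x y u v)) = csum s a (\<lambda>u v. lsum s m (\<lambda>x y. f x y u v))"
    "rsum s m (\<lambda>x y. csum s a (\<lambda>u v. f' x y u v)) = csum s a (\<lambda>u v. rsum s m (\<lambda>x y. f' x y u v))"
  using sum_lin_ext_swap(1)[OF assms, of m "comult H a" "\<lambda>x y (u, v). f x y u v"]
    sum_lin_ext_swap(2)[OF assms, of m "comult H a" "\<lambda>x y (u, v). f' x y u v"]
  by (simp_all add: csum_def split_def)

lemma linear_on_lsum:
  assumes "is_vs V" "linear_on V s g" "m \<in> carr M" "\<And>h x. x \<in> carr M \<Longrightarrow> f h x \<in> carr V"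
  shows "g (lsum (scl V) m f) = lsum s m (\<lambda>x y. g (f x y))"
  unfolding lsum_def using assms(3,4) keys_lcoact
  by (subst linear_on_lin_ext[OF assms(1,2)]) (auto simp: split_def)

lemma linear_on_rsum:
  assumes "is_vs V" "linear_on V s g" "m \<in> carr M" "\<And>h x. x \<in> carr M \<Longrightarrow> f x h \<in> carr V"
  shows "g (rsum (scl V) m f) = rsum s m (\<lambda>x y. g (f x y))"
  unfolding rsum_def using assms(3,4) keys_rcoact
  by (subst linear_on_lin_ext[OF assms(1,2)]) (auto simp: split_def)

lemma lsum_closed:
  assumes "is_vs V" "m \<in> carr M" "\<And>h x. x \<in> carr M \<Longrightarrow> f h x \<in> carr V"
  shows "lsum (scl V) m f \<in> carr V"
  unfolding lsum_def using assms keys_lcoact by (intro lin_ext_closed) auto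

lemma rsum_closed:
  assumes "is_vs V" "m \<in> carr M" "\<And>h x. x \<in> carr M \<Longrightarrow> f x h \<in> carr V"
  shows "rsum (scl V) m f \<in> carr V"
  unfolding rsum_def using assms keys_rcoact by (intro lin_ext_closed) auto

lemma lin_ext_lsum:
  assumes "vector_space s"
  shows "lin_ext s (lsum pscale m f) g = lsum s m (\<lambda>x y. lin_ext s (f x y) g)"
    "lin_ext s (rsum pscale m f') g = rsum s m (\<lambda>x y. lin_ext s (f' x y) g)"
  by (simp_all add: lsum_def rsum_def lin_ext_plin[OF assms] split_def)

lemmas sum_lin = csum_arg csum_fun vs_scale_simps lsum_arg lsum_fun

lemmas linM = linear_on_H linear_on_def[of M] sum_lin[OF vs_H] sum_lin[OF vs_pscale] sum_lin[OF vs_M]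
  scl_mult_left scl_mult_right distrib_left distrib_right mult.assoc S_mult Si_mult
  lact_add ract_add lact_scale ract_scale lact_lact ract_ract lact_ract

lemma lsum_coassoc:
  assumes s: "vector_space s" and m: "m \<in> carr M" and "\<And>y z. z \<in> carr M \<Longrightarrow> linear_on H s (\<lambda>x. f x y z)"
    "\<And>x z. z \<in> carr M \<Longrightarrow> linear_on H s (\<lambda>y. f x y z)" "\<And>x y. linear_on M s (f x y)"
  shows "lsum s m (\<lambda>h x. lsum s x (\<lambda>k y. f h k y)) = lsum s m (\<lambda>h x. csum s h (\<lambda>a b. f a b x))"
proof -
  let ?L = "\<lambda>t. lin_ext s t (\<lambda>(x, T). lin_ext s T (\<lambda>(y, z). f x y z))"
  note e = lin_ext_ten3[of s H H M f, OF s is_vs_H is_vs_H is_vs_M assms(3-5) in_carr_H in_carr_H]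
  have "?L (plin (lcoact M m) (\<lambda>(h1, v'). plin (lcoact M v') (\<lambda>(h2, v0). ten H (tsp H M) h1 (ten H M h2 v0)))) =
    ?L (plin (lcoact M m) (\<lambda>(h, v0). plin (comult H h) (\<lambda>(h1, h2). ten H (tsp H M) h1 (ten H M h2 v0))))"
    using lcomodule m by (simp add: left_comodule_def)
  then have "lsum s m (\<lambda>h x. lsum s x (\<lambda>k y. ?L (ten H (tsp H M) h (ten H M k y)))) =
     lsum s m (\<lambda>h x. csum s h (\<lambda>a b. ?L (ten H (tsp H M) a (ten H M b x))))"
    by (simp add: lin_ext_plin[OF s] split_def csum_def lsum_def)
  then show ?thesis by (simp add: e m cong: lsum_cong)
qed

lemma rsum_coassoc:
  assumes s: "vector_space s" and m: "m \<in> carr M" and "\<And>y z. linear_on M s (\<lambda>x. f x y z)"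
    "\<And>x z. x \<in> carr M \<Longrightarrow> linear_on H s (\<lambda>y. f x y z)" "\<And>x y. x \<in> carr M \<Longrightarrow> linear_on H s (f x y)"
  shows "rsum s m (\<lambda>x h. rsum s x (\<lambda>y k. f y k h)) = rsum s m (\<lambda>x h. csum s h (\<lambda>a b. f x a b))"
proof -
  let ?L = "\<lambda>t. lin_ext s t (\<lambda>(x, T). lin_ext s T (\<lambda>(y, z). f x y z))"
  note e = lin_ext_ten3[of s M H H f, OF s is_vs_M is_vs_H is_vs_H assms(3-5) _ in_carr_H in_carr_H]
  have "?L (plin (rcoact M m) (\<lambda>(v', h2). plin (rcoact M v') (\<lambda>(v0, h1). ten M (tsp H H) v0 (ten H H h1 h2)))) =
    ?L (plin (rcoact M m) (\<lambda>(v0, h). plin (comult H h) (\<lambda>(h1, h2). ten M (tsp H H) v0 (ten H H h1 h2))))"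
    using rcomodule m by (simp add: right_comodule_def)
  then have "rsum s m (\<lambda>x h. rsum s x (\<lambda>y k. ?L (ten M (tsp H H) y (ten H H k h)))) =
     rsum s m (\<lambda>x h. csum s h (\<lambda>a b. ?L (ten M (tsp H H) x (ten H H a b))))"
    by (simp add: lin_ext_plin[OF s] split_def csum_def rsum_def)
  then show ?thesis by (simp add: e m cong: rsum_cong)
qed

lemma lsum_counit:
  assumes m: "m \<in> carr M" and f: "linear_on M s f"
  shows "lsum s m (\<lambda>h x. s (eps h) (f x)) = f m"
proof -
  have "f (lsum (scl M) m (\<lambda>h x. scl M (eps h) x)) = f m"
    using lcomodule m by (simp add: left_comodule_def lsum_def)
  then show ?thesis using f m
    by (simp add: linear_on_lsum[of M] cong: lsum_cong) (simp add: linear_on_def cong: lsum_cong)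
qed

lemma rsum_counit:
  assumes m: "m \<in> carr M" and f: "linear_on M s f"
  shows "rsum s m (\<lambda>x h. s (eps h) (f x)) = f m"
proof -
  have "f (rsum (scl M) m (\<lambda>x h. scl M (eps h) x)) = f m"
    using rcomodule m by (simp add: right_comodule_def rsum_def)
  then show ?thesis using f m
    by (simp add: linear_on_rsum[of M] cong: rsum_cong) (simp add: linear_on_def cong: rsum_cong)
qed

lemma lsum_act:
  assumes s: "vector_space s" and m: "m \<in> carr M" and "\<And>x. x \<in> carr M \<Longrightarrow> linear_on H s (\<lambda>h. f h x)"
    "\<And>h. linear_on M s (f h)"
  shows "lsum s (m \<lhd> a) f = lsum s m (\<lambda>h x. csum s a (\<lambda>a1 a2. f (h * a1) (x \<lhd> a2)))"
    and "lsum s (a \<rhd> m) f = csum s a (\<lambda>a1 a2. lsum s m (\<lambda>h x. f (a1 * h) (a2 \<rhd> x)))"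
proof -
  let ?L = "\<lambda>t. lin_ext s t (\<lambda>(x, y). f x y)"
  note e = lin_ext_ten[of s M H f, OF s assms(3,4) in_carr_H]
  have "lsum s (m \<lhd> a) f = lsum s m (\<lambda>h x. csum s a (\<lambda>a1 a2. ?L (ten H M (h * a1) (x \<lhd> a2))))"
    using m by (simp add: lin_ext_plin[OF s] split_def csum_def lsum_def lcoact_ract)
  then show "lsum s (m \<lhd> a) f = lsum s m (\<lambda>h x. csum s a (\<lambda>a1 a2. f (h * a1) (x \<lhd> a2)))"
    using m by (simp add: e cong: lsum_cong)
  have "lsum s (a \<rhd> m) f = csum s a (\<lambda>a1 a2. lsum s m (\<lambda>h x. ?L (ten H M (a1 * h) (a2 \<rhd> x))))"
    using m by (simp add: lin_ext_plin[OF s] split_def csum_def lsum_def lcoact_lact)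
  then show "lsum s (a \<rhd> m) f = csum s a (\<lambda>a1 a2. lsum s m (\<lambda>h x. f (a1 * h) (a2 \<rhd> x)))"
    using m by (simp add: e cong: lsum_cong)
qed

lemma rsum_act:
  assumes s: "vector_space s" and m: "m \<in> carr M" and "\<And>h. linear_on M s (\<lambda>x. f x h)"
    "\<And>x. x \<in> carr M \<Longrightarrow> linear_on H s (f x)"
  shows "rsum s (m \<lhd> a) f = rsum s m (\<lambda>x h. csum s a (\<lambda>a1 a2. f (x \<lhd> a1) (h * a2)))"
    and "rsum s (a \<rhd> m) f = csum s a (\<lambda>a1 a2. rsum s m (\<lambda>x h. f (a1 \<rhd> x) (a2 * h)))"
proof -
  let ?L = "\<lambda>t. lin_ext s t (\<lambda>(x, y). f x y)"
  note e = lin_ext_ten[of s H M f, OF s assms(3,4) _ in_carr_H]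
  have "rsum s (m \<lhd> a) f = rsum s m (\<lambda>x h. csum s a (\<lambda>a1 a2. ?L (ten M H (x \<lhd> a1) (h * a2))))"
    using m by (simp add: lin_ext_plin[OF s] split_def csum_def rsum_def rcoact_ract)
  then show "rsum s (m \<lhd> a) f = rsum s m (\<lambda>x h. csum s a (\<lambda>a1 a2. f (x \<lhd> a1) (h * a2)))"
    using m by (simp add: e cong: rsum_cong)
  have "rsum s (a \<rhd> m) f = csum s a (\<lambda>a1 a2. rsum s m (\<lambda>x h. ?L (ten M H (a1 \<rhd> x) (a2 * h))))"
    using m by (simp add: lin_ext_plin[OF s] split_def csum_def rsum_def rcoact_lact)
  then show "rsum s (a \<rhd> m) f = csum s a (\<lambda>a1 a2. rsum s m (\<lambda>x h. f (a1 \<rhd> x) (a2 * h)))"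
    using m by (simp add: e cong: rsum_cong)
qed

section \<open>Coinvariants and the projections onto them\<close>

definition coL :: "'m set" where "coL = left_coinvariants H M"
definition coR :: "'m set" where "coR = {m \<in> carr M. rcoact M m = ten M H m 1}"

lemma coL_carr [simp]: "w \<in> coL \<Longrightarrow> w \<in> carr M" and coR_carr [simp]: "e \<in> coR \<Longrightarrow> e \<in> carr M"
  by (simp_all add: coL_def coR_def left_coinvariants_def)

lemma lsum_coL:
  assumes "vector_space s" "w \<in> coL" "\<And>x. x \<in> carr M \<Longrightarrow> linear_on H s (\<lambda>h. f h x)" "\<And>h. linear_on M s (f h)"
  shows "lsum s w f = f 1 w"
  using assms lin_ext_ten[of s M H f 1 w] by (simp add: lsum_def coL_def left_coinvariants_def del: coL_carr)

lemma rsum_coR: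
  assumes "vector_space s" "e \<in> coR" "\<And>h. linear_on M s (\<lambda>x. f x h)" "\<And>x. x \<in> carr M \<Longrightarrow> linear_on H s (f x)"
  shows "rsum s e f = f e 1"
  using assms lin_ext_ten[of s H M f e 1] by (simp add: rsum_def coR_def del: coR_carr)

text \<open>The projections m_0S^{-1}(m_{-1}) and m_0S(m_1) of Hopf module theory. Combining a left
  coaction with a right action is what calls for the inverse antipode.\<close>

definition PL :: "'m \<Rightarrow> 'm" where "PL m = lsum (scl M) m (\<lambda>h x. x \<lhd> Si h)"
definition PR :: "'m \<Rightarrow> 'm" where "PR m = rsum (scl M) m (\<lambda>x h. x \<lhd> S h)"

lemma PL_closed [simp]: "m \<in> carr M \<Longrightarrow> PL m \<in> carr M" and PR_closed [simp]: "m \<in> carr M \<Longrightarrow> PR m \<in> carr M"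
  unfolding PL_def PR_def by (simp_all add: lsum_closed rsum_closed)

text \<open>In the coaction of m_0S^{-1}(m_{-1}) the factor in \<open>H\<close> is
  m_{-1}S^{-1}(m_{-2}), next to m_0S^{-1}(m_{-3}); it collapses to 1. The bilinear \<open>f\<close>
  becomes \<open>ten H M\<close> in the proof that the result is coinvariant.\<close>

lemma lsum_PL:
  assumes s: "vector_space s" and m: "m \<in> carr M" and f: "\<And>x. x \<in> carr M \<Longrightarrow> linear_on H s (\<lambda>h. f h x)"
    "\<And>h. linear_on M s (f h)"
  shows "lsum s (PL m) f = f 1 (PL m)"
proof -
  note l = linM sum_lin[OF s] f(1)[unfolded linear_on_H] f(2)[unfolded linear_on_def]
  have *: "lsum s (x \<lhd> Si h) f = lsum s x (\<lambda>k y. csum s h (\<lambda>a b. f (k * Si b) (y \<lhd> Si a)))"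
    if "x \<in> carr M" for x h
  proof -
    have "lsum s (x \<lhd> Si h) f = lsum s x (\<lambda>k y. csum s (Si h) (\<lambda>u v. f (k * u) (y \<lhd> v)))"
      by (rule lsum_act) (simp_all add: l s that)
    also have "\<dots> = lsum s x (\<lambda>k y. csum s h (\<lambda>a b. f (k * Si b) (y \<lhd> Si a)))"
      by (intro lsum_cong refl that csum_Si) (simp_all add: l s)
    finally show ?thesis .
  qed
  have "lsum s (PL m) f = lsum s m (\<lambda>h x. lsum s (x \<lhd> Si h) f)"
    unfolding PL_def by (rule linear_on_lsum) (simp_all add: l m)
  also have "\<dots> = lsum s m (\<lambda>h x. lsum s x (\<lambda>k y. csum s h (\<lambda>a b. f (k * Si b) (y \<lhd> Si a))))"
    by (intro lsum_cong refl m *)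
  also have "\<dots> = lsum s m (\<lambda>h x. csum s h (\<lambda>h1 k. csum s h1 (\<lambda>a b. f (k * Si b) (x \<lhd> Si a))))"
    by (rule lsum_coassoc) (simp_all add: l s m)
  also have "\<dots> = lsum s m (\<lambda>h x. f 1 (x \<lhd> Si h))"
    by (intro lsum_cong refl m csum_cancel_Si_right(2)[where F = "\<lambda>a b. f b (x \<lhd> Si a)" for x])
      (simp_all add: l s m)
  also have "\<dots> = f 1 (PL m)"
    unfolding PL_def by (rule linear_on_lsum[symmetric]) (simp_all add: l m)
  finally show ?thesis .
qed

lemma rsum_PR:
  assumes s: "vector_space s" and m: "m \<in> carr M" and f: "\<And>h. linear_on M s (\<lambda>x. f x h)"
    "\<And>x. x \<in> carr M \<Longrightarrow> linear_on H s (f x)"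
  shows "rsum s (PR m) f = f (PR m) 1"
proof -
  note l = linM sum_lin[OF s] f(1)[unfolded linear_on_def] f(2)[unfolded linear_on_H]
  have *: "rsum s (x \<lhd> S h) f = rsum s x (\<lambda>y k. csum s h (\<lambda>a b. f (y \<lhd> S b) (k * S a)))"
    if "x \<in> carr M" for x h
  proof -
    have "rsum s (x \<lhd> S h) f = rsum s x (\<lambda>y k. csum s (S h) (\<lambda>u v. f (y \<lhd> u) (k * v)))"
      by (rule rsum_act) (simp_all add: l s that)
    also have "\<dots> = rsum s x (\<lambda>y k. csum s h (\<lambda>a b. f (y \<lhd> S b) (k * S a)))"
      by (intro rsum_cong refl that csum_S) (simp_all add: l s)
    finally show ?thesis .
  qed
  have "rsum s (PR m) f = rsum s m (\<lambda>x h. rsum s (x \<lhd> S h) f)"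
    unfolding PR_def by (rule linear_on_rsum) (simp_all add: l m)
  also have "\<dots> = rsum s m (\<lambda>x h. rsum s x (\<lambda>y k. csum s h (\<lambda>a b. f (y \<lhd> S b) (k * S a))))"
    by (intro rsum_cong refl m *)
  also have "\<dots> = rsum s m (\<lambda>x h. csum s h (\<lambda>k h2. csum s h2 (\<lambda>a b. f (x \<lhd> S b) (k * S a))))"
    by (rule rsum_coassoc) (simp_all add: l s m)
  also have "\<dots> = rsum s m (\<lambda>x h. f (x \<lhd> S h) 1)"
    by (intro rsum_cong refl m csum_cancel_S_right(1)[where F = "\<lambda>a b. f (x \<lhd> S b) a" for x])
      (simp_all add: l s m)
  also have "\<dots> = f (PR m) 1"
    unfolding PR_def by (rule linear_on_rsum[symmetric, where g = "\<lambda>x. f x 1"]) (simp_all add: l m)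
  finally show ?thesis .
qed

lemma PL_coL [simp]: "m \<in> carr M \<Longrightarrow> PL m \<in> coL"
proof -
  assume m: "m \<in> carr M"
  have "lcoact M (PL m) = lsum pscale (PL m) (ten H M)"
    unfolding lsum_def by (rule tsp_expand[symmetric]) (simp add: coact_scale m)
  also have "\<dots> = ten H M 1 (PL m)"
    by (rule lsum_PL) (simp_all add: m linear_on_def ten_add_left ten_add_right ten_scale_left ten_scale_right)
  finally show ?thesis using m by (simp add: coL_def left_coinvariants_def del: coL_carr)
qed

lemma PR_coR [simp]: "m \<in> carr M \<Longrightarrow> PR m \<in> coR"
proof -
  assume m: "m \<in> carr M"
  have "rcoact M (PR m) = rsum pscale (PR m) (ten M H)"
    unfolding rsum_def by (rule tsp_expand[symmetric]) (simp add: coact_scale m)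
  also have "\<dots> = ten M H (PR m) 1"
    by (rule rsum_PR) (simp_all add: m linear_on_def ten_add_left ten_add_right ten_scale_left ten_scale_right)
  finally show ?thesis using m by (simp add: coR_def del: coR_carr)
qed

text \<open>The left side is m_0S^{-1}(m_{-1})m_{-2}. This is the generating half of the structure
  theorem for Hopf modules: coinvariants generate under the right action.\<close>

lemma PL_expand:
  assumes m: "m \<in> carr M"
  shows "lsum (scl M) m (\<lambda>h x. PL x \<lhd> h) = m"
proof -
  have "lsum (scl M) m (\<lambda>h x. PL x \<lhd> h) = lsum (scl M) m (\<lambda>h x. lsum (scl M) x (\<lambda>k y. y \<lhd> (Si k * h)))"
    unfolding PL_def
    by (intro lsum_cong refl m, subst linear_on_lsum[of M "scl M" "\<lambda>x. x \<lhd> a" for a])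
      (simp_all add: linM cong: lsum_cong)
  also have "\<dots> = lsum (scl M) m (\<lambda>h x. csum (scl M) h (\<lambda>a b. x \<lhd> (Si b * a)))"
    by (rule lsum_coassoc) (simp_all add: m linM)
  also have "\<dots> = lsum (scl M) m (\<lambda>h x. scl M (eps h) (x \<lhd> 1))"
    by (intro lsum_cong refl m csum_antipode_inv_left) (simp_all add: linM)
  also have "\<dots> = m"
    by (subst lsum_counit) (simp_all add: m linM)
  finally show ?thesis .
qed

lemma PR_expand:
  assumes m: "m \<in> carr M"
  shows "rsum (scl M) m (\<lambda>x h. PR x \<lhd> h) = m"
proof -
  have "rsum (scl M) m (\<lambda>x h. PR x \<lhd> h) = rsum (scl M) m (\<lambda>x h. rsum (scl M) x (\<lambda>y k. y \<lhd> (S k * h)))"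
    unfolding PR_def
    by (intro rsum_cong refl m, subst linear_on_rsum[of M "scl M" "\<lambda>x. x \<lhd> a" for a])
      (simp_all add: linM cong: rsum_cong)
  also have "\<dots> = rsum (scl M) m (\<lambda>x h. csum (scl M) h (\<lambda>a b. x \<lhd> (S a * b)))"
    by (rule rsum_coassoc) (simp_all add: m linM)
  also have "\<dots> = rsum (scl M) m (\<lambda>x h. scl M (eps h) (x \<lhd> 1))"
    by (intro rsum_cong refl m csum_antipode_left) (simp_all add: linM)
  also have "\<dots> = m"
    by (subst rsum_counit) (simp_all add: m linM)
  finally show ?thesis .
qed

lemma PL_id:
  assumes "w \<in> coL"
  shows "PL w = w"
  unfolding PL_def using assms by (subst lsum_coL) (simp_all add: linM)

text \<open>The two legs of \<open>a\<close> meet as a_2S^{-1}(a_1). Later this makes the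
  coefficients with respect to a coinvariant basis right linear.\<close>

lemma PL_ract:
  assumes m: "m \<in> carr M"
  shows "PL (m \<lhd> a) = scl M (eps a) (PL m)"
proof -
  have "PL (m \<lhd> a) = lsum (scl M) m (\<lambda>h x. csum (scl M) a (\<lambda>a1 a2. (x \<lhd> a2) \<lhd> Si (h * a1)))"
    unfolding PL_def by (rule lsum_act) (simp_all add: m linM)
  also have "\<dots> = lsum (scl M) m (\<lambda>h x. csum (scl M) a (\<lambda>a1 a2. x \<lhd> ((a2 * Si a1) * Si h)))"
    using m by (simp add: linM cong: lsum_cong)
  also have "\<dots> = lsum (scl M) m (\<lambda>h x. scl M (eps a) (x \<lhd> (1 * Si h)))"
    by (intro lsum_cong refl m csum_antipode_inv_right) (simp add: linM)
  also have "\<dots> = scl M (eps a) (PL m)"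
    by (simp add: PL_def linM)
  finally show ?thesis .
qed

lemma PL_linear: "linear_on M (scl M) PL"
  by (simp add: PL_def linM)

section \<open>Spanning sets of tensor powers\<close>

lemma keys_words:
  assumes "t \<in> carr (hpow M n)"
  shows "Poly_Mapping.keys t \<subseteq> words M n"
  using hpow_keys[OF is_vs_M _ _ assms] by simp

lemma hpow_expand': "t \<in> carr (hpow M n) \<Longrightarrow> plin t (hten M) = t"
  by (rule hpow_expand[OF _ keys_words])

lemma words_closed: "w \<in> words M n \<Longrightarrow> hten M w \<in> carr (hpow M n)"
  by (rule hten_closed) (simp_all add: words_def)

lemma hten_closed' [simp]:
  "x \<in> carr M \<Longrightarrow> hten M [x] \<in> carr (hpow M (Suc 0))"
  "x \<in> carr M \<Longrightarrow> y \<in> carr M \<Longrightarrow> hten M [x, y] \<in> carr (hpow M 2)"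
  "x \<in> carr M \<Longrightarrow> y \<in> carr M \<Longrightarrow> z \<in> carr M \<Longrightarrow> hten M [x, y, z] \<in> carr (hpow M 3)"
  by (simp_all add: hten_closed)

lemma linear_on_hpow:
  assumes "linear_on (hpow M n) s f" "t \<in> carr (hpow M n)"
  shows "f t = lin_ext s t (\<lambda>w. f (hten M w))"
proof -
  have "f (lin_ext (scl (hpow M n)) t (hten M)) = lin_ext s t (\<lambda>w. f (hten M w))"
    using keys_words[OF assms(2)] words_closed by (intro linear_on_lin_ext[OF _ assms(1)]) auto
  then show ?thesis by (simp add: hpow_expand'[OF assms(2)])
qed

lemma hpow_eqI:
  assumes "linear_on (hpow M n) s f" "linear_on (hpow M n) s g" "t \<in> carr (hpow M n)"
    "\<And>w. w \<in> words M n \<Longrightarrow> f (hten M w) = g (hten M w)"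
  shows "f t = g t"
  unfolding linear_on_hpow[OF assms(1,3)] linear_on_hpow[OF assms(2,3)]
  using keys_words[OF assms(3)] assms(4) by (intro lin_ext_cong) auto

lemmas linT = linM hten_simps

lemmas lsum_closed_hpow = lsum_closed[where V = "hpow M n" for n, simplified]
lemmas rsum_closed_hpow = rsum_closed[where V = "hpow M n" for n, simplified]

lemma csum_closed:
  assumes "is_vs V" "\<And>x y. f x y \<in> carr V"
  shows "csum (scl V) a f \<in> carr V"
  unfolding csum_def using assms by (intro lin_ext_closed) auto

lemmas csum_closed_hpow = csum_closed[where V = "hpow M n" for n, simplified]

lemma linear_on_lsum_hpow:
  assumes "linear_on (hpow M n) s g" "m \<in> carr M" "\<And>h x. x \<in> carr M \<Longrightarrow> f h x \<in> carr (hpow M n)"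
  shows "g (lsum pscale m f) = lsum s m (\<lambda>x y. g (f x y))"
  using linear_on_lsum[of "hpow M n" s g m f] assms by simp

lemma linear_on_rsum_hpow:
  assumes "linear_on (hpow M n) s g" "m \<in> carr M" "\<And>h x. x \<in> carr M \<Longrightarrow> f x h \<in> carr (hpow M n)"
  shows "g (rsum pscale m f) = rsum s m (\<lambda>x y. g (f x y))"
  using linear_on_rsum[of "hpow M n" s g m f] assms by simp

lemma linear_on_csum_hpow:
  assumes "linear_on (hpow M n) s g" "\<And>h x. f x h \<in> carr (hpow M n)"
  shows "g (csum pscale a f) = csum s a (\<lambda>x y. g (f x y))"
  using linear_on_csum[of "hpow M n" s g f a] assms by simp

text \<open>The coefficient m_{-1} of PL(m_0) moves across the tensor sign, and m_{-1}n is then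
  expanded in right coinvariants.\<close>

lemma hten_expand_LR:
  assumes m: "m \<in> carr M" and n: "n \<in> carr M"
  shows "hten M [m, n] = lsum pscale m (\<lambda>h x. rsum pscale (h \<rhd> n) (\<lambda>y k. hten M [PL x, PR y \<lhd> k]))"
proof -
  have "hten M [lsum (scl M) m (\<lambda>h x. PL x \<lhd> h), n] = lsum pscale m (\<lambda>h x. hten M [PL x \<lhd> h, n])"
    by (rule linear_on_lsum) (simp_all add: m n linT)
  moreover have "hten M [PL x \<lhd> h, n] = rsum pscale (h \<rhd> n) (\<lambda>y k. hten M [PL x, PR y \<lhd> k])"
    if x: "x \<in> carr M" for x h
  proof -
    have "hten M [PL x, rsum (scl M) (h \<rhd> n) (\<lambda>y k. PR y \<lhd> k)] = rsum pscale (h \<rhd> n) (\<lambda>y k. hten M [PL x, PR y \<lhd> k])"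
      by (rule linear_on_rsum) (simp_all add: x n linT)
    then show ?thesis using x n by (simp add: PR_expand hten_moves)
  qed
  ultimately show ?thesis by (simp add: m n PL_expand cong: lsum_cong)
qed

lemma hten_expand_RL:
  assumes m: "m \<in> carr M" and n: "n \<in> carr M"
  shows "hten M [m, n] = rsum pscale m (\<lambda>x h. lsum pscale (h \<rhd> n) (\<lambda>k y. hten M [PR x, PL y \<lhd> k]))"
proof -
  have "hten M [rsum (scl M) m (\<lambda>x h. PR x \<lhd> h), n] = rsum pscale m (\<lambda>x h. hten M [PR x \<lhd> h, n])"
    by (rule linear_on_rsum) (simp_all add: m n linT)
  moreover have "hten M [PR x \<lhd> h, n] = lsum pscale (h \<rhd> n) (\<lambda>k y. hten M [PR x, PL y \<lhd> k])"
    if x: "x \<in> carr M" for x h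
  proof -
    have "hten M [PR x, lsum (scl M) (h \<rhd> n) (\<lambda>k y. PL y \<lhd> k)] = lsum pscale (h \<rhd> n) (\<lambda>k y. hten M [PR x, PL y \<lhd> k])"
      by (rule linear_on_lsum) (simp_all add: x n linT)
    then show ?thesis using x n by (simp add: PL_expand hten_moves)
  qed
  ultimately show ?thesis by (simp add: m n PR_expand cong: rsum_cong)
qed

text \<open>Identities about the braiding are checked by this principle, because on such tensors its
  formula has no Sweedler sum left. The maps compared are only linear over the ground field, hence
  the coefficient \<open>k\<close>.\<close>

lemma hpow2_eqI_LR:
  assumes f: "linear_on (hpow M 2) s f" and g: "linear_on (hpow M 2) s g" and t: "t \<in> carr (hpow M 2)"
    and eq: "\<And>w e k. w \<in> coL \<Longrightarrow> e \<in> coR \<Longrightarrow> f (hten M [w, e \<lhd> k]) = g (hten M [w, e \<lhd> k])"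
  shows "f t = g t"
proof (rule hpow_eqI[OF f g t])
  fix w assume "w \<in> words M 2"
  then obtain m n where w: "w = [m, n]" and mn: "m \<in> carr M" "n \<in> carr M" by (auto simp: words_2)
  have "F (hten M w) = lsum s m (\<lambda>h x. rsum s (h \<rhd> n) (\<lambda>y k. F (hten M [PL x, PR y \<lhd> k])))"
    if F: "linear_on (hpow M 2) s F" for F
    unfolding w hten_expand_LR[OF mn] using mn
    by (simp add: linear_on_lsum_hpow[OF F] linear_on_rsum_hpow[OF F] rsum_closed_hpow cong: lsum_cong)
  from this[OF f] this[OF g] show "f (hten M w) = g (hten M w)"
    using mn by (simp add: eq cong: lsum_cong rsum_cong)
qed

lemma hpow2_eqI_RL:
  assumes f: "linear_on (hpow M 2) s f" and g: "linear_on (hpow M 2) s g" and t: "t \<in> carr (hpow M 2)"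
    and eq: "\<And>w e k. w \<in> coL \<Longrightarrow> e \<in> coR \<Longrightarrow> f (hten M [e, w \<lhd> k]) = g (hten M [e, w \<lhd> k])"
  shows "f t = g t"
proof (rule hpow_eqI[OF f g t])
  fix w assume "w \<in> words M 2"
  then obtain m n where w: "w = [m, n]" and mn: "m \<in> carr M" "n \<in> carr M" by (auto simp: words_2)
  have "F (hten M w) = rsum s m (\<lambda>x h. lsum s (h \<rhd> n) (\<lambda>k y. F (hten M [PR x, PL y \<lhd> k])))"
    if F: "linear_on (hpow M 2) s F" for F
    unfolding w hten_expand_RL[OF mn] using mn
    by (simp add: linear_on_lsum_hpow[OF F] linear_on_rsum_hpow[OF F] lsum_closed_hpow cong: rsum_cong)
  from this[OF f] this[OF g] show "f (hten M w) = g (hten M w)"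
    using mn by (simp add: eq cong: lsum_cong rsum_cong)
qed

text \<open>Whatever the bilinear map \<open>Q\<close>, the map \<open>(m, n) \<mapsto> Q (m\<^sub>0S(m\<^sub>1)) (m\<^sub>2n)\<close> is \<open>H\<close>-balanced. Both the
  inverse of the braiding and \<open>\<phi> \<oplus> \<phi>\<close> have this form.\<close>

definition twist :: "('k \<Rightarrow> 'v::ab_group_add \<Rightarrow> 'v) \<Rightarrow> ('m \<Rightarrow> 'm \<Rightarrow> 'v) \<Rightarrow> 'm \<Rightarrow> 'm \<Rightarrow> 'v" where
  "twist s Q m n = rsum s m (\<lambda>m0 h. csum s h (\<lambda>m1 m2. Q (m0 \<lhd> S m1) (m2 \<rhd> n)))"

context
  fixes s :: "'k \<Rightarrow> 'v::ab_group_add \<Rightarrow> 'v" and Q :: "'m \<Rightarrow> 'm \<Rightarrow> 'v"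
  assumes s: "vector_space s" and Q: "\<And>y. y \<in> carr M \<Longrightarrow> linear_on M s (\<lambda>x. Q x y)"
    "\<And>x. x \<in> carr M \<Longrightarrow> linear_on M s (Q x)"
begin

lemmas linQ = linT sum_lin[OF s] Q(1)[unfolded linear_on_def] Q(2)[unfolded linear_on_def]

text \<open>Replacing m by ma gives m_0a_1S(a_2)S(m_1) in the first slot and m_2a_3n in the second;
  the pair a_1S(a_2) cancels and \<open>a\<close> is left in front of n.\<close>

lemma twist_balanced:
  assumes m: "m \<in> carr M" and n: "n \<in> carr M"
  shows "twist s Q (m \<lhd> a) n = twist s Q m (a \<rhd> n)"
proof -
  let ?G = "\<lambda>x h. csum s h (\<lambda>m1 m2. Q (x \<lhd> S m1) (m2 \<rhd> n))"
  have *: "csum s a (\<lambda>a1 a2. ?G (x \<lhd> a1) (h * a2)) = csum s h (\<lambda>m1 m2. Q (x \<lhd> S m1) (m2 \<rhd> a \<rhd> n))"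
    if x: "x \<in> carr M" for x h
  proof -
    have "csum s a (\<lambda>a1 a2. ?G (x \<lhd> a1) (h * a2)) =
       csum s a (\<lambda>a1 a2. csum s h (\<lambda>m1 m2. csum s a2 (\<lambda>b1 b2. Q (x \<lhd> a1 \<lhd> S (m1 * b1)) ((m2 * b2) \<rhd> n))))"
      by (subst csum_mult) (simp_all add: linQ x n s)
    also have "\<dots> = csum s h (\<lambda>m1 m2. csum s a (\<lambda>a1 a2. csum s a2 (\<lambda>b1 b2. Q (x \<lhd> ((a1 * S b1) * S m1)) ((m2 * b2) \<rhd> n))))"
      by (subst csum_swap[OF s]) (simp add: linQ x)
    also have "\<dots> = csum s h (\<lambda>m1 m2. Q (x \<lhd> (1 * S m1)) ((m2 * a) \<rhd> n))"
      by (subst csum_cancel_S_right(1)[of s "\<lambda>z b2. Q (x \<lhd> (z * S m1)) ((m2 * b2) \<rhd> n)" for m1 m2])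
        (simp_all add: linQ x n s)
    finally show ?thesis by (simp add: linQ x n)
  qed
  have "twist s Q (m \<lhd> a) n = rsum s m (\<lambda>x h. csum s a (\<lambda>a1 a2. ?G (x \<lhd> a1) (h * a2)))"
    unfolding twist_def by (rule rsum_act) (simp_all add: linQ m n s)
  also have "\<dots> = twist s Q m (a \<rhd> n)"
    unfolding twist_def by (intro rsum_cong refl m *)
  finally show ?thesis .
qed

lemma twist_linear:
  "y \<in> carr M \<Longrightarrow> linear_on M s (\<lambda>x. twist s Q x y)"
  "x \<in> carr M \<Longrightarrow> linear_on M s (twist s Q x)"
  by (simp_all add: twist_def linQ cong: rsum_cong)

lemma lin_ext_twist:
  assumes m: "m \<in> carr M" and n: "n \<in> carr M"
  shows "lin_ext s (hten M [m, n]) (\<lambda>w. twist s Q (w ! 0) (w ! 1)) = twist s Q m n"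
  using lin_ext_hten2[OF s, of M "\<lambda>w. twist s Q (w ! 0) (w ! 1)" m n] twist_linear twist_balanced
  by simp

lemma twist_coR:
  assumes "e \<in> coR" "n \<in> carr M"
  shows "twist s Q e n = Q e n"
  unfolding twist_def using assms
  by (subst rsum_coR) (simp_all add: linQ s csum_one)

text \<open>If \<open>Q\<close> is already balanced, S(m_1) moves over to m_2 and the detour through
  the coaction cancels.\<close>

lemma twist_of_balanced:
  assumes m: "m \<in> carr M" and n: "n \<in> carr M"
    and b: "\<And>x y a. x \<in> carr M \<Longrightarrow> y \<in> carr M \<Longrightarrow> Q (x \<lhd> a) y = Q x (a \<rhd> y)"
  shows "twist s Q m n = Q m n"
proof -
  have "twist s Q m n = rsum s m (\<lambda>m0 h. csum s h (\<lambda>m1 m2. Q m0 ((S m1 * m2) \<rhd> n)))"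
    unfolding twist_def using m n by (simp add: b lact_lact cong: rsum_cong)
  also have "\<dots> = rsum s m (\<lambda>m0 h. s (eps h) (Q m0 (1 \<rhd> n)))"
    by (intro rsum_cong refl m csum_antipode_left) (simp add: linQ n)
  also have "\<dots> = Q m n"
    by (subst rsum_counit) (simp_all add: m n Q)
  finally show ?thesis .
qed

end

section \<open>The Woronowicz braiding\<close>

definition braid_word :: "'m \<Rightarrow> 'm \<Rightarrow> ('m list \<Rightarrow>\<^sub>0 'k)" where
  "braid_word m n = lsum pscale m (\<lambda>h m0. csum pscale h (\<lambda>h2 h1. rsum pscale n (\<lambda>n0 g. csum pscale g (\<lambda>n1 n2.
     hten M [(h2 \<rhd> n0) \<lhd> S n1, (S h1 \<rhd> m0) \<lhd> n2]))))"

lemma braiding_eq: "braiding H M t = plin t (\<lambda>w. braid_word (w ! 0) (w ! 1))"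
  by (simp add: braiding_def braid_word_def lsum_def csum_def rsum_def)

lemma braid_word_linear:
  "n \<in> carr M \<Longrightarrow> linear_on M pscale (\<lambda>m. braid_word m n)"
  "m \<in> carr M \<Longrightarrow> linear_on M pscale (braid_word m)"
  by (simp_all add: braid_word_def linT cong: lsum_cong rsum_cong)

text \<open>Both sides equal m_{-2}a_1n_0S(n_1) \<otimes> S(m_{-1}a_2)m_0a_3n_2. Starting from an,
  the factor S(a_2) arises at the end of the first tensor factor and has to pass through the tensor
  sign.\<close>

lemma braid_word_balanced:
  assumes m: "m \<in> carr M" and n: "n \<in> carr M"
  shows "braid_word (m \<lhd> a) n = braid_word m (a \<rhd> n)"
proof -
  \<comment> \<open>The coefficients taken from \<open>H\<close> are separate arguments, so that
    \<open>R\<close> is linear in each of them and the legs of \<open>a\<close> can be regrouped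
    outside.\<close>
  define R where "R p q x y = rsum pscale n (\<lambda>n0 g. csum pscale g (\<lambda>n1 n2.
     hten M [(p \<rhd> n0) \<lhd> S n1, (q \<rhd> (x \<lhd> y)) \<lhd> n2]))" for p q x y
  have Rl: "linear_on M pscale (\<lambda>x. R p q x y)"
      "x \<in> carr M \<Longrightarrow> linear_on H pscale (\<lambda>p. R p q x y)"
      "x \<in> carr M \<Longrightarrow> linear_on H pscale (\<lambda>q. R p q x y)"
      "x \<in> carr M \<Longrightarrow> linear_on H pscale (\<lambda>y. R p q x y)" for p q x y
    using n by (simp_all add: R_def linT cong: rsum_cong)
  note l = linT Rl[unfolded linear_on_H] Rl[unfolded linear_on_def[of M]]
  have "braid_word (m \<lhd> a) n = lsum pscale (m \<lhd> a) (\<lambda>h x. csum pscale h (\<lambda>p q. R p (S q) x 1))"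
    unfolding braid_word_def R_def using m n by (simp cong: lsum_cong)
  also have "\<dots> = lsum pscale m (\<lambda>h x. csum pscale a (\<lambda>a1 a2. csum pscale (h * a1) (\<lambda>p q. R p (S q) (x \<lhd> a2) 1)))"
    by (rule lsum_act) (simp_all add: l m)
  also have "\<dots> = lsum pscale m (\<lambda>h x. csum pscale a (\<lambda>a1 a2. csum pscale h (\<lambda>p q. csum pscale a1 (\<lambda>b1 b2.
       R (p * b1) (S (q * b2)) x a2))))"
  proof (intro lsum_cong refl m)
    fix h x assume x: "x \<in> carr M"
    have R1: "R p q (x \<lhd> a) 1 = R p q x a" for p q a
      using x by (simp add: R_def ract_ract)
    show "csum pscale a (\<lambda>a1 a2. csum pscale (h * a1) (\<lambda>p q. R p (S q) (x \<lhd> a2) 1)) =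
      csum pscale a (\<lambda>a1 a2. csum pscale h (\<lambda>p q. csum pscale a1 (\<lambda>b1 b2. R (p * b1) (S (q * b2)) x a2)))"
      unfolding R1 by (subst csum_mult) (simp_all add: l x)
  qed
  also have "\<dots> = lsum pscale m (\<lambda>h x. csum pscale h (\<lambda>p q. csum pscale a (\<lambda>a1 a2. csum pscale a1 (\<lambda>b1 b2.
       R (p * b1) (S (q * b2)) x a2))))"
    by (subst csum_swap) simp_all
  also have "\<dots> = lsum pscale m (\<lambda>h x. csum pscale h (\<lambda>p q. csum pscale a (\<lambda>a1 r. csum pscale r (\<lambda>b1 b2.
       R (p * a1) (S (q * b1)) x b2))))"
  proof (intro lsum_cong refl m)
    fix h x assume x: "x \<in> carr M"
    show "csum pscale h (\<lambda>p q. csum pscale a (\<lambda>a1 a2. csum pscale a1 (\<lambda>b1 b2. R (p * b1) (S (q * b2)) x a2))) =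
      csum pscale h (\<lambda>p q. csum pscale a (\<lambda>a1 r. csum pscale r (\<lambda>b1 b2. R (p * a1) (S (q * b1)) x b2)))"
      by (subst csum_coassoc[where f = "\<lambda>b1 b2 a2. R (p * b1) (S (q * b2)) x a2" for p q]) (simp_all add: l x)
  qed
  also have "\<dots> = lsum pscale m (\<lambda>h x. csum pscale h (\<lambda>p q. rsum pscale (a \<rhd> n) (\<lambda>n0 g. csum pscale g (\<lambda>n1 n2.
     hten M [(p \<rhd> n0) \<lhd> S n1, (S q \<rhd> x) \<lhd> n2]))))"
  proof (intro lsum_cong refl m)
    fix h x assume x: "x \<in> carr M"
    have "csum pscale a (\<lambda>a1 r. csum pscale r (\<lambda>b1 b2. R (p * a1) (S (q * b1)) x b2)) =
      rsum pscale (a \<rhd> n) (\<lambda>n0 g. csum pscale g (\<lambda>n1 n2. hten M [(p \<rhd> n0) \<lhd> S n1, (S q \<rhd> x) \<lhd> n2]))" for p q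
    proof -
      have "rsum pscale (a \<rhd> n) (\<lambda>n0 g. csum pscale g (\<lambda>n1 n2. hten M [(p \<rhd> n0) \<lhd> S n1, (S q \<rhd> x) \<lhd> n2])) =
        csum pscale a (\<lambda>a1 r. rsum pscale n (\<lambda>n0 g. csum pscale (r * g) (\<lambda>n1 n2. hten M [(p \<rhd> (a1 \<rhd> n0)) \<lhd> S n1, (S q \<rhd> x) \<lhd> n2])))"
        by (rule rsum_act) (simp_all add: linT n x)
      also have "\<dots> = csum pscale a (\<lambda>a1 r. rsum pscale n (\<lambda>n0 g. csum pscale r (\<lambda>b1 b2. csum pscale g (\<lambda>n1 n2.
          hten M [((p * a1) \<rhd> n0) \<lhd> S n1, (S (q * b1) \<rhd> (x \<lhd> b2)) \<lhd> n2]))))"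
      proof -
        have "csum pscale (r * g) (\<lambda>n1 n2. hten M [(p \<rhd> (a1 \<rhd> n0)) \<lhd> S n1, (S q \<rhd> x) \<lhd> n2]) =
          csum pscale r (\<lambda>b1 b2. csum pscale g (\<lambda>n1 n2.
          hten M [((p * a1) \<rhd> n0) \<lhd> S n1, (S (q * b1) \<rhd> (x \<lhd> b2)) \<lhd> n2]))" if n0: "n0 \<in> carr M" for r g a1 n0
        proof -
          have "csum pscale (r * g) (\<lambda>n1 n2. hten M [(p \<rhd> (a1 \<rhd> n0)) \<lhd> S n1, (S q \<rhd> x) \<lhd> n2]) =
            csum pscale r (\<lambda>b1 b2. csum pscale g (\<lambda>n1 n2. hten M [(p \<rhd> (a1 \<rhd> n0)) \<lhd> S (b1 * n1), (S q \<rhd> x) \<lhd> (b2 * n2)]))"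
            by (rule csum_mult) (simp_all add: linT n0 x)
          moreover have "hten M [(p \<rhd> (a1 \<rhd> n0)) \<lhd> S (b1 * n1), (S q \<rhd> x) \<lhd> (b2 * n2)] =
             hten M [((p * a1) \<rhd> n0) \<lhd> S n1, (S (q * b1) \<rhd> (x \<lhd> b2)) \<lhd> n2]" for b1 n1 b2 n2
            using hten_moves(1)[of "((p * a1) \<rhd> n0) \<lhd> S n1" M "(S q \<rhd> x) \<lhd> (b2 * n2)" "S b1"]
            by (simp add: linM n0 x)
          ultimately show ?thesis by simp
        qed
        then show ?thesis using n by (simp cong: rsum_cong)
      qed
      also have "\<dots> = csum pscale a (\<lambda>a1 r. csum pscale r (\<lambda>b1 b2. R (p * a1) (S (q * b1)) x b2))"
        by (simp add: sum_csum_swap R_def)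
      finally show ?thesis ..
    qed
    then show "csum pscale h (\<lambda>p q. csum pscale a (\<lambda>a1 r. csum pscale r (\<lambda>b1 b2. R (p * a1) (S (q * b1)) x b2))) =
       csum pscale h (\<lambda>p q. rsum pscale (a \<rhd> n) (\<lambda>n0 g. csum pscale g (\<lambda>n1 n2. hten M [(p \<rhd> n0) \<lhd> S n1, (S q \<rhd> x) \<lhd> n2])))"
      by simp
  qed
  also have "\<dots> = braid_word m (a \<rhd> n)"
    by (simp add: braid_word_def)
  finally show ?thesis .
qed

lemma braiding_hten:
  assumes m: "m \<in> carr M" and n: "n \<in> carr M"
  shows "braiding H M (hten M [m, n]) = braid_word m n"
  unfolding braiding_eq
  using lin_ext_hten2[OF vs_pscale, of M "\<lambda>w. braid_word (w ! 0) (w ! 1)" m n] braid_word_linear braid_word_balanced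
  by simp

lemma braiding_linear [simp]: "linear_on (hpow M 2) pscale (braiding H M)"
  using linear_on_lin_ext_arg[OF vs_pscale, of "hpow M 2" "\<lambda>w. braid_word (w ! 0) (w ! 1)"] by (simp add: braiding_eq[abs_def])

lemma braid_word_closed: "m \<in> carr M \<Longrightarrow> n \<in> carr M \<Longrightarrow> braid_word m n \<in> carr (hpow M 2)"
  unfolding braid_word_def by (intro lsum_closed_hpow csum_closed_hpow rsum_closed_hpow) auto

lemma keys_hpow:
  "t \<in> carr (hpow M 2) \<Longrightarrow> w \<in> Poly_Mapping.keys t \<Longrightarrow> \<exists>x\<in>carr M. \<exists>y\<in>carr M. w = [x, y]"
  "t \<in> carr (hpow M 3) \<Longrightarrow> w \<in> Poly_Mapping.keys t \<Longrightarrow> \<exists>x\<in>carr M. \<exists>y\<in>carr M. \<exists>z\<in>carr M. w = [x, y, z]"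
  using subsetD[OF keys_words, of t 2 w] subsetD[OF keys_words, of t 3 w] by (auto simp: words_2 words_3)

lemma lin_ext_words2_closed:
  assumes "is_vs V" "t \<in> carr (hpow M 2)" "\<And>x y. x \<in> carr M \<Longrightarrow> y \<in> carr M \<Longrightarrow> f [x, y] \<in> carr V"
  shows "lin_ext (scl V) t f \<in> carr V"
  using assms(3) by (intro lin_ext_closed[OF assms(1)]) (auto dest!: keys_hpow(1)[OF assms(2)])

lemma lin_ext_words2_cong:
  assumes "t = u" "u \<in> carr (hpow M 2)" "\<And>x y. x \<in> carr M \<Longrightarrow> y \<in> carr M \<Longrightarrow> f [x, y] = g [x, y]"
  shows "lin_ext s t f = lin_ext s u g"
  using assms(1,3) by (intro lin_ext_cong) (auto dest!: keys_hpow(1)[OF assms(2)])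

lemma lin_ext_words3_cong:
  assumes "t = u" "u \<in> carr (hpow M 3)" "\<And>x y z. x \<in> carr M \<Longrightarrow> y \<in> carr M \<Longrightarrow> z \<in> carr M \<Longrightarrow> f [x, y, z] = g [x, y, z]"
  shows "lin_ext s t f = lin_ext s u g"
  using assms(1,3) by (intro lin_ext_cong) (auto dest!: keys_hpow(2)[OF assms(2)])

lemma lin_ext_words3_closed:
  assumes "is_vs V" "t \<in> carr (hpow M 3)" "\<And>x y z. x \<in> carr M \<Longrightarrow> y \<in> carr M \<Longrightarrow> z \<in> carr M \<Longrightarrow> f [x, y, z] \<in> carr V"
  shows "lin_ext (scl V) t f \<in> carr V"
  using assms(3) by (intro lin_ext_closed[OF assms(1)]) (auto dest!: keys_hpow(2)[OF assms(2)])

lemma braiding_closed [simp]: "t \<in> carr (hpow M 2) \<Longrightarrow> braiding H M t \<in> carr (hpow M 2)"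
  unfolding braiding_eq using lin_ext_words2_closed[of "hpow M 2" t "\<lambda>w. braid_word (w ! 0) (w ! 1)"]
  by (simp add: braid_word_closed)

text \<open>Coinvariance of w and e reduces the formula to ek_1S(k_2) \<otimes> wk_3.\<close>

lemma braiding_LR:
  assumes w: "w \<in> coL" and e: "e \<in> coR"
  shows "braiding H M (hten M [w, e \<lhd> k]) = hten M [e, w \<lhd> k]"
proof -
  have "braid_word w (e \<lhd> k) = csum pscale 1 (\<lambda>h2 h1. rsum pscale (e \<lhd> k) (\<lambda>n0 g. csum pscale g (\<lambda>n1 n2.
     hten M [(h2 \<rhd> n0) \<lhd> S n1, (S h1 \<rhd> w) \<lhd> n2])))"
    unfolding braid_word_def using w e by (intro lsum_coL) (simp_all add: linT cong: rsum_cong)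
  also have "\<dots> = rsum pscale (e \<lhd> k) (\<lambda>n0 g. csum pscale g (\<lambda>n1 n2. hten M [n0 \<lhd> S n1, w \<lhd> n2]))"
    using w e by (subst csum_one) (simp_all add: linT cong: rsum_cong)
  also have "\<dots> = rsum pscale e (\<lambda>n0 g. csum pscale k (\<lambda>k1 k2. csum pscale (g * k2) (\<lambda>n1 n2. hten M [(n0 \<lhd> k1) \<lhd> S n1, w \<lhd> n2])))"
    using w e by (intro rsum_act) (simp_all add: linT)
  also have "\<dots> = csum pscale k (\<lambda>k1 k2. csum pscale k2 (\<lambda>n1 n2. hten M [e \<lhd> (k1 * S n1), w \<lhd> n2]))"
    using w e by (subst rsum_coR) (simp_all add: linT)
  also have "\<dots> = hten M [e \<lhd> 1, w \<lhd> k]"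
    using w e by (intro csum_cancel_S_right(1)[where F = "\<lambda>a b. hten M [e \<lhd> a, w \<lhd> b]"]) (simp_all add: linT)
  finally show ?thesis using w e by (simp add: braiding_hten)
qed

text \<open>The inverse braiding on e \<otimes> p for right coinvariant e, namely p_0S^{-1}(p_{-1})
  \<otimes> ep_{-2}. For arbitrary first factors this is in general not balanced over
  \<open>H\<close>, hence the extension by \<open>twist\<close> in \<open>unbraid\<close>.\<close>

definition unbraid_coR :: "'m \<Rightarrow> 'm \<Rightarrow> ('m list \<Rightarrow>\<^sub>0 'k)" where
  "unbraid_coR x p = lsum pscale p (\<lambda>h p0. csum pscale h (\<lambda>h2 h1. hten M [p0 \<lhd> Si h1, x \<lhd> h2]))"

definition unbraid :: "('m list \<Rightarrow>\<^sub>0 'k) \<Rightarrow> ('m list \<Rightarrow>\<^sub>0 'k)" where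
  "unbraid t = plin t (\<lambda>w. twist pscale unbraid_coR (w ! 0) (w ! 1))"

lemma unbraid_coR_linear:
  "y \<in> carr M \<Longrightarrow> linear_on M pscale (\<lambda>x. unbraid_coR x y)"
  "x \<in> carr M \<Longrightarrow> linear_on M pscale (unbraid_coR x)"
  by (simp_all add: unbraid_coR_def linT cong: lsum_cong)

lemma unbraid_linear: "linear_on (hpow M 2) pscale unbraid"
  using linear_on_lin_ext_arg[OF vs_pscale, of "hpow M 2" "\<lambda>w. twist pscale unbraid_coR (w ! 0) (w ! 1)"]
  by (simp add: unbraid_def[abs_def])

lemma unbraid_closed: "t \<in> carr (hpow M 2) \<Longrightarrow> unbraid t \<in> carr (hpow M 2)"
proof -
  have "twist pscale unbraid_coR m n \<in> carr (hpow M 2)" if "m \<in> carr M" "n \<in> carr M" for m n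
    unfolding twist_def unbraid_coR_def using that
    by (intro lsum_closed_hpow csum_closed_hpow rsum_closed_hpow) auto
  then show "t \<in> carr (hpow M 2) \<Longrightarrow> unbraid t \<in> carr (hpow M 2)"
    unfolding unbraid_def using lin_ext_words2_closed[of "hpow M 2" t "\<lambda>w. twist pscale unbraid_coR (w ! 0) (w ! 1)"] by simp
qed

text \<open>The first factor e is right coinvariant, so \<open>twist\<close> has no effect, and the
  formula gives wk_3S^{-1}(k_2) \<otimes> ek_1.\<close>

lemma unbraid_RL:
  assumes w: "w \<in> coL" and e: "e \<in> coR"
  shows "unbraid (hten M [e, w \<lhd> k]) = hten M [w, e \<lhd> k]"
proof -
  have "unbraid (hten M [e, w \<lhd> k]) = twist pscale unbraid_coR e (w \<lhd> k)"
    unfolding unbraid_def using w e by (intro lin_ext_twist unbraid_coR_linear) simp_all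
  also have "\<dots> = unbraid_coR e (w \<lhd> k)"
    using w e by (intro twist_coR unbraid_coR_linear) simp_all
  also have "\<dots> = lsum pscale w (\<lambda>h p0. csum pscale k (\<lambda>k1 k2. csum pscale (h * k1) (\<lambda>h2 h1. hten M [(p0 \<lhd> k2) \<lhd> Si h1, e \<lhd> h2])))"
    unfolding unbraid_coR_def using w e by (intro lsum_act) (simp_all add: linT)
  also have "\<dots> = csum pscale k (\<lambda>k1 k2. csum pscale k1 (\<lambda>h2 h1. hten M [w \<lhd> (k2 * Si h1), e \<lhd> h2]))"
    using w e by (subst lsum_coL) (simp_all add: linT)
  also have "\<dots> = hten M [w \<lhd> 1, e \<lhd> k]"
    using w e by (intro csum_cancel_Si_right(2)[where F = "\<lambda>a b. hten M [w \<lhd> b, e \<lhd> a]"]) (simp_all add: linT)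
  finally show ?thesis using w by simp
qed

lemma linear_on_comp:
  assumes "linear_on V pscale f" "\<And>x. x \<in> carr V \<Longrightarrow> f x \<in> carr (hpow M n)" "linear_on (hpow M n) s g"
  shows "linear_on V s (\<lambda>x. g (f x))"
  using assms by (simp add: linear_on_def)

lemma linear_on_ident: "linear_on (hpow M n) pscale (\<lambda>x. x)"
  by (simp add: linear_on_def)

lemma unbraid_braiding: "t \<in> carr (hpow M 2) \<Longrightarrow> unbraid (braiding H M t) = t"
  by (rule hpow2_eqI_LR[OF linear_on_comp[where n = 2, OF braiding_linear _ unbraid_linear] linear_on_ident])
    (simp_all add: braiding_LR unbraid_RL)

lemma braiding_unbraid: "t \<in> carr (hpow M 2) \<Longrightarrow> braiding H M (unbraid t) = t"
  by (rule hpow2_eqI_RL[OF linear_on_comp[where n = 2, OF unbraid_linear _ braiding_linear] linear_on_ident])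
    (simp_all add: braiding_LR unbraid_RL unbraid_closed)

lemma braiding_inv_eq: "t \<in> carr (hpow M 2) \<Longrightarrow> braiding_inv H M t = unbraid t"
  unfolding braiding_inv_def
  by (rule inv_into_f_eq[OF inj_on_inverseI[of _ unbraid]]) (simp_all add: unbraid_braiding braiding_unbraid unbraid_closed)

lemma braiding_inv_closed [simp]: "t \<in> carr (hpow M 2) \<Longrightarrow> braiding_inv H M t \<in> carr (hpow M 2)"
  by (simp add: braiding_inv_eq unbraid_closed)

lemma braiding_inv_linear [simp]: "linear_on (hpow M 2) pscale (braiding_inv H M)"
proof -
  have "t \<in> carr (hpow M 2) \<Longrightarrow> pscale c t \<in> carr (hpow M 2)" for c t
    using is_vsD(4)[OF hpow_is_vs, of t M 2 c] by simp
  then show ?thesis using unbraid_linear by (simp add: linear_on_def braiding_inv_eq is_vsD(3))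
qed

lemma braiding_braiding_inv: "t \<in> carr (hpow M 2) \<Longrightarrow> braiding H M (braiding_inv H M t) = t"
  by (simp add: braiding_inv_eq braiding_unbraid)

section \<open>Right multiplication on tensor powers\<close>

lemma hpow_ract_hten:
  "x \<in> carr M \<Longrightarrow> y \<in> carr M \<Longrightarrow> hpow_ract M (hten M [x, y]) a = hten M [x, y \<lhd> a]"
  "x \<in> carr M \<Longrightarrow> y \<in> carr M \<Longrightarrow> z \<in> carr M \<Longrightarrow> hpow_ract M (hten M [x, y, z]) a = hten M [x, y, z \<lhd> a]"
  unfolding hpow_ract_def
  by (subst lin_ext_hten2 lin_ext_hten3; simp add: linT hten_moves)+

lemma hpow_ract_linear [simp]: "linear_on (hpow M n) pscale (\<lambda>t. hpow_ract M t a)"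
  unfolding hpow_ract_def by (rule linear_on_lin_ext_arg) simp_all

lemma hpow_ract_closed [simp]:
  "t \<in> carr (hpow M 2) \<Longrightarrow> hpow_ract M t a \<in> carr (hpow M 2)"
  "t \<in> carr (hpow M 3) \<Longrightarrow> hpow_ract M t a \<in> carr (hpow M 3)"
  unfolding hpow_ract_def
  using lin_ext_words2_closed[of "hpow M 2" t "\<lambda>w. hten M (butlast w @ [last w \<lhd> a])"]
    lin_ext_words3_closed[of "hpow M 3" t "\<lambda>w. hten M (butlast w @ [last w \<lhd> a])"]
  by simp_all

lemma braiding_ract:
  assumes "t \<in> carr (hpow M 2)"
  shows "braiding H M (hpow_ract M t a) = hpow_ract M (braiding H M t) a"
  by (rule hpow2_eqI_LR[OF linear_on_comp[where n = 2, OF hpow_ract_linear _ braiding_linear]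
        linear_on_comp[where n = 2, OF braiding_linear _ hpow_ract_linear] assms])
    (simp_all add: hpow_ract_hten braiding_LR ract_ract)

lemma hpow_ract_simps:
  assumes "t \<in> carr (hpow M 2)"
  shows "hpow_ract M t (a + b) = hpow_ract M t a + hpow_ract M t b"
    "hpow_ract M t (scl H c a) = pscale c (hpow_ract M t a)"
    "hpow_ract M (hpow_ract M t a) b = hpow_ract M t (a * b)"
    "hpow_ract M t 1 = t" "hpow_ract M t 0 = 0"
proof -
  show add: "hpow_ract M t (a + b) = hpow_ract M t a + hpow_ract M t b" for a b
    unfolding hpow_ract_def lin_ext_fun_add[OF vs_pscale, symmetric]
    by (rule lin_ext_words2_cong[OF refl assms]) (simp add: linT)
  show "hpow_ract M t (scl H c a) = pscale c (hpow_ract M t a)"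
    unfolding hpow_ract_def lin_ext_fun_scale[OF vs_pscale, symmetric]
    by (rule lin_ext_words2_cong[OF refl assms]) (simp add: linT)
  show "hpow_ract M (hpow_ract M t a) b = hpow_ract M t (a * b)"
    by (rule hpow_eqI[OF linear_on_comp[where n = 2, OF hpow_ract_linear _ hpow_ract_linear] hpow_ract_linear assms])
      (auto simp: words_2 hpow_ract_hten ract_ract)
  show "hpow_ract M t 1 = t"
    by (rule hpow_eqI[OF hpow_ract_linear linear_on_ident assms]) (auto simp: words_2 hpow_ract_hten)
  show "hpow_ract M t 0 = 0" using add[of 0 0] by simp
qed

section \<open>Adjoining a third tensor factor\<close>

definition hcons :: "'m \<Rightarrow> ('m list \<Rightarrow>\<^sub>0 'k) \<Rightarrow> ('m list \<Rightarrow>\<^sub>0 'k)" where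
  "hcons x t = plin t (\<lambda>v. hten M (x # v))"

definition hsnoc :: "('m list \<Rightarrow>\<^sub>0 'k) \<Rightarrow> 'm \<Rightarrow> ('m list \<Rightarrow>\<^sub>0 'k)" where
  "hsnoc t y = plin t (\<lambda>u. hten M (u @ [y]))"

lemma hcons_linear [simp]: "linear_on (hpow M 2) pscale (hcons x)"
  and hsnoc_linear [simp]: "linear_on (hpow M 2) pscale (\<lambda>t. hsnoc t x)"
  unfolding hcons_def hsnoc_def by (rule linear_on_lin_ext_arg; simp)+

lemma hcons_linear_left: "t \<in> carr (hpow M 2) \<Longrightarrow> linear_on M pscale (\<lambda>x. hcons x t)"
  and hsnoc_linear_right: "t \<in> carr (hpow M 2) \<Longrightarrow> linear_on M pscale (hsnoc t)"
  unfolding linear_on_def hcons_def hsnoc_def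
    lin_ext_fun_add[OF vs_pscale, symmetric] lin_ext_fun_scale[OF vs_pscale, symmetric]
  by (auto intro!: lin_ext_words2_cong simp: hten_simps)

lemma hcons_closed [simp]: "x \<in> carr M \<Longrightarrow> t \<in> carr (hpow M 2) \<Longrightarrow> hcons x t \<in> carr (hpow M 3)"
  and hsnoc_closed [simp]: "x \<in> carr M \<Longrightarrow> t \<in> carr (hpow M 2) \<Longrightarrow> hsnoc t x \<in> carr (hpow M 3)"
  unfolding hcons_def hsnoc_def
  using lin_ext_words2_closed[of "hpow M 3" t "\<lambda>v. hten M (x # v)"]
    lin_ext_words2_closed[of "hpow M 3" t "\<lambda>v. hten M (v @ [x])"] by simp_all

lemma hcons_hten: "x \<in> carr M \<Longrightarrow> y \<in> carr M \<Longrightarrow> z \<in> carr M \<Longrightarrow> hcons x (hten M [y, z]) = hten M [x, y, z]"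
  and hsnoc_hten: "x \<in> carr M \<Longrightarrow> y \<in> carr M \<Longrightarrow> z \<in> carr M \<Longrightarrow> hsnoc (hten M [x, y]) z = hten M [x, y, z]"
  unfolding hcons_def hsnoc_def by (subst lin_ext_hten2; simp add: linT hten_moves)+

lemma hcat_right:
  assumes "t \<in> carr (hpow M 2)" "y \<in> carr M"
  shows "hcat M t (hten M [y]) = hsnoc t y"
  unfolding hcat_def hsnoc_def using assms
  by (intro lin_ext_words2_cong refl) (simp_all add: lin_ext_hten1 linT)

lemma hcat_left:
  assumes t: "t \<in> carr (hpow M 2)" and x: "x \<in> carr M"
  shows "hcat M (hten M [x]) t = hcons x t"
  using lin_ext_hten1[OF vs_pscale, of M "\<lambda>u. plin t (\<lambda>v. hten M (u @ v))" x] hcons_linear_left[OF t]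
  by (simp add: hcat_def hcons_def)

lemma hcons_ract:
  assumes "t \<in> carr (hpow M 2)" "x \<in> carr M"
  shows "hcons x (hpow_ract M t a) = hpow_ract M (hcons x t) a"
  by (rule hpow_eqI[OF linear_on_comp[where n = 2, OF hpow_ract_linear _ hcons_linear]
        linear_on_comp[where n = 3, OF hcons_linear _ hpow_ract_linear] assms(1)])
    (use assms in \<open>auto simp: words_2 hpow_ract_hten hcons_hten\<close>)

lemma hsnoc_ract:
  assumes "t \<in> carr (hpow M 2)" "x \<in> carr M"
  shows "hsnoc t (x \<lhd> a) = hpow_ract M (hsnoc t x) a"
  by (rule hpow_eqI[OF hsnoc_linear
        linear_on_comp[where n = 3, OF hsnoc_linear _ hpow_ract_linear] assms(1)])
    (use assms in \<open>auto simp: words_2 hpow_ract_hten hsnoc_hten\<close>)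

lemma hcons_braid_word:
  assumes "x \<in> carr M" and m: "m \<in> carr M" and n: "n \<in> carr M"
  shows "hcons x (braid_word m n) = lsum pscale m (\<lambda>h m0. csum pscale h (\<lambda>h2 h1. rsum pscale n (\<lambda>n0 g. csum pscale g (\<lambda>n1 n2.
     hten M [x, (h2 \<rhd> n0) \<lhd> S n1, (S h1 \<rhd> m0) \<lhd> n2]))))"
  unfolding braid_word_def using assms
  by (simp add: linear_on_lsum_hpow[OF hcons_linear] linear_on_rsum_hpow[OF hcons_linear]
      linear_on_csum_hpow[OF hcons_linear] rsum_closed_hpow csum_closed_hpow hcons_hten cong: lsum_cong rsum_cong)

text \<open>In substance this is left linearity of the braiding, the relation that lets it act on
  the last two of three factors. In the coaction of am the factors S(a_2) and a_3 meet and
  cancel.\<close>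

lemma hcons_braiding_balanced:
  assumes x: "x \<in> carr M" and m: "m \<in> carr M" and n: "n \<in> carr M"
  shows "hcons (x \<lhd> a) (braid_word m n) = hcons x (braid_word (a \<rhd> m) n)"
proof -
  define R where "R p q y = rsum pscale n (\<lambda>n0 g. csum pscale g (\<lambda>n1 n2.
     hten M [x, (p \<rhd> n0) \<lhd> S n1, (q \<rhd> y) \<lhd> n2]))" for p q y
  have Rl: "linear_on M pscale (\<lambda>y. R p q y)"
      "y \<in> carr M \<Longrightarrow> linear_on H pscale (\<lambda>p. R p q y)"
      "y \<in> carr M \<Longrightarrow> linear_on H pscale (\<lambda>q. R p q y)" for p q y
    using n x by (simp_all add: R_def linT cong: rsum_cong)
  note l = linT Rl[unfolded linear_on_H] Rl[unfolded linear_on_def[of M]]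
  have "hcons x (braid_word (a \<rhd> m) n) = lsum pscale (a \<rhd> m) (\<lambda>h m0. csum pscale h (\<lambda>p q. R p (S q) m0))"
    using x m n by (simp add: hcons_braid_word R_def)
  also have "\<dots> = csum pscale a (\<lambda>a1 a2. lsum pscale m (\<lambda>h m0. csum pscale (a1 * h) (\<lambda>p q. R p (S q) (a2 \<rhd> m0))))"
    by (rule lsum_act) (simp_all add: l m)
  also have "\<dots> = csum pscale a (\<lambda>a1 a2. lsum pscale m (\<lambda>h m0. csum pscale a1 (\<lambda>u v. csum pscale h (\<lambda>p q.
      R (u * p) (S q * (S v * a2)) m0))))"
  proof -
    have R1: "R p q (a2 \<rhd> y) = R p (q * a2) y" if "y \<in> carr M" for p q a2 y
      using that by (simp add: R_def linM n cong: rsum_cong)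
    have "csum pscale (a1 * h) (\<lambda>p q. R p (S q) (a2 \<rhd> y)) =
      csum pscale a1 (\<lambda>u v. csum pscale h (\<lambda>p q. R (u * p) (S q * (S v * a2)) y))" if "y \<in> carr M" for a1 h a2 y
      using that by (simp add: R1) (subst csum_mult; simp add: l)
    then show ?thesis using m by (simp cong: lsum_cong)
  qed
  also have "\<dots> = lsum pscale m (\<lambda>h m0. csum pscale h (\<lambda>p q. csum pscale a (\<lambda>a1 a2. csum pscale a1 (\<lambda>u v.
      R (u * p) (S q * (S v * a2)) m0))))"
  proof -
    have "csum pscale a (\<lambda>a1 a2. csum pscale a1 (\<lambda>u v. csum pscale h (\<lambda>p q. R (u * p) (S q * (S v * a2)) y))) =
      csum pscale h (\<lambda>p q. csum pscale a (\<lambda>a1 a2. csum pscale a1 (\<lambda>u v. R (u * p) (S q * (S v * a2)) y)))" for h y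
      by (simp only: csum_swap[OF vs_pscale, of _ h])
    then show ?thesis by (simp only: sum_csum_swap(1)[OF vs_pscale, symmetric, where m = m])
  qed
  also have "\<dots> = lsum pscale m (\<lambda>h m0. csum pscale h (\<lambda>p q. R (a * p) (S q * 1) m0))"
    by (intro lsum_cong refl m, subst csum_cancel_S_left(2)[of pscale "\<lambda>u z. R (u * p) (S q * z) y" for p q y])
      (simp_all add: l)
  also have "\<dots> = hcons (x \<lhd> a) (braid_word m n)"
  proof -
    have "R (a * p) (S q * 1) y = rsum pscale n (\<lambda>n0 g. csum pscale g (\<lambda>n1 n2.
     hten M [x \<lhd> a, (p \<rhd> n0) \<lhd> S n1, (S q \<rhd> y) \<lhd> n2]))" if "y \<in> carr M" for p q y
      using that x n by (simp add: R_def hten_moves linM cong: rsum_cong)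
    then show ?thesis using x m n by (simp add: hcons_braid_word cong: lsum_cong)
  qed
  finally show ?thesis ..
qed

text \<open>Descent to three factors rests on two facts: balancing between the first two factors is
  left linearity of the braiding, between the last two it is the balancing of the braiding
  itself.\<close>

lemma at_factors_1_hten:
  assumes "x \<in> carr M" "y \<in> carr M" "z \<in> carr M"
  shows "at_factors M (Suc 0) (braiding H M) (hten M [x, y, z]) = hcons x (braid_word y z)"
proof -
  define F where "F w = plin (braiding H M (hten M [w ! Suc 0, w ! Suc (Suc 0)])) (\<lambda>v. hten M (take (Suc 0) w @ v @ drop (Suc 0 + 2) w))" for w
  have f: "F [a, b, c] = hcons a (braid_word b c)" if "b \<in> carr M" "c \<in> carr M" for a b c
    using that by (simp add: F_def hcons_def braiding_hten)
  note l = braid_word_linear[unfolded linear_on_def] hcons_linear_left[OF braid_word_closed, unfolded linear_on_def]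
     hcons_linear[unfolded linear_on_def scl_hpow]
  have "plin (hten M [x, y, z]) F = F [x, y, z]"
    by (rule lin_ext_hten3[OF vs_pscale])
      (use assms in \<open>auto simp: f linear_on_def l braid_word_closed braid_word_balanced hcons_braiding_balanced\<close>)
  then show ?thesis unfolding at_factors_def F_def[symmetric] f[OF assms(2,3)] .
qed

lemma at_linear: "linear_on (hpow M n) pscale (at_factors M i f)"
  unfolding at_factors_def[abs_def] by (rule linear_on_lin_ext_arg) simp_all

lemma at_factors_1_closed:
  assumes "t \<in> carr (hpow M 3)"
  shows "at_factors M (Suc 0) (braiding H M) t \<in> carr (hpow M 3)"
proof -
  have "plin t (\<lambda>w. plin (braiding H M (hten M [w ! Suc 0, w ! Suc (Suc 0)])) (\<lambda>v. hten M (take (Suc 0) w @ v @ drop (Suc 0 + 2) w))) \<in> carr (hpow M 3)"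
    using lin_ext_words3_closed[of "hpow M 3" t "\<lambda>w. plin (braiding H M (hten M [w ! Suc 0, w ! Suc (Suc 0)])) (\<lambda>v. hten M (take (Suc 0) w @ v @ drop (Suc 0 + 2) w))"]
      assms by (simp add: hcons_def[symmetric])
  then show ?thesis by (simp add: at_factors_def)
qed

lemma at_factors_1_ract:
  assumes "t \<in> carr (hpow M 3)"
  shows "at_factors M (Suc 0) (braiding H M) (hpow_ract M t a) = hpow_ract M (at_factors M (Suc 0) (braiding H M) t) a"
proof (rule hpow_eqI[OF linear_on_comp[where n = 3, OF hpow_ract_linear _ at_linear]
        linear_on_comp[where n = 3, OF at_linear _ hpow_ract_linear] assms(1)])
  fix w assume "w \<in> words M 3"
  then obtain x y z where w: "w = [x, y, z]" and c: "x \<in> carr M" "y \<in> carr M" "z \<in> carr M"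
    by (auto simp: words_3)
  have "braid_word y (z \<lhd> a) = hpow_ract M (braid_word y z) a"
    using braiding_ract[of "hten M [y, z]" a] c by (simp add: hpow_ract_hten braiding_hten)
  then show "at_factors M (Suc 0) (braiding H M) (hpow_ract M (hten M w) a) = hpow_ract M (at_factors M (Suc 0) (braiding H M) (hten M w)) a"
    using c by (simp add: w hpow_ract_hten at_factors_1_hten hcons_ract braid_word_closed)
qed (simp_all add: at_factors_1_closed)

section \<open>The diagonal left coaction on the tensor square\<close>

lemma lcoact2_linear: "linear_on (hpow M 2) pscale (lcoact2 H M)"
  unfolding lcoact2_def[abs_def] by (rule linear_on_lin_ext_arg) simp_all

lemma lcoact2_hten:
  assumes m: "m \<in> carr M" and n: "n \<in> carr M"
  shows "lcoact2 H M (hten M [m, n]) =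
    lsum pscale m (\<lambda>h m0. lsum pscale n (\<lambda>k n0. ten H (hpow M 2) (h * k) (hten M [m0, n0])))"
proof -
  let ?B = "\<lambda>m n. lsum pscale m (\<lambda>h m0. lsum pscale n (\<lambda>k n0. ten H (hpow M 2) (h * k) (hten M [m0, n0])))"
  have L: "lcoact2 H M t = plin t (\<lambda>w. ?B (w ! 0) (w ! 1))" for t
    by (simp add: lcoact2_def lsum_def)
  have tl: "ten H (hpow M 2) (a + b) u = ten H (hpow M 2) a u + ten H (hpow M 2) b u"
    "ten H (hpow M 2) (scl H c a) u = pscale c (ten H (hpow M 2) a u)"
    "ten H (hpow M 2) a (pscale c u) = pscale c (ten H (hpow M 2) a u)"
    if "u \<in> carr (hpow M 2)" for a b c u
    using that ten_scale_right[of a H u "hpow M 2" c]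
    by (simp_all add: ten_add_left ten_scale_left)
  have ta: "ten H (hpow M 2) a (u + v) = ten H (hpow M 2) a u + ten H (hpow M 2) a v"
    if "u \<in> carr (hpow M 2)" "v \<in> carr (hpow M 2)" for a u v
    using that by (simp add: ten_add_right)
  have bal: "?B (x \<lhd> a) y = ?B x (a \<rhd> y)" if x: "x \<in> carr M" and y: "y \<in> carr M" for x y a
  proof -
    have "?B (x \<lhd> a) y = lsum pscale x (\<lambda>h m0. csum pscale a (\<lambda>a1 a2. lsum pscale y (\<lambda>k n0. ten H (hpow M 2) (h * a1 * k) (hten M [m0 \<lhd> a2, n0]))))"
      by (rule lsum_act) (simp_all add: x y linT tl ta cong: lsum_cong)
    moreover have "?B x (a \<rhd> y) = lsum pscale x (\<lambda>h m0. csum pscale a (\<lambda>a1 a2. lsum pscale y (\<lambda>k n0. ten H (hpow M 2) (h * (a1 * k)) (hten M [m0, a2 \<rhd> n0]))))"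
      by (intro lsum_cong refl x, rule lsum_act) (simp_all add: x y linT tl ta)
    ultimately show ?thesis using x y by (simp add: hten_moves mult.assoc cong: lsum_cong)
  qed
  have lin: "linear_on M pscale (\<lambda>x. ?B x y)" "linear_on M pscale (\<lambda>x. ?B y x)" if "y \<in> carr M" for y
    using that by (simp_all add: linT tl ta cong: lsum_cong)
  show ?thesis unfolding L
    using lin_ext_hten2[OF vs_pscale, of M "\<lambda>w. ?B (w ! 0) (w ! 1)" m n] lin bal by simp
qed

lemma lcoact2_closed:
  assumes "t \<in> carr (hpow M 2)"
  shows "lcoact2 H M t \<in> carr (tsp H (hpow M 2))"
proof -
  have "lcoact2 H M t = plin t (\<lambda>w. lcoact2 H M (hten M w))"
    by (rule linear_on_hpow[OF lcoact2_linear assms])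
  also have "\<dots> \<in> carr (tsp H (hpow M 2))"
    using lin_ext_words2_closed[of "tsp H (hpow M 2)" t "\<lambda>w. lcoact2 H M (hten M w)"] assms
     lsum_closed[where V = "tsp H (hpow M 2)", simplified]
    by (simp add: lcoact2_hten)
  finally show ?thesis .
qed

context
  fixes s :: "'k \<Rightarrow> 'v::ab_group_add \<Rightarrow> 'v" and L
  assumes s: "vector_space s" and L: "\<And>u. u \<in> carr (hpow M 2) \<Longrightarrow> linear_on H s (\<lambda>k. L k u)"
    "\<And>k. linear_on (hpow M 2) s (L k)"
begin

lemmas linL = linT sum_lin[OF s] L(1)[unfolded linear_on_H] L(2)[unfolded linear_on_def scl_hpow]

lemma lcoact2_eval:
  assumes m: "m \<in> carr M" and n: "n \<in> carr M"
  shows "lin_ext s (lcoact2 H M (hten M [m, n])) (\<lambda>(k, u). L k u) =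
    lsum s m (\<lambda>h m0. lsum s n (\<lambda>k n0. L (h * k) (hten M [m0, n0])))"
  using m n lin_ext_ten[OF s L in_carr_H]
  by (simp add: lcoact2_hten lin_ext_lsum[OF s] cong: lsum_cong)

text \<open>Checked on words, where only the last factor is multiplied by \<open>a\<close>. The
  equation is stated under a bilinear \<open>L\<close> because it is applied with
  \<open>ad_tensor\<close> in that place.\<close>

lemma lcoact2_ract:
  assumes t: "t \<in> carr (hpow M 2)"
  shows "lin_ext s (lcoact2 H M (hpow_ract M t a)) (\<lambda>(k, u). L k u) =
    lin_ext s (lcoact2 H M t) (\<lambda>(k, u). csum s a (\<lambda>a1 a2. L (k * a1) (hpow_ract M u a2)))"
proof -
  have e: "linear_on (hpow M 2) s (\<lambda>t. lin_ext s (lcoact2 H M t) f)" for f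
    using lcoact2_linear by (simp add: linear_on_def lin_ext_add[OF s] lin_ext_pscale[OF s])
  note hr = hpow_ract_linear[where n = 2, unfolded linear_on_def scl_hpow]
  let ?L = "\<lambda>k u. csum s a (\<lambda>a1 a2. L (k * a1) (hpow_ract M u a2))"
  have L': "\<And>u. u \<in> carr (hpow M 2) \<Longrightarrow> linear_on H s (\<lambda>k. ?L k u)" "\<And>k. linear_on (hpow M 2) s (?L k)"
    by (simp_all add: linL linear_on_def[of "hpow M 2"] hr)
  show ?thesis
  proof (rule hpow_eqI[OF linear_on_comp[where n = 2, OF hpow_ract_linear _ e] e t])
    fix w assume "w \<in> words M 2"
    then obtain m n where w: "w = [m, n]" and c: "m \<in> carr M" "n \<in> carr M"
      by (auto simp: words_2)
    have "lin_ext s (lcoact2 H M (hten M [m, n \<lhd> a])) (\<lambda>(k, u). L k u) =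
      lsum s m (\<lambda>h m0. lsum s (n \<lhd> a) (\<lambda>k n0. L (h * k) (hten M [m0, n0])))"
      by (rule lcoact2_eval) (simp_all add: c)
    also have "\<dots> = lsum s m (\<lambda>h m0. lsum s n (\<lambda>k n0. csum s a (\<lambda>a1 a2. L (h * (k * a1)) (hten M [m0, n0 \<lhd> a2]))))"
      by (rule lsum_cong[OF refl c(1)], rule lsum_act) (simp_all add: linL c s)
    also have "\<dots> = lin_ext s (lcoact2 H M (hten M [m, n])) (\<lambda>(k, u). ?L k u)"
      using lin_ext_ten[OF s L' in_carr_H] c
      by (simp add: lcoact2_hten lin_ext_lsum[OF s] hpow_ract_hten mult.assoc cong: lsum_cong)
    finally show "lin_ext s (lcoact2 H M (hpow_ract M (hten M w) a)) (\<lambda>(k, u). L k u) =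
         lin_ext s (lcoact2 H M (hten M w)) (\<lambda>(k, u). ?L k u)"
      using c by (simp add: w hpow_ract_hten)
  qed simp
qed

end

section \<open>The antisymmetriser in degree two\<close>

lemma at0_linear:
  assumes l: "linear_on (hpow M 2) pscale F" and c: "\<And>t. t \<in> carr (hpow M 2) \<Longrightarrow> F t \<in> carr (hpow M 2)"
    and t: "t \<in> carr (hpow M 2)"
  shows "at_factors M 0 F t = F t"
proof -
  have "at_factors M 0 F t = plin t (\<lambda>w. F (hten M w))"
    unfolding at_factors_def
  proof (rule lin_ext_words2_cong[OF refl t])
    fix x y assume x: "x \<in> carr M" "y \<in> carr M"
    then show "plin (F (hten M [[x, y] ! 0, [x, y] ! Suc 0])) (\<lambda>v. hten M (take 0 [x, y] @ v @ drop (0 + 2) [x, y])) = F (hten M [x, y])"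
      using hpow_expand'[OF c[of "hten M [x, y]"]] by simp
  qed
  then show ?thesis using linear_on_hpow[OF l t] by simp
qed

text \<open>Of the two permutations, the identity has the empty reduced word, and the transposition
  contributes the inverse braiding with sign -1.\<close>

lemma antisymmetriser_2:
  assumes t: "t \<in> carr (hpow M 2)"
  shows "antisymmetriser H M 2 t = t - braiding_inv H M t"
proof -
  have ne: "id \<noteq> transpose 0 (1::nat)" by (metis id_apply transpose_apply_first zero_neq_one)
  have m: "pscale (- 1) u = - u" for u :: "'m list \<Rightarrow>\<^sub>0 'k"
    by (rule poly_mapping_eqI) (simp add: lookup_pscale)
  have "antisymmetriser H M 2 t = pscale 1 t + pscale (- 1) (at_factors M 0 (braiding_inv H M) t)"
    unfolding antisymmetriser_def permutes_lessThan_2 using ne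
    by (simp add: Eps_reduced_word sign_swap_id)
  then show ?thesis
    by (simp add: at0_linear t vs_scale_simps m)
qed

end

section \<open>The bimodule of one-forms\<close>

locale woronowicz_calculus_bij = woronowicz_calculus H C + hopf_algebra_bij H
  for H :: "('k::field, 'h::ring_1) hopf" and C :: "('k, 'h, 'w::ring_1) calculus"
begin

abbreviation M :: "('k, 'h, 'w) bibimodule" where "M \<equiv> Omega1 C"

lemma vs_C [simp]: "vector_space (wscl C)" by (rule vector_space_C)

lemma Omega1_simps:
  "carr M = grade C 1" "scl M = wscl C" "lact M a x = emb C a * x" "ract M x a = x * emb C a"
  "lcoact M = wlcoact C 1" "rcoact M = wrcoact C 1"
  by (simp_all add: Omega1_def)

lemma emb_add: "emb C (a + b) = emb C a + emb C b" and emb_scale: "emb C (scl H c a) = wscl C c (emb C a)"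
proof -
  interpret Vector_Spaces.linear "scl H" "wscl C" "emb C" by (rule emb_linear)
  show "emb C (a + b) = emb C a + emb C b" "emb C (scl H c a) = wscl C c (emb C a)" by (simp_all add: add scale)
qed

lemma dd_add: "dd C (x + y) = dd C x + dd C y" and dd_scale: "dd C (wscl C c x) = wscl C c (dd C x)"
proof -
  interpret Vector_Spaces.linear "wscl C" "wscl C" "dd C" by (rule dd_linear)
  show "dd C (x + y) = dd C x + dd C y" "dd C (wscl C c x) = wscl C c (dd C x)" by (simp_all add: add scale)
qed

lemma emb_grade [simp]: "emb C a \<in> grade C 0"
  using emb_bij by (auto simp: bij_betw_def)

text \<open>\<open>forms C 1\<close> and \<open>Omega1 C\<close> are records of different types with
  the same carrier and scaling, and tensor products depend on nothing else.\<close>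

lemma ten_Omega1:
  "ten H (forms C (Suc 0)) = ten H M" "ten (forms C (Suc 0)) H = ten M H"
  "tsp H (forms C (Suc 0)) = tsp H M" "tsp (forms C (Suc 0)) H = tsp M H"
  "ten H (tsp H (forms C (Suc 0))) = ten H (tsp H M)" "ten (forms C (Suc 0)) (tsp H H) = ten M (tsp H H)"
  by (simp_all add: fun_eq_iff ten_def tsp_def trel_def forms_def Omega1_def)

lemma forms_simps: "carr (forms C n) = grade C n" "scl (forms C n) = wscl C"
  by (simp_all add: forms_def)

lemma lin_map_Omega1:
  "lin_map (forms C (Suc 0)) V f \<longleftrightarrow> lin_map M V f"
  by (simp add: lin_map_def forms_def Omega1_def)

lemma comodule_Omega1: "left_comodule H M (lcoact M)" "right_comodule H M (rcoact M)"
  using wlcoact_comodule[of 1] wrcoact_comodule[of 1]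
  by (simp_all add: left_comodule_def right_comodule_def Omega1_simps ten_Omega1 lin_map_Omega1 forms_simps)

lemma is_vs_forms: "is_vs (forms C n)"
  by (simp add: is_vs_def forms_def grade_subspace)

lemma forms_keys:
  assumes "x \<in> grade C n"
  shows "(h, y) \<in> Poly_Mapping.keys (wlcoact C n x) \<Longrightarrow> y \<in> grade C n"
    "(y, h) \<in> Poly_Mapping.keys (wrcoact C n x) \<Longrightarrow> y \<in> grade C n"
  using tsp_keys[OF is_vs_H is_vs_forms, of "wlcoact C n x" n] tsp_keys[OF is_vs_forms is_vs_H, of "wrcoact C n x" n]
    wlcoact_comodule[of n] wrcoact_comodule[of n] assms
  by (auto simp: left_comodule_def right_comodule_def lin_map_def forms_simps)

lemma is_vs_Omega1: "is_vs M"
  using is_vs_forms[of 1] by (simp add: is_vs_def forms_def Omega1_def)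

text \<open>The bicomodule algebra law in degrees 0 and 1. The coaction of \<open>emb C a\<close> is
  a sum of representatives of simple tensors, so the multiplication has to be evaluated on these as
  a bilinear map; the four numbered facts do this.\<close>

lemma coact_products:
  assumes m: "m \<in> grade C (Suc 0)"
  shows "wlcoact C (Suc 0) (emb C a * m) =
      plin (comult H a) (\<lambda>(a1, a2). plin (wlcoact C (Suc 0) m) (\<lambda>(h, x). ten H M (a1 * h) (emb C a2 * x)))"
    "wlcoact C (Suc 0) (m * emb C a) =
      plin (wlcoact C (Suc 0) m) (\<lambda>(h, x). plin (comult H a) (\<lambda>(a1, a2). ten H M (h * a1) (x * emb C a2)))"
    "wrcoact C (Suc 0) (emb C a * m) =
      plin (comult H a) (\<lambda>(a1, a2). plin (wrcoact C (Suc 0) m) (\<lambda>(x, h). ten M H (emb C a1 * x) (a2 * h)))"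
    "wrcoact C (Suc 0) (m * emb C a) =
      plin (wrcoact C (Suc 0) m) (\<lambda>(x, h). plin (comult H a) (\<lambda>(a1, a2). ten M H (x * emb C a1) (h * a2)))"
proof -
  have tl: "ten H M (h + h') x = ten H M h x + ten H M h' x" "ten H M (scl H c h) x = pscale c (ten H M h x)"
      "ten H M h (wscl C c x) = pscale c (ten H M h x)"
      "ten M H x (h + h') = ten M H x h + ten M H x h'" "ten M H x (scl H c h) = pscale c (ten M H x h)"
      "ten M H (wscl C c x) h = pscale c (ten M H x h)"
    if "x \<in> grade C (Suc 0)" for h h' x c
    using that ten_scale_left[of x M h H c] ten_scale_right[of h H x M c]
      ten_scale_left[of h H x M c] ten_scale_right[of x M h H c]
    by (simp_all add: ten_add_left ten_add_right Omega1_simps)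
  have ta: "ten H M h (x + y) = ten H M h x + ten H M h y" "ten M H (x + y) h = ten M H x h + ten M H y h"
    if "x \<in> grade C (Suc 0)" "y \<in> grade C (Suc 0)" for h x y
    using that by (simp_all add: ten_add_left ten_add_right Omega1_simps)
  have gm: "z * x \<in> grade C (Suc 0)" "x * z \<in> grade C (Suc 0)" if "x \<in> grade C (Suc 0)" "z \<in> grade C 0" for x z
    using grade_mult[of z 0 x "Suc 0"] grade_mult[of x "Suc 0" z 0] that by simp_all
  note k = forms_keys[OF m[folded One_nat_def], simplified]
  note lin = linear_on_H linear_on_def forms_simps distrib_left distrib_right scl_mult_left scl_mult_right
    wscl_mult_left wscl_mult_right
  have 1: "plin (ten H (forms C 0) a1 (emb C a2)) (\<lambda>(x1, x0). plin (wlcoact C (Suc 0) m) (\<lambda>(h, x). ten H M (x1 * h) (x0 * x))) =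
     plin (wlcoact C (Suc 0) m) (\<lambda>(h, x). ten H M (a1 * h) (emb C a2 * x))" for a1 a2
    by (rule lin_ext_ten[of pscale "forms C 0" H "\<lambda>x1 x0. plin (wlcoact C (Suc 0) m) (\<lambda>(h, x). ten H M (x1 * h) (x0 * x))"])
      (auto simp: lin lin_ext_fun_add[OF vs_pscale, symmetric] lin_ext_fun_scale[OF vs_pscale, symmetric]
        intro!: lin_ext_cong dest!: k, auto simp: tl ta gm)
  have 2: "plin (ten (forms C 0) H (emb C a1) a2) (\<lambda>(x0, x1). plin (wrcoact C (Suc 0) m) (\<lambda>(x, h). ten M H (x0 * x) (x1 * h))) =
     plin (wrcoact C (Suc 0) m) (\<lambda>(x, h). ten M H (emb C a1 * x) (a2 * h))" for a1 a2
    by (rule lin_ext_ten[of pscale H "forms C 0" "\<lambda>x0 x1. plin (wrcoact C (Suc 0) m) (\<lambda>(x, h). ten M H (x0 * x) (x1 * h))"])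
      (auto simp: lin lin_ext_fun_add[OF vs_pscale, symmetric] lin_ext_fun_scale[OF vs_pscale, symmetric]
        intro!: lin_ext_cong dest!: k, auto simp: tl ta gm)
  have 3: "plin (ten H (forms C 0) a1 (emb C a2)) (\<lambda>(y1, y0). ten H M (h * y1) (x * y0)) =
     ten H M (h * a1) (x * emb C a2)" if "x \<in> grade C (Suc 0)" for a1 a2 h x
    by (rule lin_ext_ten[of pscale "forms C 0" H "\<lambda>y1 y0. ten H M (h * y1) (x * y0)"])
      (simp_all add: lin tl ta gm that)
  have 4: "plin (ten (forms C 0) H (emb C a1) a2) (\<lambda>(y0, y1). ten M H (x * y0) (h * y1)) =
     ten M H (x * emb C a1) (h * a2)" if "x \<in> grade C (Suc 0)" for a1 a2 h x
    by (rule lin_ext_ten[of pscale H "forms C 0" "\<lambda>y0 y1. ten M H (x * y0) (h * y1)"])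
      (simp_all add: lin tl ta gm that)
  show "wlcoact C (Suc 0) (emb C a * m) =
      plin (comult H a) (\<lambda>(a1, a2). plin (wlcoact C (Suc 0) m) (\<lambda>(h, x). ten H M (a1 * h) (emb C a2 * x)))"
    using wlcoact_mult[of "emb C a" 0 m "Suc 0"] m 1
    by (simp add: wlcoact_emb lin_ext_plin ten_Omega1 split_def)
  show "wrcoact C (Suc 0) (emb C a * m) =
      plin (comult H a) (\<lambda>(a1, a2). plin (wrcoact C (Suc 0) m) (\<lambda>(x, h). ten M H (emb C a1 * x) (a2 * h)))"
    using wrcoact_mult[of "emb C a" 0 m "Suc 0"] m 2
    by (simp add: wrcoact_emb lin_ext_plin ten_Omega1 split_def)
  have "wlcoact C (Suc 0) (m * emb C a) = plin (wlcoact C (Suc 0) m) (\<lambda>(h, x). plin (comult H a)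
     (\<lambda>(a1, a2). plin (ten H (forms C 0) a1 (emb C a2)) (\<lambda>(y1, y0). ten H M (h * y1) (x * y0))))"
    using wlcoact_mult[of m "Suc 0" "emb C a" 0] m
    by (simp add: wlcoact_emb lin_ext_plin ten_Omega1 split_def)
  also have "\<dots> = plin (wlcoact C (Suc 0) m) (\<lambda>(h, x). plin (comult H a) (\<lambda>(a1, a2). ten H M (h * a1) (x * emb C a2)))"
    by (rule lin_ext_cong) (auto simp: 3 dest!: k)
  finally show "wlcoact C (Suc 0) (m * emb C a) = \<dots>" .
  have "wrcoact C (Suc 0) (m * emb C a) = plin (wrcoact C (Suc 0) m) (\<lambda>(x, h). plin (comult H a)
     (\<lambda>(a1, a2). plin (ten (forms C 0) H (emb C a1) a2) (\<lambda>(y0, y1). ten M H (x * y0) (h * y1))))"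
    using wrcoact_mult[of m "Suc 0" "emb C a" 0] m
    by (simp add: wrcoact_emb lin_ext_plin ten_Omega1 split_def)
  also have "\<dots> = plin (wrcoact C (Suc 0) m) (\<lambda>(x, h). plin (comult H a) (\<lambda>(a1, a2). ten M H (x * emb C a1) (h * a2)))"
    by (rule lin_ext_cong) (auto simp: 4 dest!: k)
  finally show "wrcoact C (Suc 0) (m * emb C a) = \<dots>" .
qed

sublocale bicovariant_bimodule H M
proof
  show "is_vs M" by (rule is_vs_Omega1)
  show "left_comodule H M (lcoact M)" "right_comodule H M (rcoact M)" by (rule comodule_Omega1)+
qed (simp_all add: Omega1_simps emb_add emb_scale distrib_left distrib_right wscl_mult_left wscl_mult_right
    emb_mult emb_one mult.assoc coact_products grade_mult[of "emb C a" 0 _ "Suc 0" for a, simplified]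
    grade_mult[of _ "Suc 0" "emb C a" 0 for a, simplified])

end

section \<open>The sum of a connection with itself\<close>

context woronowicz_calculus_bij
begin

notation lmul (infixr "\<rhd>" 75) and rmul (infixl "\<lhd>" 75)

abbreviation da :: "'h \<Rightarrow> 'w" where "da a \<equiv> dd C (emb C a)"

lemma da_closed [simp]: "da a \<in> carr M"
  using dd_grade[of "emb C a" 0] by (simp add: Omega1_simps)

lemma da_add: "da (a + b) = da a + da b" and da_scale: "da (scl H c a) = scl M c (da a)"
  by (simp_all add: emb_add emb_scale dd_add dd_scale Omega1_simps)

lemma da_mult: "da (a * b) = da a \<lhd> b + a \<rhd> da b"
  using dd_Leibniz[of "emb C a" 0 "emb C b"] by (simp add: emb_mult Omega1_simps)

text \<open>Left colinearity of d turns the coproduct of b into the coaction b_1 \<otimes> db_2;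
  tensors with \<open>forms C 0\<close> are evaluated away in between.\<close>

lemma lsum_da:
  assumes s: "vector_space s" and f: "\<And>x. x \<in> carr M \<Longrightarrow> linear_on H s (\<lambda>h. f h x)" "\<And>h. linear_on M s (f h)"
  shows "lsum s (da b) f = csum s b (\<lambda>b1 b2. f b1 (da b2))"
proof -
  have d: "dd C x \<in> carr M" if "x \<in> grade C 0" for x
    using dd_grade[OF that] by (simp add: Omega1_simps)
  have "lcoact M (da b) = plin (wlcoact C 0 (emb C b)) (\<lambda>(h, x0). ten H M h (dd C x0))"
    using wlcoact_dd[of "emb C b" 0] by (simp add: Omega1_simps ten_Omega1)
  also have "\<dots> = plin (comult H b) (\<lambda>(a1, a2). plin (ten H (forms C 0) a1 (emb C a2)) (\<lambda>(h, x0). ten H M h (dd C x0)))"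
    by (simp add: wlcoact_emb lin_ext_plin split_def)
  also have "\<dots> = plin (comult H b) (\<lambda>(a1, a2). ten H M a1 (da a2))"
  proof -
    have "plin (ten H (forms C 0) a1 (emb C a2)) (\<lambda>(h, x0). ten H M h (dd C x0)) = ten H M a1 (da a2)" for a1 a2
      by (rule lin_ext_ten[of pscale "forms C 0" H "\<lambda>h x0. ten H M h (dd C x0)"])
        (simp_all add: linear_on_def forms_simps d dd_add dd_scale ten_add_left ten_add_right ten_scale_left
          ten_scale_right[of _ H _ M, unfolded Omega1_simps(2)])
    then show ?thesis by simp
  qed
  finally have "lcoact M (da b) = plin (comult H b) (\<lambda>(a1, a2). ten H M a1 (da a2))" .
  then show ?thesis
    using lin_ext_ten[OF s f, where y = "da y" and x = x for x y] by (simp add: lsum_def csum_def lin_ext_plin[OF s] split_def)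
qed

text \<open>For \<open>x = m\<^sub>0S(m\<^sub>1)\<close> and \<open>y = m\<^sub>2n\<close> the two summands of \<open>\<phi> \<oplus> \<phi>\<close> are \<open>\<sigma>\<^sub>2\<^sub>3(\<phi>(x) \<otimes> y)\<close> and
  \<open>\<phi>\<^sub>-\<^sub>2 x S(\<phi>\<^sub>-\<^sub>1) \<otimes> \<phi>\<^sub>0(y)\<close>.\<close>

definition ad_tensor :: "'w \<Rightarrow> 'h \<Rightarrow> ('w list \<Rightarrow>\<^sub>0 'k) \<Rightarrow> ('w list \<Rightarrow>\<^sub>0 'k)" where
  "ad_tensor x p u = csum pscale p (\<lambda>p2 p1. hcons ((p2 \<rhd> x) \<lhd> S p1) u)"

text \<open>Here \<open>h\<close> and \<open>y\<close> stand for y_{-1} and y_0 in \<phi>_{-1} =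
  \<phi>(y_0)_{-1}S^{-1}(y_{-1}). Separating them exposes a map that is bilinear in the two legs of
  the coaction.\<close>

definition second_leg_at :: "('w \<Rightarrow> ('w list \<Rightarrow>\<^sub>0 'k)) \<Rightarrow> 'w \<Rightarrow> 'h \<Rightarrow> 'w \<Rightarrow> ('w list \<Rightarrow>\<^sub>0 'k)" where
  "second_leg_at \<phi> x h y = plin (lcoact2 H M (\<phi> y)) (\<lambda>(k, u). ad_tensor x (k * Si h) u)"

definition second_leg :: "('w \<Rightarrow> ('w list \<Rightarrow>\<^sub>0 'k)) \<Rightarrow> 'w \<Rightarrow> 'w \<Rightarrow> ('w list \<Rightarrow>\<^sub>0 'k)" where
  "second_leg \<phi> x y = lsum pscale y (second_leg_at \<phi> x)"

definition oplus_legs :: "('w \<Rightarrow> ('w list \<Rightarrow>\<^sub>0 'k)) \<Rightarrow> 'w \<Rightarrow> 'w \<Rightarrow> ('w list \<Rightarrow>\<^sub>0 'k)" where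
  "oplus_legs \<phi> x y = at_factors M (Suc 0) (braiding H M) (hsnoc (\<phi> x) y) + second_leg \<phi> x y"

lemma ad_tensor_linear:
  "linear_on H pscale (\<lambda>p. ad_tensor x p u)"
  "linear_on (hpow M 2) pscale (ad_tensor x p)"
  "u \<in> carr (hpow M 2) \<Longrightarrow> linear_on M pscale (\<lambda>x. ad_tensor x p u)"
  using hcons_linear[unfolded linear_on_def scl_hpow] hcons_linear_left[unfolded linear_on_def]
  by (simp_all add: ad_tensor_def linM linear_on_def[of "hpow M 2"])

lemma ad_tensor_closed [simp]: "x \<in> carr M \<Longrightarrow> u \<in> carr (hpow M 2) \<Longrightarrow> ad_tensor x p u \<in> carr (hpow M 3)"
  unfolding ad_tensor_def by (intro csum_closed_hpow) auto

lemma ad_tensor_ract: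
  assumes "x \<in> carr M" "u \<in> carr (hpow M 2)"
  shows "ad_tensor x p (hpow_ract M u a) = hpow_ract M (ad_tensor x p u) a"
  unfolding ad_tensor_def using assms
  by (subst linear_on_csum_hpow[where n = 3, OF hpow_ract_linear]) (simp_all add: hcons_ract)

lemma ad_tensor_one: "x \<in> carr M \<Longrightarrow> u \<in> carr (hpow M 2) \<Longrightarrow> ad_tensor x 1 u = hcons x u"
  unfolding ad_tensor_def using hcons_linear_left[of u, unfolded linear_on_def]
  by (subst csum_one) (simp_all add: linM)

context
  fixes \<phi> :: "'w \<Rightarrow> ('w list \<Rightarrow>\<^sub>0 'k)"
  assumes phi_closed [simp]: "\<And>x. x \<in> carr M \<Longrightarrow> \<phi> x \<in> carr (hpow M 2)"
    and phi_linear: "linear_on M pscale \<phi>"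
begin

lemma keys_lcoact2_phi: "y \<in> carr M \<Longrightarrow> (k, u) \<in> Poly_Mapping.keys (lcoact2 H M (\<phi> y)) \<Longrightarrow> u \<in> carr (hpow M 2)"
  using tsp_keys[OF is_vs_H hpow_is_vs lcoact2_closed[OF phi_closed]] by auto

lemma second_leg_at_linear:
  "y \<in> carr M \<Longrightarrow> linear_on M pscale (\<lambda>x. second_leg_at \<phi> x h y)"
  "y \<in> carr M \<Longrightarrow> linear_on H pscale (\<lambda>h. second_leg_at \<phi> x h y)"
  "linear_on M pscale (second_leg_at \<phi> x h)"
proof -
  note K = ad_tensor_linear[unfolded linear_on_def[of M] linear_on_H]
  show "linear_on M pscale (\<lambda>x. second_leg_at \<phi> x h y)" "linear_on H pscale (\<lambda>h. second_leg_at \<phi> x h y)" if y: "y \<in> carr M"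
    unfolding linear_on_def[of M] linear_on_H second_leg_at_def
      lin_ext_fun_add[OF vs_pscale, symmetric] lin_ext_fun_scale[OF vs_pscale, symmetric]
    using y keys_lcoact2_phi by (auto intro!: lin_ext_cong simp: K linM)
  show "linear_on M pscale (second_leg_at \<phi> x h)"
    using phi_linear lcoact2_linear
    by (simp add: linear_on_def second_leg_at_def lin_ext_add lin_ext_pscale)
qed

lemma second_leg_at_closed: "x \<in> carr M \<Longrightarrow> y \<in> carr M \<Longrightarrow> second_leg_at \<phi> x h y \<in> carr (hpow M 3)"
  unfolding second_leg_at_def
  using lin_ext_closed[of "hpow M 3" "lcoact2 H M (\<phi> y)" "\<lambda>(k, u). ad_tensor x (k * Si h) u"] keys_lcoact2_phi
  by auto

lemma second_leg_closed: "x \<in> carr M \<Longrightarrow> y \<in> carr M \<Longrightarrow> second_leg \<phi> x y \<in> carr (hpow M 3)"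
  unfolding second_leg_def by (intro lsum_closed_hpow second_leg_at_closed)

lemma oplus_legs_linear:
  "y \<in> carr M \<Longrightarrow> linear_on M pscale (\<lambda>x. oplus_legs \<phi> x y)"
  "x \<in> carr M \<Longrightarrow> linear_on M pscale (oplus_legs \<phi> x)"
proof -
  have "linear_on M pscale (\<lambda>x. second_leg \<phi> x y)" if "y \<in> carr M" for y
    using that second_leg_at_linear(1)[unfolded linear_on_def]
    by (simp add: linear_on_def second_leg_def sum_lin[OF vs_pscale] cong: lsum_cong)
  moreover have "linear_on M pscale (second_leg \<phi> x)" for x
    by (simp add: linear_on_def second_leg_def sum_lin[OF vs_pscale])
  ultimately show
    "y \<in> carr M \<Longrightarrow> linear_on M pscale (\<lambda>x. oplus_legs \<phi> x y)"
    "x \<in> carr M \<Longrightarrow> linear_on M pscale (oplus_legs \<phi> x)"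
    using phi_linear at_linear[of 3 "Suc 0" "braiding H M"] hsnoc_linear hsnoc_linear_right[of "\<phi> x"]
    by (simp_all add: linear_on_def oplus_legs_def vs_scale_simps)
qed

lemma oplus_legs_closed: "x \<in> carr M \<Longrightarrow> y \<in> carr M \<Longrightarrow> oplus_legs \<phi> x y \<in> carr (hpow M 3)"
  unfolding oplus_legs_def by (intro is_vsD(3)[OF hpow_is_vs] at_factors_1_closed second_leg_closed) simp_all

text \<open>The definition of \<open>oplus\<close> applies the antipode to p_1m_1. Since S(p_1m_1) =
  S(m_1)S(p_1), the factor S(m_1) can be absorbed into the first argument, and m enters through
  m_0S(m_1) as \<open>twist\<close> requires.\<close>

lemma plin_map_lcoact:
  assumes x: "x \<in> carr M" and y: "y \<in> carr M"
  shows "plin (map_lcoact H C \<phi> y) (\<lambda>(p, u). csum pscale p (\<lambda>p2 p1. hcat M (hten M [(p2 \<rhd> x) \<lhd> S (p1 * a)]) u)) =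
    second_leg \<phi> (x \<lhd> S a) y"
proof -
  define F where "F p u = csum pscale p (\<lambda>p2 p1. hcat M (hten M [(p2 \<rhd> x) \<lhd> S (p1 * a)]) u)" for p u
  have F: "F p u = ad_tensor (x \<lhd> S a) p u" if "u \<in> carr (hpow M 2)" for p u
    using that x by (simp add: F_def ad_tensor_def hcat_left linM)
  have t: "plin (ten H (hpow M 2) p u) (\<lambda>(p, u). F p u) = ad_tensor (x \<lhd> S a) p u" if u: "u \<in> carr (hpow M 2)" for p u
  proof -
    have "plin (ten H (hpow M 2) p u) (\<lambda>(p, u). F p u) = F p u"
    proof (rule lin_ext_ten[OF vs_pscale])
      show "linear_on H pscale (\<lambda>p. F p u)" for u
        by (simp add: F_def linear_on_H csum_arg)
      show "linear_on (hpow M 2) pscale (F p)" for p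
        using ad_tensor_linear(2)[of "x \<lhd> S a" p] is_vsD(3,4)[OF hpow_is_vs, of _ M 2] by (simp add: linear_on_def F)
    qed (simp_all add: u)
    then show ?thesis by (simp add: F u)
  qed
  have m: "map_lcoact H C \<phi> y = lsum pscale y (\<lambda>h y0. plin (lcoact2 H M (\<phi> y0)) (\<lambda>(k, u). ten H (hpow M 2) (k * Si h) u))"
    by (simp add: map_lcoact_def lsum_def)
  have "plin (map_lcoact H C \<phi> y) (\<lambda>(p, u). F p u) =
    lsum pscale y (\<lambda>h y0. plin (lcoact2 H M (\<phi> y0)) (\<lambda>(k, u). plin (ten H (hpow M 2) (k * Si h) u) (\<lambda>(p, u). F p u)))"
    by (simp add: m lin_ext_lsum lin_ext_plin split_def)
  also have "\<dots> = second_leg \<phi> (x \<lhd> S a) y"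
    unfolding second_leg_def second_leg_at_def using keys_lcoact2_phi
    by (intro lsum_cong refl y lin_ext_cong) (auto simp: t)
  finally show ?thesis by (simp add: F_def)
qed

lemma oplus_eq:
  assumes t: "t \<in> carr (hpow M 2)"
  shows "oplus H C \<phi> t = plin t (\<lambda>w. twist pscale (oplus_legs \<phi>) (w ! 0) (w ! 1))"
  unfolding oplus_def Let_def
proof (rule lin_ext_words2_cong[OF refl t])
  fix m n assume m: "m \<in> carr M" and n: "n \<in> carr M"
  have "rsum pscale m (\<lambda>m0 h. csum pscale h (\<lambda>m1 m2.
     at_factors M 1 (braiding H M) (hcat M (\<phi> (m0 \<lhd> S m1)) (hten M [m2 \<rhd> n])) +
       plin (map_lcoact H C \<phi> (m2 \<rhd> n)) (\<lambda>(p, u). csum pscale p (\<lambda>p2 p1. hcat M (hten M [(p2 \<rhd> m0) \<lhd> S (p1 * m1)]) u)))) =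
    twist pscale (oplus_legs \<phi>) m n"
    unfolding twist_def by (intro rsum_cong refl m) (simp add: plin_map_lcoact n hcat_right oplus_legs_def)
  then show "plin (rcoact M ([m, n] ! 0)) (\<lambda>(m0, h). plin (comult H h) (\<lambda>(m1, m2).
         at_factors M 1 (braiding H M) (hcat M (\<phi> (m0 \<lhd> S m1)) (hten M [m2 \<rhd> [m, n] ! 1])) +
         plin (map_lcoact H C \<phi> (m2 \<rhd> [m, n] ! 1)) (\<lambda>(p, s). plin (comult H p) (\<lambda>(p2, p1).
           hcat M (hten M [(p2 \<rhd> m0) \<lhd> S (p1 * m1)]) s)))) =
    twist pscale (oplus_legs \<phi>) ([m, n] ! 0) ([m, n] ! 1)"
    by (simp add: rsum_def csum_def)
qed

lemma oplus_hten:
  assumes "m \<in> carr M" "n \<in> carr M"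
  shows "oplus H C \<phi> (hten M [m, n]) = twist pscale (oplus_legs \<phi>) m n"
  using assms by (simp add: oplus_eq) (simp add: lin_ext_twist[OF vs_pscale oplus_legs_linear, simplified])

lemma oplus_closed:
  assumes t: "t \<in> carr (hpow M 2)"
  shows "oplus H C \<phi> t \<in> carr (hpow M 3)"
proof -
  have "twist pscale (oplus_legs \<phi>) m n \<in> carr (hpow M 3)" if "m \<in> carr M" "n \<in> carr M" for m n
    unfolding twist_def using that by (intro rsum_closed_hpow csum_closed_hpow oplus_legs_closed) simp_all
  then show ?thesis
    using lin_ext_words2_closed[of "hpow M 3" t "\<lambda>w. twist pscale (oplus_legs \<phi>) (w ! 0) (w ! 1)"] t by (simp add: oplus_eq)
qed

context
  assumes phi_Leibniz: "\<And>x a. x \<in> carr M \<Longrightarrow> \<phi> (x \<lhd> a) = hpow_ract M (\<phi> x) a + hten M [x, da a]"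
begin

text \<open>The Leibniz rule splits \<phi>(yb) in two; both parts carry a leg of b just before
  \<open>Si h\<close>, ready to cancel against a leg of the same element inside h.\<close>

lemma second_leg_at_ract:
  assumes x: "x \<in> carr M" and y: "y \<in> carr M"
  shows "second_leg_at \<phi> x h (y \<lhd> b) =
    plin (lcoact2 H M (\<phi> y)) (\<lambda>(k, u). csum pscale b (\<lambda>b1 b2. ad_tensor x (k * b1 * Si h) (hpow_ract M u b2))) +
    lsum pscale y (\<lambda>k z. csum pscale b (\<lambda>b1 b2. ad_tensor x (k * b1 * Si h) (hten M [z, da b2])))"
proof -
  note K = ad_tensor_linear[unfolded linear_on_def[of M] linear_on_def[of "hpow M 2"] linear_on_H scl_hpow]
  have l: "linear_on H pscale (\<lambda>k. ad_tensor x (k * Si h) u)" "linear_on (hpow M 2) pscale (ad_tensor x (k * Si h))" for u k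
    by (simp_all add: K linM linear_on_def[of "hpow M 2"])
  have "lcoact2 H M (\<phi> (y \<lhd> b)) = lcoact2 H M (hpow_ract M (\<phi> y) b) + lcoact2 H M (hten M [y, da b])"
    using y lcoact2_linear by (simp add: phi_Leibniz linear_on_def)
  then have "second_leg_at \<phi> x h (y \<lhd> b) =
    plin (lcoact2 H M (hpow_ract M (\<phi> y) b)) (\<lambda>(k, u). ad_tensor x (k * Si h) u) +
    plin (lcoact2 H M (hten M [y, da b])) (\<lambda>(k, u). ad_tensor x (k * Si h) u)"
    by (simp add: second_leg_at_def lin_ext_add)
  moreover have "plin (lcoact2 H M (hpow_ract M (\<phi> y) b)) (\<lambda>(k, u). ad_tensor x (k * Si h) u) =
    plin (lcoact2 H M (\<phi> y)) (\<lambda>(k, u). csum pscale b (\<lambda>b1 b2. ad_tensor x (k * b1 * Si h) (hpow_ract M u b2)))"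
    by (rule lcoact2_ract) (use y l in simp_all)
  moreover have "plin (lcoact2 H M (hten M [y, da b])) (\<lambda>(k, u). ad_tensor x (k * Si h) u) =
    lsum pscale y (\<lambda>k z. lsum pscale (da b) (\<lambda>b1 v. ad_tensor x (k * b1 * Si h) (hten M [z, v])))"
    by (rule lcoact2_eval) (use y l in simp_all)
  moreover have "\<dots> = lsum pscale y (\<lambda>k z. csum pscale b (\<lambda>b1 b2. ad_tensor x (k * b1 * Si h) (hten M [z, da b2])))"
    by (intro lsum_cong refl y lsum_da) (simp_all add: K linT)
  ultimately show ?thesis by simp
qed

text \<open>The coaction of ya turns S^{-1}(y_{-1}) into S^{-1}(a_1)S^{-1}(y_{-1}), preceded by a_2,
  so these legs of a cancel. In the derivative part y_{-1}S^{-1}(y_{-2}) cancels as well, and x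
  \<otimes> y \<otimes> da remains.\<close>

lemma second_leg_ract:
  assumes x: "x \<in> carr M" and y: "y \<in> carr M"
  shows "second_leg \<phi> x (y \<lhd> a) = hpow_ract M (second_leg \<phi> x y) a + hten M [x, y, da a]"
proof -
  note K = ad_tensor_linear[unfolded linear_on_def[of M] linear_on_def[of "hpow M 2"] linear_on_H scl_hpow]
  note hr = hpow_ract_linear[where n = 2, unfolded linear_on_def scl_hpow]
  note da = da_add da_scale
  \<comment> \<open>\<open>?A\<close> comes from the right linear part of the Leibniz rule,
    \<open>?B\<close> from the derivative.\<close>
  let ?A = "\<lambda>h y0 a1 a2. plin (lcoact2 H M (\<phi> y0)) (\<lambda>(k, u). csum pscale a2 (\<lambda>b1 b2. ad_tensor x (k * b1 * Si (h * a1)) (hpow_ract M u b2)))"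
  let ?B = "\<lambda>h y0 a1 a2. lsum pscale y0 (\<lambda>k z. csum pscale a2 (\<lambda>b1 b2. ad_tensor x (k * b1 * Si (h * a1)) (hten M [z, da b2])))"
  have "second_leg \<phi> x (y \<lhd> a) = lsum pscale y (\<lambda>h y0. csum pscale a (\<lambda>a1 a2. second_leg_at \<phi> x (h * a1) (y0 \<lhd> a2)))"
    unfolding second_leg_def by (rule lsum_act) (simp_all add: y second_leg_at_linear)
  also have "\<dots> = lsum pscale y (\<lambda>h y0. csum pscale a (\<lambda>a1 a2. ?A h y0 a1 a2 + ?B h y0 a1 a2))"
    using y by (simp add: second_leg_at_ract x cong: lsum_cong)
  also have "\<dots> = lsum pscale y (\<lambda>h y0. csum pscale a (\<lambda>a1 a2. ?A h y0 a1 a2)) +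
      lsum pscale y (\<lambda>h y0. csum pscale a (\<lambda>a1 a2. ?B h y0 a1 a2))"
    by (simp add: sum_lin[OF vs_pscale])
  also have "lsum pscale y (\<lambda>h y0. csum pscale a (\<lambda>a1 a2. ?A h y0 a1 a2)) = hpow_ract M (second_leg \<phi> x y) a"
  proof -
    have "csum pscale a (\<lambda>a1 a2. ?A h y0 a1 a2) = hpow_ract M (second_leg_at \<phi> x h y0) a" if y0: "y0 \<in> carr M" for h y0
    proof -
      have "csum pscale a (\<lambda>a1 a2. ?A h y0 a1 a2) =
        plin (lcoact2 H M (\<phi> y0)) (\<lambda>(k, u). csum pscale a (\<lambda>a1 a2. csum pscale a2 (\<lambda>b1 b2. ad_tensor x (k * (b1 * Si a1) * Si h) (hpow_ract M u b2))))"
        by (simp add: csum_lin_ext_swap split_def Si_mult mult.assoc)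
      also have "\<dots> = plin (lcoact2 H M (\<phi> y0)) (\<lambda>(k, u). hpow_ract M (ad_tensor x (k * Si h) u) a)"
      proof (rule lin_ext_cong[OF refl], safe)
        fix k u assume "(k, u) \<in> Poly_Mapping.keys (lcoact2 H M (\<phi> y0))"
        then have u: "u \<in> carr (hpow M 2)" using keys_lcoact2_phi y0 by blast
        have "csum pscale a (\<lambda>a1 a2. csum pscale a2 (\<lambda>b1 b2. ad_tensor x (k * (b1 * Si a1) * Si h) (hpow_ract M u b2))) =
          ad_tensor x (k * 1 * Si h) (hpow_ract M u a)"
          by (rule csum_cancel_Si_right(1)[where F = "\<lambda>z b. ad_tensor x (k * z * Si h) (hpow_ract M u b)"])
            (use u in \<open>simp_all add: K linM hpow_ract_simps\<close>)
        then show "csum pscale a (\<lambda>a1 a2. csum pscale a2 (\<lambda>b1 b2. ad_tensor x (k * (b1 * Si a1) * Si h) (hpow_ract M u b2))) =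
          hpow_ract M (ad_tensor x (k * Si h) u) a"
          by (simp add: ad_tensor_ract x u)
      qed
      also have "\<dots> = hpow_ract M (second_leg_at \<phi> x h y0) a"
      proof -
        have "hpow_ract M (lin_ext (scl (hpow M 3)) (lcoact2 H M (\<phi> y0)) (\<lambda>(k, u). ad_tensor x (k * Si h) u)) a =
           plin (lcoact2 H M (\<phi> y0)) (\<lambda>p. hpow_ract M (case p of (k, u) \<Rightarrow> ad_tensor x (k * Si h) u) a)"
          by (rule linear_on_lin_ext[OF hpow_is_vs hpow_ract_linear]) (use keys_lcoact2_phi y0 x in auto)
        then show ?thesis by (simp add: second_leg_at_def split_def)
      qed
      finally show ?thesis .
    qed
    then show ?thesis unfolding second_leg_def using x y
      by (simp add: linear_on_lsum_hpow[where n = 3, OF hpow_ract_linear] second_leg_at_closed cong: lsum_cong)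
  qed
  also have "lsum pscale y (\<lambda>h y0. csum pscale a (\<lambda>a1 a2. ?B h y0 a1 a2)) = hten M [x, y, da a]"
  proof -
    have "csum pscale a (\<lambda>a1 a2. ?B h y0 a1 a2) = lsum pscale y0 (\<lambda>k z. ad_tensor x (k * Si h) (hten M [z, da a]))"
      if y0: "y0 \<in> carr M" for h y0
    proof -
      have "csum pscale a (\<lambda>a1 a2. ?B h y0 a1 a2) =
        lsum pscale y0 (\<lambda>k z. csum pscale a (\<lambda>a1 a2. csum pscale a2 (\<lambda>b1 b2. ad_tensor x (k * (b1 * Si a1) * Si h) (hten M [z, da b2]))))"
        by (simp add: sum_csum_swap Si_mult mult.assoc)
      also have "\<dots> = lsum pscale y0 (\<lambda>k z. ad_tensor x (k * 1 * Si h) (hten M [z, da a]))"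
        by (intro lsum_cong refl y0 csum_cancel_Si_right(1)[where F = "\<lambda>w b. ad_tensor x (k * w * Si h) (hten M [z, da b])" for k z])
          (simp_all add: K linT da)
      finally show ?thesis by simp
    qed
    then have "lsum pscale y (\<lambda>h y0. csum pscale a (\<lambda>a1 a2. ?B h y0 a1 a2)) =
      lsum pscale y (\<lambda>h y0. lsum pscale y0 (\<lambda>k z. ad_tensor x (k * Si h) (hten M [z, da a])))"
      using y by (simp cong: lsum_cong)
    also have "\<dots> = lsum pscale y (\<lambda>h z. csum pscale h (\<lambda>a1 b1. ad_tensor x (b1 * Si a1) (hten M [z, da a])))"
      by (rule lsum_coassoc) (simp_all add: y K linT)
    also have "\<dots> = lsum pscale y (\<lambda>h z. pscale (eps h) (ad_tensor x 1 (hten M [z, da a])))"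
      by (intro lsum_cong refl y csum_antipode_inv_right) (simp add: K linT)
    also have "\<dots> = ad_tensor x 1 (hten M [y, da a])"
      by (rule lsum_counit) (simp_all add: y K linT)
    also have "\<dots> = hten M [x, y, da a]"
      by (simp add: ad_tensor_one x y hcons_hten)
    finally show ?thesis .
  qed
  finally show ?thesis .
qed

text \<open>The summand with the braiding applies \<phi> to the first factor and is right linear in
  the second, so the derivative stems from the other leg alone. It is x \<otimes> y \<otimes> da,
  which is balanced over \<open>H\<close> and therefore passes through \<open>twist\<close>
  unchanged.\<close>

lemma oplus_Leibniz:
  assumes t: "t \<in> carr (hpow M 2)"
  shows "oplus H C \<phi> (hpow_ract M t a) = hpow_ract M (oplus H C \<phi> t) a + hsnoc t (da a)"
proof -
  note da = da_add da_scale
  have ol: "linear_on (hpow M 2) pscale (oplus H C \<phi>)"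
    unfolding oplus_def Let_def by (rule linear_on_lin_ext_arg) simp_all
  have Q: "oplus_legs \<phi> x (y \<lhd> a) = hpow_ract M (oplus_legs \<phi> x y) a + hten M [x, y, da a]"
    if "x \<in> carr M" "y \<in> carr M" for x y
    using that hpow_ract_linear[of 3 a, unfolded linear_on_def]
    by (simp add: oplus_legs_def hsnoc_ract at_factors_1_ract second_leg_ract at_factors_1_closed second_leg_closed)
  have main: "oplus H C \<phi> (hten M [m, n \<lhd> a]) = hpow_ract M (oplus H C \<phi> (hten M [m, n])) a + hten M [m, n, da a]"
    if m: "m \<in> carr M" and n: "n \<in> carr M" for m n
  proof -
    have "oplus H C \<phi> (hten M [m, n \<lhd> a]) = rsum pscale m (\<lambda>m0 h. csum pscale h (\<lambda>m1 m2. oplus_legs \<phi> (m0 \<lhd> S m1) ((m2 \<rhd> n) \<lhd> a)))"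
      using m n by (simp add: oplus_hten twist_def lact_ract cong: rsum_cong)
    also have "\<dots> = rsum pscale m (\<lambda>m0 h. csum pscale h (\<lambda>m1 m2. hpow_ract M (oplus_legs \<phi> (m0 \<lhd> S m1) (m2 \<rhd> n)) a)) +
       twist pscale (\<lambda>x y. hten M [x, y, da a]) m n"
      using m n by (simp add: Q sum_lin[OF vs_pscale] twist_def del: lact_ract cong: rsum_cong)
    also have "rsum pscale m (\<lambda>m0 h. csum pscale h (\<lambda>m1 m2. hpow_ract M (oplus_legs \<phi> (m0 \<lhd> S m1) (m2 \<rhd> n)) a)) =
      hpow_ract M (twist pscale (oplus_legs \<phi>) m n) a"
      unfolding twist_def using m n
      by (simp add: linear_on_rsum_hpow[where n = 3, OF hpow_ract_linear] linear_on_csum_hpow[where n = 3, OF hpow_ract_linear]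
          csum_closed_hpow oplus_legs_closed cong: rsum_cong)
    also have "twist pscale (\<lambda>x y. hten M [x, y, da a]) m n = hten M [m, n, da a]"
      by (rule twist_of_balanced) (simp_all add: m n linT hten_moves)
    finally show ?thesis using m n by (simp add: oplus_hten)
  qed
  have l: "linear_on (hpow M 2) pscale (\<lambda>t. hpow_ract M (oplus H C \<phi> t) a + hsnoc t (da a))"
    using linear_on_comp[OF ol oplus_closed hpow_ract_linear[of 3 a]] hsnoc_linear[of "da a"]
    by (simp add: linear_on_def vs_scale_simps)
  show ?thesis
  proof (rule hpow_eqI[OF linear_on_comp[where n = 2, OF hpow_ract_linear _ ol] l t])
    fix w assume "w \<in> words M 2"
    then show "oplus H C \<phi> (hpow_ract M (hten M w) a) = hpow_ract M (oplus H C \<phi> (hten M w)) a + hsnoc (hten M w) (da a)"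
      using main by (auto simp: words_2 hpow_ract_hten hsnoc_hten)
  qed simp
qed

end

end

section \<open>Vector fields and their pairing with one-forms\<close>

abbreviation DV :: "('k, 'w \<Rightarrow> 'h) vspace" where "DV \<equiv> dual_vspace H M"

lemma dual_simps:
  "carr (VF H C) = carr DV" "scl (VF H C) = scl DV" "lact (VF H C) = (\<lambda>a X m. a * X m)"
  "ract (VF H C) X a m = (if m \<in> carr M then X (a \<rhd> m) else 0)" "scl DV c X m = scl H c (X m)"
  by (simp_all add: dual_bibimodule_def dual_vspace_def)

lemma carr_DV: "X \<in> carr DV \<longleftrightarrow> (\<forall>x\<in>carr M. \<forall>y\<in>carr M. X (x + y) = X x + X y) \<and>
     (\<forall>x\<in>carr M. \<forall>a. X (x \<lhd> a) = X x * a) \<and> (\<forall>x. x \<notin> carr M \<longrightarrow> X x = 0)"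
  by (simp add: dual_vspace_def right_hom_def)

text \<open>Scalars act through \<open>H\<close>, so the additive right linear maps in
  \<open>right_hom\<close> are homogeneous.\<close>

lemma scale_as_ract: "x \<in> carr M \<Longrightarrow> scl M c x = x \<lhd> scl H c 1"
  by (simp add: ract_scale)

lemma DV_apply:
  assumes "X \<in> carr DV"
  shows "x \<in> carr M \<Longrightarrow> y \<in> carr M \<Longrightarrow> X (x + y) = X x + X y" "x \<in> carr M \<Longrightarrow> X (x \<lhd> a) = X x * a"
    "x \<in> carr M \<Longrightarrow> X (scl M c x) = scl H c (X x)" "x \<notin> carr M \<Longrightarrow> X x = 0" "linear_on M (scl H) X"
  using assms by (auto simp: carr_DV linear_on_def scale_as_ract scl_mult_right)

lemma is_vs_DV [simp]: "is_vs DV"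
proof -
  interpret h: vector_space "scl H" by simp
  interpret v: vector_space "scl DV"
    by unfold_locales (simp_all add: fun_eq_iff dual_simps h.scale_right_distrib h.scale_left_distrib)
  have "v.subspace (carr DV)"
    by (rule v.subspaceI) (simp_all add: carr_DV dual_simps h.scale_right_distrib scl_mult_left algebra_simps)
  then show ?thesis by (simp add: is_vs_def v.vector_space_axioms)
qed

lemma is_vs_VF [simp]: "is_vs (VF H C)"
  using is_vs_DV by (simp add: is_vs_def dual_simps)

lemma DV_lact [simp]: "X \<in> carr DV \<Longrightarrow> (\<lambda>m. a * X m) \<in> carr DV"
  by (simp add: carr_DV distrib_left mult.assoc)

lemma DV_ract [simp]: "X \<in> carr DV \<Longrightarrow> ract (VF H C) X a \<in> carr DV"
  by (simp add: carr_DV dual_simps lact_add lact_ract[symmetric])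

lemma ten_DV_lin:
  assumes "Y \<in> carr DV"
  shows "ten H DV (h + h') Y = ten H DV h Y + ten H DV h' Y" "ten H DV (scl H c h) Y = pscale c (ten H DV h Y)"
    "ten H DV h (scl DV c Y) = pscale c (ten H DV h Y)"
    "ten DV H Y (h + h') = ten DV H Y h + ten DV H Y h'" "ten DV H Y (scl H c h) = pscale c (ten DV H Y h)"
    "ten DV H (scl DV c Y) h = pscale c (ten DV H Y h)"
    "Z \<in> carr DV \<Longrightarrow> ten H DV h (Y + Z) = ten H DV h Y + ten H DV h Z"
    "Z \<in> carr DV \<Longrightarrow> ten DV H (Y + Z) h = ten DV H Y h + ten DV H Z h"
  using assms by (simp_all add: ten_add_left ten_add_right ten_scale_left ten_scale_right)

lemma ten_HH_lin:
  "ten H H (h + h') = (\<lambda>k. ten H H h k + ten H H h' k)" "ten H H (scl H c h) = (\<lambda>k. pscale c (ten H H h k))"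
  "ten H H k (h + h') = ten H H k h + ten H H k h'" "ten H H k (scl H c h) = pscale c (ten H H k h)"
  by (simp_all add: fun_eq_iff ten_add_left ten_add_right ten_scale_left ten_scale_right)

lemma DV_smul:
  assumes "X \<in> carr DV"
  shows "(\<lambda>m. (a + b) * X m) = (\<lambda>m. a * X m) + (\<lambda>m. b * X m)" "(\<lambda>m. scl H c (a * X m)) = scl DV c (\<lambda>m. a * X m)"
  by (simp_all add: fun_eq_iff dual_simps distrib_right)

lemma lin_ext_ten_HDV:
  assumes s: "vector_space s" and G: "\<And>y. linear_on H s (\<lambda>x. G x y)" "\<And>x. linear_on H s (G x)"
    and Y: "Y \<in> carr DV"
  shows "lin_ext s (ten H DV h Y) (\<lambda>(h, Z). G h (Z m)) = G h (Y m)"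
    "lin_ext s (ten DV H Y h) (\<lambda>(Z, h). G (Z m) h) = G (Y m) h"
  using lin_ext_ten[OF s, of DV H "\<lambda>h Z. G h (Z m)" h Y] lin_ext_ten[OF s, of H DV "\<lambda>Z h. G (Z m) h" Y h] G Y
  by (simp_all add: linear_on_H linear_on_def[of DV] dual_simps)

lemma sum_fun_apply: "(\<Sum>i\<in>A. g i) x = (\<Sum>i\<in>A. g i x)" for g :: "'i \<Rightarrow> 'x \<Rightarrow> 'y::ab_group_add"
  by (induction A rule: infinite_finite_induct) simp_all

definition pair_word :: "('w \<Rightarrow> 'h) \<Rightarrow> ('w \<Rightarrow> 'h) \<Rightarrow> ('w list \<Rightarrow>\<^sub>0 'k) \<Rightarrow> 'h" where
  "pair_word X Y t = lin_ext (scl H) t (\<lambda>w. ract (VF H C) X (Y (w ! 0)) (w ! 1))"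

lemma pair2_eq: "pair2 H C g t = lin_ext (scl H) g (\<lambda>W. pair_word (W ! 0) (W ! 1) t)"
  by (simp add: pair2_def pair_word_def)

lemma pair_word_linear: "linear_on (hpow M 2) (scl H) (pair_word X Y)"
  unfolding pair_word_def[abs_def] by (rule linear_on_lin_ext_arg) simp_all

lemma pair_word_hten:
  assumes "X \<in> carr DV" "Y \<in> carr DV" "m \<in> carr M" "n \<in> carr M"
  shows "pair_word X Y (hten M [m, n]) = X (Y m \<rhd> n)"
  unfolding pair_word_def
  by (subst lin_ext_hten2[of "scl H" M]) (simp_all add: assms dual_simps linM DV_apply(1-3)[OF assms(1)] DV_apply(1-3)[OF assms(2)])

lemma pair2_linear: "linear_on (hpow M 2) (scl H) (pair2 H C g)"
  using pair_word_linear by (simp add: linear_on_def pair2_eq lin_ext_fun_add[OF vs_H] lin_ext_fun_scale[OF vs_H])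

lemma keys_VF:
  assumes "g \<in> carr (hpow (VF H C) 2)" "W \<in> Poly_Mapping.keys g"
  obtains X Y where "X \<in> carr DV" "Y \<in> carr DV" "W = [X, Y]"
proof -
  have "Poly_Mapping.keys g \<subseteq> words (VF H C) 2"
    by (rule hpow_keys[OF is_vs_VF _ _ assms(1)]) (simp_all only: dual_simps DV_lact DV_ract)
  then have "W \<in> words (VF H C) 2" using assms(2) by blast
  then show ?thesis using that by (auto simp: words_2 dual_simps)
qed

lemma pair_word_ract:
  assumes "X \<in> carr DV" "Y \<in> carr DV" "t \<in> carr (hpow M 2)"
  shows "pair_word X Y (hpow_ract M t a) = pair_word X Y t * a"
proof (rule hpow_eqI[OF linear_on_comp[where n = 2, OF hpow_ract_linear _ pair_word_linear] _ assms(3)])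
  show "linear_on (hpow M 2) (scl H) (\<lambda>t. pair_word X Y t * a)"
    using pair_word_linear[of X Y] by (simp add: linear_on_def distrib_right scl_mult_left)
  fix w assume "w \<in> words M 2"
  then show "pair_word X Y (hpow_ract M (hten M w) a) = pair_word X Y (hten M w) * a"
    by (auto simp: words_2 hpow_ract_hten pair_word_hten assms lact_ract[symmetric] DV_apply(2)[OF assms(1)])
qed simp

lemma pair2_ract:
  assumes g: "g \<in> carr (hpow (VF H C) 2)" and t: "t \<in> carr (hpow M 2)"
  shows "pair2 H C g (hpow_ract M t a) = pair2 H C g t * a"
proof -
  have "pair2 H C g (hpow_ract M t a) = lin_ext (scl H) g (\<lambda>W. pair_word (W ! 0) (W ! 1) t * a)"
    unfolding pair2_eq by (rule lin_ext_cong[OF refl]) (auto elim!: keys_VF[OF g] simp: pair_word_ract t)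
  also have "\<dots> = pair2 H C g t * a"
    unfolding pair2_eq
    by (rule linear_on_lin_ext[of H "scl H" "\<lambda>x. x * a", symmetric]) (simp_all add: linear_on_H distrib_right scl_mult_left)
  finally show ?thesis .
qed

text \<open>As (Xa)(Y(m)n) = X(aY(m)n), the pairing respects balancing also in its vector field
  slot.\<close>

lemma pair_word_hten_VF:
  assumes A: "A \<in> carr DV" and B: "B \<in> carr DV" and t: "t \<in> carr (hpow M 2)"
  shows "lin_ext (scl H) (hten (VF H C) [A, B]) (\<lambda>W. pair_word (W ! 0) (W ! 1) t) = pair_word A B t"
proof -
  let ?f = "\<lambda>W. pair_word (W ! 0) (W ! 1) t"
  have "lin_ext (scl H) (hten (VF H C) [A, B]) ?f = ?f [A, B]"
  proof (rule lin_ext_hten2[OF vs_H])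
    fix Y assume Y: "Y \<in> carr (VF H C)"
    show "linear_on (VF H C) (scl H) (\<lambda>X. ?f [X, Y])"
      unfolding linear_on_def pair_word_def lin_ext_fun_add[OF vs_H, symmetric] lin_ext_fun_scale[OF vs_H, symmetric]
      using t Y by (auto intro!: lin_ext_words2_cong simp: dual_simps)
    show "linear_on (VF H C) (scl H) (\<lambda>X. ?f [Y, X])"
      unfolding linear_on_def pair_word_def lin_ext_fun_add[OF vs_H, symmetric] lin_ext_fun_scale[OF vs_H, symmetric]
      using t Y by (auto intro!: lin_ext_words2_cong simp: dual_simps lact_add lact_scale DV_apply(1,3))
    fix X a assume "X \<in> carr (VF H C)"
    then show "?f [ract (VF H C) X a, Y] = ?f [X, lact (VF H C) a Y]"
      unfolding pair_word_def
      using t Y by (auto intro!: lin_ext_words2_cong simp: dual_simps lact_lact)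
  qed
  then show ?thesis by simp
qed

lemma pair_word_acts:
  assumes X: "X \<in> carr DV" and Y: "Y \<in> carr DV" and m: "m \<in> carr M" "n \<in> carr M"
  shows "pair_word (ract (VF H C) (lact (VF H C) a Y) b) (ract (VF H C) (lact (VF H C) c X) d) (hten M [m, n]) =
    a * Y ((b * c * X (d \<rhd> m)) \<rhd> n)"
  using assms by (subst pair_word_hten) (simp_all add: dual_simps lact_lact mult.assoc)

section \<open>Coactions of vector fields by means of a dual basis\<close>

context
  fixes I :: "'i set" and e :: "'i \<Rightarrow> 'w" and f :: "'i \<Rightarrow> 'w \<Rightarrow> 'h"
  assumes e [simp]: "\<And>i. i \<in> I \<Longrightarrow> e i \<in> carr M" and f [simp]: "\<And>i. i \<in> I \<Longrightarrow> f i \<in> carr DV"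
    and dual_basis: "\<And>m. m \<in> carr M \<Longrightarrow> m = (\<Sum>i\<in>I. e i \<lhd> f i m)"
begin

lemma DV_expand:
  assumes X: "X \<in> carr DV"
  shows "X = (\<Sum>i\<in>I. (\<lambda>m. X (e i) * f i m))"
proof
  fix m
  show "X m = (\<Sum>i\<in>I. (\<lambda>m. X (e i) * f i m)) m"
  proof (cases "m \<in> carr M")
    case True
    have "X m = X (\<Sum>i\<in>I. e i \<lhd> f i m)" by (subst dual_basis[OF True]) simp
    also have "\<dots> = (\<Sum>i\<in>I. X (e i \<lhd> f i m))"
      by (rule linear_on_sum[OF is_vs_M DV_apply(5)[OF X]]) simp
    also have "\<dots> = (\<Sum>i\<in>I. X (e i) * f i m)"
      by (intro sum.cong refl) (simp add: DV_apply(2)[OF X])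
    finally show ?thesis by (simp add: sum_fun_apply)
  next
    case False
    then show ?thesis using f X by (simp add: sum_fun_apply DV_apply(4))
  qed
qed

text \<open>Each Y equals the sum of the Y(e_i)f_i, so a tensor is rebuilt from its evaluations at
  the e_i. This is the uniqueness behind the definite description of the coaction.\<close>

lemma tsp_H_DV_expand:
  assumes t: "t \<in> carr (tsp H DV)"
  shows "t = (\<Sum>i\<in>I. plin (plin t (\<lambda>(h, Y). ten H H h (Y (e i)))) (\<lambda>(h, k). ten H DV h (\<lambda>m. k * f i m)))"
proof -
  have l: "linear_on DV pscale (ten H DV h)" for h
    by (simp add: linear_on_def ten_DV_lin)
  have E: "ten H DV h Y = (\<Sum>i\<in>I. plin (ten H H h (Y (e i))) (\<lambda>(h, k). ten H DV h (\<lambda>m. k * f i m)))"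
    if Y: "Y \<in> carr DV" for h Y
  proof -
    have "ten H DV h Y = (\<Sum>i\<in>I. ten H DV h (\<lambda>m. Y (e i) * f i m))"
      by (subst DV_expand[OF Y]) (rule linear_on_sum[OF is_vs_DV l], simp)
    also have "\<dots> = (\<Sum>i\<in>I. plin (ten H H h (Y (e i))) (\<lambda>(h, k). ten H DV h (\<lambda>m. k * f i m)))"
      by (intro sum.cong refl lin_ext_ten_H[symmetric])
        (simp_all add: linear_on_H ten_DV_lin DV_smul scl_mult_left)
    finally show ?thesis .
  qed
  have "plin t (\<lambda>(h, Y). ten H DV h Y) =
    plin t (\<lambda>(h, Y). \<Sum>i\<in>I. plin (ten H H h (Y (e i))) (\<lambda>(h, k). ten H DV h (\<lambda>m. k * f i m)))" (is "plin t ?L = plin t ?R")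
  proof (intro lin_ext_cong refl)
    fix p assume "p \<in> Poly_Mapping.keys t"
    then obtain h Y where p: "p = (h, Y)" "Y \<in> carr DV"
      using tsp_keys[OF is_vs_H is_vs_DV t] by (cases p) blast
    show "?L p = ?R p" unfolding p(1) prod.case by (rule E[OF p(2)])
  qed
  then show ?thesis
    using tsp_expand[OF t] lin_ext_fun_sum[OF vs_pscale, of t "\<lambda>i (h, Y). plin (ten H H h (Y (e i))) (\<lambda>(h, k). ten H DV h (\<lambda>m. k * f i m))" I]
    by (simp add: lin_ext_plin split_def)
qed

lemma tsp_DV_H_expand:
  assumes t: "t \<in> carr (tsp DV H)"
  shows "t = (\<Sum>i\<in>I. plin (plin t (\<lambda>(Y, h). ten H H (Y (e i)) h)) (\<lambda>(k, h). ten DV H (\<lambda>m. k * f i m) h))"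
proof -
  have l: "linear_on DV pscale (\<lambda>Y. ten DV H Y h)" for h
    by (simp add: linear_on_def ten_DV_lin)
  have E: "ten DV H Y h = (\<Sum>i\<in>I. plin (ten H H (Y (e i)) h) (\<lambda>(k, h). ten DV H (\<lambda>m. k * f i m) h))"
    if Y: "Y \<in> carr DV" for h Y
  proof -
    have "ten DV H Y h = (\<Sum>i\<in>I. ten DV H (\<lambda>m. Y (e i) * f i m) h)"
      by (subst DV_expand[OF Y]) (rule linear_on_sum[OF is_vs_DV l], simp)
    also have "\<dots> = (\<Sum>i\<in>I. plin (ten H H (Y (e i)) h) (\<lambda>(k, h). ten DV H (\<lambda>m. k * f i m) h))"
      by (intro sum.cong refl lin_ext_ten_H[symmetric])
        (simp_all add: linear_on_H ten_DV_lin DV_smul scl_mult_left)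
    finally show ?thesis .
  qed
  have "plin t (\<lambda>(Y, h). ten DV H Y h) =
    plin t (\<lambda>(Y, h). \<Sum>i\<in>I. plin (ten H H (Y (e i)) h) (\<lambda>(k, h). ten DV H (\<lambda>m. k * f i m) h))" (is "plin t ?L = plin t ?R")
  proof (intro lin_ext_cong refl)
    fix p assume "p \<in> Poly_Mapping.keys t"
    then obtain h Y where p: "p = (Y, h)" "Y \<in> carr DV"
      using tsp_keys[OF is_vs_DV is_vs_H t] by (cases p) blast
    show "?L p = ?R p" unfolding p(1) prod.case by (rule E[OF p(2)])
  qed
  then show ?thesis
    using tsp_expand[OF t] lin_ext_fun_sum[OF vs_pscale, of t "\<lambda>i (Y, h). plin (ten H H (Y (e i)) h) (\<lambda>(k, h). ten DV H (\<lambda>m. k * f i m) h)" I]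
    by (simp add: lin_ext_plin split_def)
qed

text \<open>The candidate is forced: multiply f_i by the second leg of the prescribed value at e_i
  and sum over i. Right linearity of \<open>L\<close> then gives the prescribed value at every
  e_if_i(m), hence at m.\<close>

lemma dual_lcoact_ex:
  assumes l: "linear_on M pscale L" and L: "\<And>m. m \<in> carr M \<Longrightarrow> L m \<in> carr (tsp H H)"
    and r: "\<And>m a. m \<in> carr M \<Longrightarrow> L (m \<lhd> a) = plin (L m) (\<lambda>(h, k). ten H H h (k * a))"
  defines "T \<equiv> THE t. t \<in> carr (tsp H DV) \<and> (\<forall>m\<in>carr M. plin t (\<lambda>(h, Y). ten H H h (Y m)) = L m)"
  shows "T \<in> carr (tsp H DV)" "m \<in> carr M \<Longrightarrow> plin T (\<lambda>(h, Y). ten H H h (Y m)) = L m"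
proof -
  let ?P = "\<lambda>t. t \<in> carr (tsp H DV) \<and> (\<forall>m\<in>carr M. plin t (\<lambda>(h, Y). ten H H h (Y m)) = L m)"
  define t where "t = (\<Sum>i\<in>I. plin (L (e i)) (\<lambda>(h, k). ten H DV h (\<lambda>m. k * f i m)))"
  have "t \<in> carr (tsp H DV)"
    unfolding t_def
    by (intro is_vs_sum tsp_is_vs lin_ext_closed[where V = "tsp H DV" for V, simplified]) auto
  moreover have "plin t (\<lambda>(h, Y). ten H H h (Y m)) = L m" if m: "m \<in> carr M" for m
  proof -
    have "plin t (\<lambda>(h, Y). ten H H h (Y m)) =
      (\<Sum>i\<in>I. plin (L (e i)) (\<lambda>(h, k). plin (ten H DV h (\<lambda>m. k * f i m)) (\<lambda>(h, Y). ten H H h (Y m))))"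
      by (simp add: t_def lin_ext_sum lin_ext_plin split_def)
    also have "\<dots> = (\<Sum>i\<in>I. plin (L (e i)) (\<lambda>(h, k). ten H H h (k * f i m)))"
      by (intro sum.cong refl lin_ext_cong) (simp add: split_def lin_ext_ten_HDV(1)[OF vs_pscale, of "ten H H", unfolded split_def] linear_on_H ten_HH_lin)
    also have "\<dots> = (\<Sum>i\<in>I. L (e i \<lhd> f i m))"
      by (intro sum.cong refl) (simp add: r)
    also have "\<dots> = L (\<Sum>i\<in>I. e i \<lhd> f i m)"
      by (rule linear_on_sum[OF is_vs_M l, symmetric]) simp
    finally show ?thesis by (simp add: dual_basis[OF m, symmetric])
  qed
  ultimately have "?P t" by blast
  moreover have "u = t" if "?P u" for u
    using tsp_H_DV_expand[of u] that unfolding t_def by simp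
  ultimately have "?P T" unfolding T_def by (rule theI)
  then show "T \<in> carr (tsp H DV)" "m \<in> carr M \<Longrightarrow> plin T (\<lambda>(h, Y). ten H H h (Y m)) = L m" by auto
qed

lemma dual_rcoact_ex:
  assumes l: "linear_on M pscale L" and L: "\<And>m. m \<in> carr M \<Longrightarrow> L m \<in> carr (tsp H H)"
    and r: "\<And>m a. m \<in> carr M \<Longrightarrow> L (m \<lhd> a) = plin (L m) (\<lambda>(k, h). ten H H (k * a) h)"
  defines "T \<equiv> THE t. t \<in> carr (tsp DV H) \<and> (\<forall>m\<in>carr M. plin t (\<lambda>(Y, h). ten H H (Y m) h) = L m)"
  shows "T \<in> carr (tsp DV H)" "m \<in> carr M \<Longrightarrow> plin T (\<lambda>(Y, h). ten H H (Y m) h) = L m"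
proof -
  let ?P = "\<lambda>t. t \<in> carr (tsp DV H) \<and> (\<forall>m\<in>carr M. plin t (\<lambda>(Y, h). ten H H (Y m) h) = L m)"
  define t where "t = (\<Sum>i\<in>I. plin (L (e i)) (\<lambda>(k, h). ten DV H (\<lambda>m. k * f i m) h))"
  have "t \<in> carr (tsp DV H)"
    unfolding t_def
    by (intro is_vs_sum tsp_is_vs lin_ext_closed[where V = "tsp DV H" for V, simplified]) auto
  moreover have "plin t (\<lambda>(Y, h). ten H H (Y m) h) = L m" if m: "m \<in> carr M" for m
  proof -
    have "plin t (\<lambda>(Y, h). ten H H (Y m) h) =
      (\<Sum>i\<in>I. plin (L (e i)) (\<lambda>(k, h). plin (ten DV H (\<lambda>m. k * f i m) h) (\<lambda>(Y, h). ten H H (Y m) h)))"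
      by (simp add: t_def lin_ext_sum lin_ext_plin split_def)
    also have "\<dots> = (\<Sum>i\<in>I. plin (L (e i)) (\<lambda>(k, h). ten H H (k * f i m) h))"
      by (intro sum.cong refl lin_ext_cong) (simp add: split_def lin_ext_ten_HDV(2)[OF vs_pscale, of "ten H H", unfolded split_def] linear_on_H ten_HH_lin)
    also have "\<dots> = (\<Sum>i\<in>I. L (e i \<lhd> f i m))"
      by (intro sum.cong refl) (simp add: r)
    also have "\<dots> = L (\<Sum>i\<in>I. e i \<lhd> f i m)"
      by (rule linear_on_sum[OF is_vs_M l, symmetric]) simp
    finally show ?thesis by (simp add: dual_basis[OF m, symmetric])
  qed
  ultimately have "?P t" by blast
  moreover have "u = t" if "?P u" for u
    using tsp_DV_H_expand[of u] that unfolding t_def by simp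
  ultimately have "?P T" unfolding T_def by (rule theI)
  then show "T \<in> carr (tsp DV H)" "m \<in> carr M \<Longrightarrow> plin T (\<lambda>(Y, h). ten H H (Y m) h) = L m" by auto
qed

text \<open>For ma the prescribed value contains x_1a_2S^{-1}(a_1)S^{-1}(m_{-1}) with x = X(m_0);
  these legs of a cancel, which is the right linearity that existence demands. Thereafter the
  coaction can be evaluated under any bilinear \<open>G\<close>.\<close>

lemma dual_lcoact:
  assumes X: "X \<in> carr DV"
  shows "lcoact (VF H C) X \<in> carr (tsp H DV)"
    and "vector_space s \<Longrightarrow> (\<And>y. linear_on H s (\<lambda>x. G x y)) \<Longrightarrow> (\<And>x. linear_on H s (G x)) \<Longrightarrow> m \<in> carr M \<Longrightarrow>
      lin_ext s (lcoact (VF H C) X) (\<lambda>(h, Z). G h (Z m)) =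
      lsum s m (\<lambda>h m0. csum s (X m0) (\<lambda>a1 a2. G (a1 * Si h) a2))"
proof -
  define L where "L m = lsum pscale m (\<lambda>h m0. csum pscale (X m0) (\<lambda>a1 a2. ten H H (a1 * Si h) a2))" for m
  have T: "lcoact (VF H C) X = (THE t. t \<in> carr (tsp H DV) \<and> (\<forall>m\<in>carr M. plin t (\<lambda>(h, Y). ten H H h (Y m)) = L m))"
    by (simp add: dual_bibimodule_def L_def lsum_def csum_def)
  note Xl = DV_apply(1-3)[OF X]
  have l: "linear_on M pscale L"
    by (simp add: L_def linM)
  have c: "L m \<in> carr (tsp H H)" if "m \<in> carr M" for m
    unfolding L_def using that
    by (intro lsum_closed[where V = "tsp H H", simplified] csum_closed[where V = "tsp H H", simplified]) auto
  have r: "L (m \<lhd> a) = plin (L m) (\<lambda>(h, k). ten H H h (k * a))" if m: "m \<in> carr M" for m a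
  proof -
    have "L (m \<lhd> a) = lsum pscale m (\<lambda>h m0. csum pscale a (\<lambda>a1 a2. csum pscale (X (m0 \<lhd> a2)) (\<lambda>x1 x2. ten H H (x1 * Si (h * a1)) x2)))"
      unfolding L_def by (rule lsum_act) (simp_all add: linM m Xl ten_HH_lin)
    also have "\<dots> = lsum pscale m (\<lambda>h m0. csum pscale (X m0) (\<lambda>x1 x2. ten H H (x1 * Si h) (x2 * a)))"
    proof (rule lsum_cong[OF refl m])
      fix h m0 assume m0: "m0 \<in> carr M"
      have "csum pscale (X (m0 \<lhd> a2)) (\<lambda>x1 x2. ten H H (x1 * Si (h * a1)) x2) =
        csum pscale (X m0) (\<lambda>x1 x2. csum pscale a2 (\<lambda>b1 b2. ten H H (x1 * b1 * Si (h * a1)) (x2 * b2)))" for a1 a2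
        using m0 by (simp add: Xl) (subst csum_mult; simp add: linM ten_HH_lin)
      then have "csum pscale a (\<lambda>a1 a2. csum pscale (X (m0 \<lhd> a2)) (\<lambda>x1 x2. ten H H (x1 * Si (h * a1)) x2)) =
         csum pscale (X m0) (\<lambda>x1 x2. csum pscale a (\<lambda>a1 a2. csum pscale a2 (\<lambda>b1 b2. ten H H (x1 * (b1 * Si a1) * Si h) (x2 * b2))))"
        by (simp add: Si_mult mult.assoc csum_swap[OF vs_pscale, of a "X m0"])
      also have "\<dots> = csum pscale (X m0) (\<lambda>x1 x2. ten H H (x1 * 1 * Si h) (x2 * a))"
        by (subst csum_cancel_Si_right(1)[where F = "\<lambda>z b. ten H H (x1 * z * Si h) (x2 * b)" for x1 x2]) (simp_all add: linM ten_HH_lin)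
      finally show "csum pscale a (\<lambda>a1 a2. csum pscale (X (m0 \<lhd> a2)) (\<lambda>x1 x2. ten H H (x1 * Si (h * a1)) x2)) =
         csum pscale (X m0) (\<lambda>x1 x2. ten H H (x1 * Si h) (x2 * a))" by simp
    qed
    also have "\<dots> = plin (L m) (\<lambda>(h, k). ten H H h (k * a))"
      using lin_ext_ten_H[of pscale "\<lambda>h k. ten H H h (k * a)"]
      by (simp add: L_def lin_ext_lsum lin_ext_csum linM ten_HH_lin)
    finally show ?thesis .
  qed
  note ex = dual_lcoact_ex[of L, OF l c r, folded T]
  show "lcoact (VF H C) X \<in> carr (tsp H DV)" using ex(1) by simp
  assume s: "vector_space s" and G: "\<And>y. linear_on H s (\<lambda>x. G x y)" "\<And>x. linear_on H s (G x)" and m: "m \<in> carr M"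
  have "lin_ext s (plin (lcoact (VF H C) X) (\<lambda>(h, Y). ten H H h (Y m))) (\<lambda>(h, k). G h k) =
    lin_ext s (L m) (\<lambda>(h, k). G h k)"
    using ex(2)[OF _ _ m] by simp
  then show "lin_ext s (lcoact (VF H C) X) (\<lambda>(h, Z). G h (Z m)) =
      lsum s m (\<lambda>h m0. csum s (X m0) (\<lambda>a1 a2. G (a1 * Si h) a2))"
    using lin_ext_ten_H[OF s G]
    by (simp add: L_def lin_ext_lsum[OF s] lin_ext_csum[OF s] lin_ext_plin[OF s] split_def)
qed

text \<open>The mirror image: the cancelling pair is now a_2S(a_3), in front of S(m_1).\<close>

lemma dual_rcoact:
  assumes X: "X \<in> carr DV"
  shows "rcoact (VF H C) X \<in> carr (tsp DV H)"
    and "vector_space s \<Longrightarrow> (\<And>y. linear_on H s (\<lambda>x. G x y)) \<Longrightarrow> (\<And>x. linear_on H s (G x)) \<Longrightarrow> m \<in> carr M \<Longrightarrow>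
      lin_ext s (rcoact (VF H C) X) (\<lambda>(Z, h). G (Z m) h) =
      rsum s m (\<lambda>m0 h. csum s (X m0) (\<lambda>a1 a2. G a1 (a2 * S h)))"
proof -
  define L where "L m = rsum pscale m (\<lambda>m0 h. csum pscale (X m0) (\<lambda>a1 a2. ten H H a1 (a2 * S h)))" for m
  have T: "rcoact (VF H C) X = (THE t. t \<in> carr (tsp DV H) \<and> (\<forall>m\<in>carr M. plin t (\<lambda>(Y, h). ten H H (Y m) h) = L m))"
    by (simp add: dual_bibimodule_def L_def rsum_def csum_def)
  note Xl = DV_apply(1-3)[OF X]
  have l: "linear_on M pscale L"
    by (simp add: L_def linM)
  have c: "L m \<in> carr (tsp H H)" if "m \<in> carr M" for m
    unfolding L_def using that
    by (intro rsum_closed[where V = "tsp H H", simplified] csum_closed[where V = "tsp H H", simplified]) auto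
  have r: "L (m \<lhd> a) = plin (L m) (\<lambda>(k, h). ten H H (k * a) h)" if m: "m \<in> carr M" for m a
  proof -
    have "L (m \<lhd> a) = rsum pscale m (\<lambda>m0 h. csum pscale a (\<lambda>a1 a2. csum pscale (X (m0 \<lhd> a1)) (\<lambda>x1 x2. ten H H x1 (x2 * S (h * a2)))))"
      unfolding L_def by (rule rsum_act) (simp_all add: linM m Xl ten_HH_lin)
    also have "\<dots> = rsum pscale m (\<lambda>m0 h. csum pscale (X m0) (\<lambda>x1 x2. ten H H (x1 * a) (x2 * S h)))"
    proof (rule rsum_cong[OF refl m])
      fix h m0 assume m0: "m0 \<in> carr M"
      have "csum pscale (X (m0 \<lhd> a1)) (\<lambda>x1 x2. ten H H x1 (x2 * S (h * a2))) =
        csum pscale (X m0) (\<lambda>x1 x2. csum pscale a1 (\<lambda>b1 b2. ten H H (x1 * b1) (x2 * b2 * S (h * a2))))" for a1 a2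
        using m0 by (simp add: Xl) (subst csum_mult; simp add: linM ten_HH_lin)
      then have "csum pscale a (\<lambda>a1 a2. csum pscale (X (m0 \<lhd> a1)) (\<lambda>x1 x2. ten H H x1 (x2 * S (h * a2)))) =
         csum pscale (X m0) (\<lambda>x1 x2. csum pscale a (\<lambda>a1 a2. csum pscale a1 (\<lambda>b1 b2. ten H H (x1 * b1) (x2 * (b2 * S a2) * S h))))"
        by (simp add: S_mult mult.assoc csum_swap[OF vs_pscale, of a "X m0"])
      also have "\<dots> = csum pscale (X m0) (\<lambda>x1 x2. ten H H (x1 * a) (x2 * 1 * S h))"
        by (subst csum_cancel_S_right(2)[where F = "\<lambda>b z. ten H H (x1 * b) (x2 * z * S h)" for x1 x2]) (simp_all add: linM ten_HH_lin)
      finally show "csum pscale a (\<lambda>a1 a2. csum pscale (X (m0 \<lhd> a1)) (\<lambda>x1 x2. ten H H x1 (x2 * S (h * a2)))) =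
         csum pscale (X m0) (\<lambda>x1 x2. ten H H (x1 * a) (x2 * S h))" by simp
    qed
    also have "\<dots> = plin (L m) (\<lambda>(k, h). ten H H (k * a) h)"
      using lin_ext_ten_H[of pscale "\<lambda>k h. ten H H (k * a) h"]
      by (simp add: L_def lin_ext_lsum lin_ext_csum linM ten_HH_lin)
    finally show ?thesis .
  qed
  note ex = dual_rcoact_ex[of L, OF l c r, folded T]
  show "rcoact (VF H C) X \<in> carr (tsp DV H)" using ex(1) by simp
  assume s: "vector_space s" and G: "\<And>y. linear_on H s (\<lambda>x. G x y)" "\<And>x. linear_on H s (G x)" and m: "m \<in> carr M"
  have "lin_ext s (plin (rcoact (VF H C) X) (\<lambda>(Y, h). ten H H (Y m) h)) (\<lambda>(h, k). G h k) =
    lin_ext s (L m) (\<lambda>(h, k). G h k)"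
    using ex(2)[OF _ _ m] by simp
  then show "lin_ext s (rcoact (VF H C) X) (\<lambda>(Z, h). G (Z m) h) =
      rsum s m (\<lambda>m0 h. csum s (X m0) (\<lambda>a1 a2. G a1 (a2 * S h)))"
    using lin_ext_ten_H[OF s G]
    by (simp add: L_def lin_ext_lsum[OF s] lin_ext_csum[OF s] lin_ext_plin[OF s] split_def)
qed

text \<open>The shape \<open>F X\<^sub>-\<^sub>2 X\<^sub>-\<^sub>1 X\<^sub>0 Y\<^sub>0 Y\<^sub>1 Y\<^sub>2\<close> of the braiding of vector fields.\<close>

definition dual_sum :: "('w \<Rightarrow> 'h) \<Rightarrow> ('w \<Rightarrow> 'h) \<Rightarrow>
    ('h \<Rightarrow> 'h \<Rightarrow> ('w \<Rightarrow> 'h) \<Rightarrow> ('w \<Rightarrow> 'h) \<Rightarrow> 'h \<Rightarrow> 'h \<Rightarrow> 'h) \<Rightarrow> 'h" where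
  "dual_sum X Y F = lin_ext (scl H) (lcoact (VF H C) X) (\<lambda>(h, X0). csum (scl H) h (\<lambda>h2 h1.
     lin_ext (scl H) (rcoact (VF H C) Y) (\<lambda>(Y0, c). csum (scl H) c (\<lambda>n1 n2. F h2 h1 X0 Y0 n1 n2))))"

lemma dual_sum_cong:
  assumes X: "X \<in> carr DV" and Y: "Y \<in> carr DV"
    and eq: "\<And>h2 h1 X0 Y0 n1 n2. X0 \<in> carr DV \<Longrightarrow> Y0 \<in> carr DV \<Longrightarrow> F h2 h1 X0 Y0 n1 n2 = G h2 h1 X0 Y0 n1 n2"
  shows "dual_sum X Y F = dual_sum X Y G"
  unfolding dual_sum_def csum_def
  using tsp_keys[OF is_vs_H is_vs_DV dual_lcoact(1)[OF X]] tsp_keys[OF is_vs_DV is_vs_H dual_rcoact(1)[OF Y]]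
  by (auto intro!: lin_ext_cong eq)

text \<open>The coaction of X is evaluated at n_2w with w left coinvariant, that of Y at v, which is
  right coinvariant. Two cancellations remain: S(n_1) against a leg of n_2, leaving
  X(c_2w)S^{-1}(c_1)Y_0(v) with c = Y_1, and then S^{-1}(y_2)y_1 with y = Y(v).\<close>

lemma dual_braiding_word:
  assumes X: "X \<in> carr DV" and Y: "Y \<in> carr DV" and w: "w \<in> coL" and v: "v \<in> coR"
  shows "dual_sum X Y (\<lambda>h2 h1 X0 Y0 n1 n2. h2 * Y0 ((S n1 * S h1 * X0 (n2 \<rhd> w)) \<rhd> v)) = X (Y v \<rhd> w)"
proof -
  note Xl = DV_apply(1-3)[OF X] and Yl = DV_apply(1-3)[OF Y]
  have wc [simp]: "w \<in> carr M" and vc [simp]: "v \<in> carr M" using w v by simp_all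
  have "dual_sum X Y (\<lambda>h2 h1 X0 Y0 n1 n2. h2 * Y0 ((S n1 * S h1 * X0 (n2 \<rhd> w)) \<rhd> v)) =
    lin_ext (scl H) (rcoact (VF H C) Y) (\<lambda>(Y0, c). csum (scl H) c (\<lambda>n1 n2.
     lin_ext (scl H) (lcoact (VF H C) X) (\<lambda>(h, X0). csum (scl H) h (\<lambda>h2 h1.
       h2 * Y0 ((S n1 * S h1 * X0 (n2 \<rhd> w)) \<rhd> v)))))"
    by (simp add: dual_sum_def split_def csum_lin_ext_swap lin_ext_swap[of "scl H" "lcoact (VF H C) X"]
       csum_swap[of "scl H" "fst x" for x :: "'h \<times> ('w \<Rightarrow> 'h)"])
  also have "\<dots> = lin_ext (scl H) (rcoact (VF H C) Y) (\<lambda>(Y0, c). csum (scl H) c (\<lambda>a1 a2. X (a2 \<rhd> w) * Si a1 * Y0 v))"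
  proof (rule lin_ext_cong[OF refl])
    fix p assume "p \<in> Poly_Mapping.keys (rcoact (VF H C) Y)"
    then obtain Y0 c where p: "p = (Y0, c)" and Y0: "Y0 \<in> carr DV"
      using tsp_keys[OF is_vs_DV is_vs_H dual_rcoact(1)[OF Y]] by (cases p) blast
    note Y0l = DV_apply(1-3)[OF Y0]
    have inner: "lin_ext (scl H) (lcoact (VF H C) X) (\<lambda>(h, X0). csum (scl H) h (\<lambda>h2 h1.
       h2 * Y0 ((S n1 * S h1 * X0 (n2 \<rhd> w)) \<rhd> v))) =
       csum (scl H) n2 (\<lambda>u r. csum (scl H) r (\<lambda>a1 a2. X (a2 \<rhd> w) * Si a1 * Y0 ((S n1 * u) \<rhd> v)))" for n1 n2
    proof -
      \<comment> \<open>\<open>z\<close> takes the place of the value X_0(n_2w), on which the sum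
        depends linearly, so that the formula for the coaction of X applies.\<close>
      define G where "G h z = csum (scl H) h (\<lambda>h2 h1. h2 * Y0 ((S n1 * S h1 * z) \<rhd> v))" for h z
      have Gl: "linear_on H (scl H) (\<lambda>h. G h z)" "linear_on H (scl H) (G h)" for h z
        by (simp_all add: G_def linM Y0l)
      have Ge: "G (x + y) = (\<lambda>z. G x z + G y z)" "G (scl H c x) = (\<lambda>z. scl H c (G x z))" for x y c
        using Gl by (simp_all add: fun_eq_iff linear_on_H)
      have G: "csum (scl H) z (\<lambda>x1 x2. G (x1 * Si c1) x2) = csum (scl H) c1 (\<lambda>a1 a2. z * Si a2 * Y0 ((S n1 * a1) \<rhd> v))" for z c1
      proof -
        have 1: "csum (scl H) (Si c1) (\<lambda>r t. p * (r * Y0 ((S n1 * (S t * x2)) \<rhd> v))) =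
           csum (scl H) c1 (\<lambda>a1 a2. p * (Si a2 * Y0 ((S n1 * (a1 * x2)) \<rhd> v)))" for p x2
          by (subst csum_Si) (simp_all add: linM Y0l)
        have "G (x1 * Si c1) x2 = csum (scl H) x1 (\<lambda>p q. csum (scl H) (Si c1) (\<lambda>r t. p * r * Y0 ((S n1 * S (q * t) * x2) \<rhd> v)))" for x1 x2
          unfolding G_def by (rule csum_mult) (simp_all add: linM Y0l)
        then have "csum (scl H) z (\<lambda>x1 x2. G (x1 * Si c1) x2) = csum (scl H) z (\<lambda>x1 x2. csum (scl H) x1 (\<lambda>p q.
            csum (scl H) c1 (\<lambda>a1 a2. p * Si a2 * Y0 ((S n1 * a1 * (S q * x2)) \<rhd> v))))"
          by (simp add: 1 S_mult mult.assoc)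
        also have "\<dots> = csum (scl H) c1 (\<lambda>a1 a2. z * Si a2 * Y0 ((S n1 * a1 * 1) \<rhd> v))"
          by (rule csum_cancel_S_left(2)[where F = "\<lambda>p z. csum (scl H) c1 (\<lambda>a1 a2. p * Si a2 * Y0 ((S n1 * a1 * z) \<rhd> v))"])
            (simp_all add: linM Y0l)
        finally show ?thesis by simp
      qed
      have "lin_ext (scl H) (lcoact (VF H C) X) (\<lambda>(h, X0). csum (scl H) h (\<lambda>h2 h1. h2 * Y0 ((S n1 * S h1 * X0 (n2 \<rhd> w)) \<rhd> v))) =
        lin_ext (scl H) (lcoact (VF H C) X) (\<lambda>(h, X0). G h (X0 (n2 \<rhd> w)))"
        by (simp add: G_def)
      also have "\<dots> = lsum (scl H) (n2 \<rhd> w) (\<lambda>h m0. csum (scl H) (X m0) (\<lambda>a1 a2. G (a1 * Si h) a2))"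
        by (rule dual_lcoact(2)[OF X]) (simp_all add: Gl)
      also have "\<dots> = csum (scl H) n2 (\<lambda>c1 c2. lsum (scl H) w (\<lambda>h m0. csum (scl H) (X (c2 \<rhd> m0)) (\<lambda>a1 a2. G (a1 * Si (c1 * h)) a2)))"
        using Gl(2) by (intro lsum_act) (simp_all add: linM Xl Ge)
      also have "\<dots> = csum (scl H) n2 (\<lambda>c1 c2. csum (scl H) (X (c2 \<rhd> w)) (\<lambda>a1 a2. G (a1 * Si c1) a2))"
        using Gl(2) w by (subst lsum_coL) (simp_all add: linM Xl Ge)
      also have "\<dots> = csum (scl H) n2 (\<lambda>c1 c2. csum (scl H) c1 (\<lambda>a1 a2. X (c2 \<rhd> w) * Si a2 * Y0 ((S n1 * a1) \<rhd> v)))"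
        by (simp add: G)
      also have "\<dots> = csum (scl H) n2 (\<lambda>u r. csum (scl H) r (\<lambda>a1 a2. X (a2 \<rhd> w) * Si a1 * Y0 ((S n1 * u) \<rhd> v)))"
        by (rule csum_coassoc) (simp_all add: linM Xl Y0l)
      finally show ?thesis .
    qed
    \<comment> \<open>The first cancellation: S(n_1) meets the next leg u of the same
      element.\<close>
    have "csum (scl H) c (\<lambda>n1 n2. csum (scl H) n2 (\<lambda>u r. csum (scl H) r (\<lambda>a1 a2. X (a2 \<rhd> w) * Si a1 * Y0 ((S n1 * u) \<rhd> v)))) =
      csum (scl H) c (\<lambda>a1 a2. X (a2 \<rhd> w) * Si a1 * Y0 (1 \<rhd> v))"
      by (rule csum_cancel_S_left(1)[where F = "\<lambda>z r. csum (scl H) r (\<lambda>a1 a2. X (a2 \<rhd> w) * Si a1 * Y0 (z \<rhd> v))"])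
        (simp_all add: linM Xl Y0l)
    then show "(case p of (Y0, c) \<Rightarrow> csum (scl H) c (\<lambda>n1 n2.
         lin_ext (scl H) (lcoact (VF H C) X) (\<lambda>(h, X0). csum (scl H) h (\<lambda>h2 h1. h2 * Y0 ((S n1 * S h1 * X0 (n2 \<rhd> w)) \<rhd> v))))) =
      (case p of (Y0, c) \<Rightarrow> csum (scl H) c (\<lambda>a1 a2. X (a2 \<rhd> w) * Si a1 * Y0 v))"
      by (simp add: p inner)
  qed
  also have "\<dots> = rsum (scl H) v (\<lambda>m0 h. csum (scl H) (Y m0) (\<lambda>b1 b2. csum (scl H) (b2 * S h) (\<lambda>a1 a2. X (a2 \<rhd> w) * Si a1 * b1)))"
    by (rule dual_rcoact(2)[OF Y, where G = "\<lambda>z c. csum (scl H) c (\<lambda>a1 a2. X (a2 \<rhd> w) * Si a1 * z)"])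
      (simp_all add: linM Xl)
  also have "\<dots> = csum (scl H) (Y v) (\<lambda>b1 b2. csum (scl H) b2 (\<lambda>a1 a2. X (a2 \<rhd> w) * (Si a1 * b1)))"
    using v by (subst rsum_coR) (simp_all add: linM Yl)
  also have "\<dots> = X (Y v \<rhd> w) * 1"
    by (rule csum_cancel_Si_left(1)[where F = "\<lambda>z a2. X (a2 \<rhd> w) * z"]) (simp_all add: linM Xl)
  finally show ?thesis by simp
qed

text \<open>The pairing is right linear, so the coefficient \<open>k\<close> can be split off; on w
  \<otimes> v the computation for words gives \<langle>\<sigma>g, w \<otimes> v\<rangle> =
  \<langle>g, v \<otimes> w\<rangle>.\<close>

lemma pair2_braiding:
  assumes g: "g \<in> carr (hpow (VF H C) 2)" "braiding H (VF H C) g = g" and t: "t \<in> carr (hpow M 2)"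
  shows "pair2 H C g t = pair2 H C g (braiding H M t)"
proof (rule hpow2_eqI_LR[OF pair2_linear linear_on_comp[where n = 2, OF braiding_linear _ pair2_linear] t])
  fix w v k assume w: "w \<in> coL" and v: "v \<in> coR"
  let ?P = "\<lambda>h2 h1 X0 Y0 n1 n2. lin_ext (scl H)
    (hten (VF H C) [ract (VF H C) (lact (VF H C) h2 Y0) (S n1), ract (VF H C) (lact (VF H C) (S h1) X0) n2])
    (\<lambda>W. pair_word (W ! 0) (W ! 1) (hten M [w, v]))"
  have word: "dual_sum (W ! 0) (W ! 1) ?P = pair_word (W ! 0) (W ! 1) (hten M [v, w])"
    if W: "W \<in> Poly_Mapping.keys g" for W
  proof -
    obtain X Y where X: "X \<in> carr DV" and Y: "Y \<in> carr DV" and W: "W = [X, Y]" using keys_VF[OF g(1) W] .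
    have l: "lact (VF H C) a Z \<in> carr DV" if "Z \<in> carr DV" for a Z
      using that by (simp add: dual_simps)
    have "dual_sum X Y ?P = dual_sum X Y (\<lambda>h2 h1 X0 Y0 n1 n2. h2 * Y0 ((S n1 * S h1 * X0 (n2 \<rhd> w)) \<rhd> v))"
      using l v w
      by (intro dual_sum_cong X Y) (simp only: pair_word_hten_VF DV_ract hten_closed' coL_carr coR_carr pair_word_acts)
    then show ?thesis
      using X Y v w by (simp add: W dual_braiding_word pair_word_hten)
  qed
  have "pair2 H C (braiding H (VF H C) g) (hten M [w, v]) = lin_ext (scl H) g (\<lambda>W. dual_sum (W ! 0) (W ! 1) ?P)"
    by (simp only: pair2_eq braiding_def dual_sum_def csum_def lin_ext_plin[OF vs_H] split_def)
  also have "\<dots> = pair2 H C g (hten M [v, w])"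
    unfolding pair2_eq by (rule lin_ext_cong[OF refl]) (rule word)
  finally have *: "pair2 H C (braiding H (VF H C) g) (hten M [w, v]) = pair2 H C g (hten M [v, w])" .
  have "hten M [w, v \<lhd> k] = hpow_ract M (hten M [w, v]) k" "hten M [v, w \<lhd> k] = hpow_ract M (hten M [v, w]) k"
    using w v by (simp_all add: hpow_ract_hten)
  then have "pair2 H C g (hten M [w, v \<lhd> k]) = pair2 H C g (hten M [v, w \<lhd> k])"
    using w v * g(2) by (simp add: pair2_ract[OF g(1)])
  then show "pair2 H C g (hten M [w, v \<lhd> k]) = pair2 H C g (braiding H M (hten M [w, v \<lhd> k]))"
    by (simp only: braiding_LR[OF w v])
qed simp

end

section \<open>Torsion-free connections\<close>

lemma wedge_linear: "linear_on (hpow M n) (wscl C) (wedge C)"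
  unfolding wedge_def[abs_def] by (rule linear_on_lin_ext_arg) simp_all

lemma carr_M: "carr M = grade C (Suc 0)" "scl M = wscl C"
  by (simp_all add: Omega1_simps)

lemma wedge_hten:
  assumes "x \<in> carr M" "y \<in> carr M"
  shows "wedge C (hten M [x, y]) = x * y"
  unfolding wedge_def
  by (subst lin_ext_hten2[of "wscl C" M])
    (simp_all add: linear_on_def Omega1_simps distrib_left distrib_right wscl_mult_left wscl_mult_right mult.assoc)

lemma wedge_ract:
  assumes t: "t \<in> carr (hpow M 2)"
  shows "wedge C (hpow_ract M t a) = wedge C t * emb C a"
proof (rule hpow_eqI[OF linear_on_comp[where n = 2, OF hpow_ract_linear _ wedge_linear] _ t])
  show "linear_on (hpow M 2) (wscl C) (\<lambda>t. wedge C t * emb C a)"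
    using wedge_linear[of 2] by (simp add: linear_on_def distrib_right wscl_mult_left)
  fix w assume "w \<in> words M 2"
  then show "wedge C (hpow_ract M (hten M w) a) = wedge C (hten M w) * emb C a"
    by (auto simp: words_2 hpow_ract_hten wedge_hten) (simp add: Omega1_simps mult.assoc)
qed simp

text \<open>In degree two the antisymmetriser is the identity minus the inverse braiding, whose
  kernel is the eigenspace for 1.\<close>

lemma wedge_eq_0_iff:
  assumes t: "t \<in> carr (hpow M 2)"
  shows "wedge C t = 0 \<longleftrightarrow> t \<in> sym_forms H C"
  using braided_exterior[of 2 t] t
  by (auto simp: antisymmetriser_2 sym_forms_def eigenspace_def vs_scale_simps)

lemma sym_forms_carr: "t \<in> sym_forms H C \<Longrightarrow> t \<in> carr (hpow M 2)"
  by (simp add: sym_forms_def eigenspace_def)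

text \<open>As the kernel of the right linear wedge product, the symmetric forms are a right
  submodule.\<close>

lemma sym_forms_ract: "t \<in> sym_forms H C \<Longrightarrow> hpow_ract M t a \<in> sym_forms H C"
  using wedge_eq_0_iff[of t] wedge_eq_0_iff[of "hpow_ract M t a"] by (simp add: sym_forms_carr wedge_ract)

text \<open>Two-forms are spanned by a db_1 \<and> db_2, each the product of the one-forms a db_1
  and db_2. This provides the values from which a torsion-free connection is built.\<close>

lemma wedge_surj:
  assumes "x \<in> grade C 2"
  shows "\<exists>t\<in>carr (hpow M 2). wedge C t = x"
proof -
  interpret vector_space "wscl C" by simp
  have "x \<in> span {emb C a * prod_list (map (\<lambda>b. dd C (emb C b)) bs) | a bs. length bs = 2}"
    using assms grade_spanned[of 2] by simp
  then show ?thesis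
  proof (induction rule: span_induct_alt)
    case base
    show ?case using is_vsD(2)[OF hpow_is_vs, of M 2] linear_on_0[OF hpow_is_vs wedge_linear[of 2]] by blast
  next
    case (step c z y)
    then obtain a b1 b2 where z: "z = (a \<rhd> da b1) * da b2"
      by (auto simp: length_Suc_conv numeral_2_eq_2 Omega1_simps mult.assoc)
    then have z: "z = wedge C (hten M [a \<rhd> da b1, da b2])"
      by (simp add: wedge_hten)
    obtain t where t: "t \<in> carr (hpow M 2)" "wedge C t = y" using step by blast
    let ?u = "scl (hpow M 2) c (hten M [a \<rhd> da b1, da b2])"
    have u: "?u \<in> carr (hpow M 2)" by (rule is_vsD(4)[OF hpow_is_vs]) simp
    moreover have "wedge C ?u = wscl C c z"
      using wedge_linear[of 2] by (simp add: linear_on_def z)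
    ultimately have u: "?u \<in> carr (hpow M 2)" "wedge C ?u = wscl C c z" .
    show ?case
      using is_vsD(3)[OF hpow_is_vs u(1) t(1)] wedge_linear[of 2] u t
      by (intro bexI[of _ "?u + t"]) (simp_all add: linear_on_def)
  qed
qed

section \<open>Connections built from a dual basis\<close>

lemma dd_right: "x \<in> carr M \<Longrightarrow> dd C (x \<lhd> a) = dd C x * emb C a - x * da a"
  using dd_Leibniz[of x 1 "emb C a"] by (simp add: Omega1_simps)

text \<open>What the Leibniz rule gives for the sum of the e_if_i(m) if \<open>E i\<close> is the
  value at e_i. For a dual basis that is not free, these values need not be attained.\<close>

definition basis_connection :: "'i set \<Rightarrow> ('i \<Rightarrow> 'w) \<Rightarrow> ('i \<Rightarrow> 'w \<Rightarrow> 'h) \<Rightarrow> ('i \<Rightarrow> ('w list \<Rightarrow>\<^sub>0 'k)) \<Rightarrow> 'w \<Rightarrow> ('w list \<Rightarrow>\<^sub>0 'k)" where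
  "basis_connection I e f E m =
    (if m \<in> carr M then \<Sum>i\<in>I. hpow_ract M (E i) (f i m) + hten M [e i, da (f i m)] else 0)"

context
  fixes I :: "'i set" and e :: "'i \<Rightarrow> 'w" and f :: "'i \<Rightarrow> 'w \<Rightarrow> 'h" and E :: "'i \<Rightarrow> ('w list \<Rightarrow>\<^sub>0 'k)"
  assumes e [simp]: "\<And>i. i \<in> I \<Longrightarrow> e i \<in> carr M" and f [simp]: "\<And>i. i \<in> I \<Longrightarrow> f i \<in> carr DV"
    and dual_basis: "\<And>m. m \<in> carr M \<Longrightarrow> m = (\<Sum>i\<in>I. e i \<lhd> f i m)"
    and E [simp]: "\<And>i. i \<in> I \<Longrightarrow> E i \<in> carr (hpow M 2)"
begin

abbreviation conn :: "'w \<Rightarrow> ('w list \<Rightarrow>\<^sub>0 'k)" where "conn \<equiv> basis_connection I e f E"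

lemma basis_connection: "right_connection H C conn"
  unfolding right_connection_def
proof (intro conjI ballI allI impI)
  have h: "hten M [e i, da (a + b)] = hten M [e i, da a] + hten M [e i, da b]"
    "hten M [e i, da (scl H c a)] = pscale c (hten M [e i, da a])" if "i \<in> I" for i a b c
    using that by (simp_all add: da_add da_scale hten_simps)
  have sc: "(\<Sum>i\<in>I. pscale c (g i)) = pscale c (\<Sum>i\<in>I. g i)" for c and g :: "'i \<Rightarrow> ('w list \<Rightarrow>\<^sub>0 'k)"
  proof -
    interpret vector_space "pscale :: 'k \<Rightarrow> ('w list \<Rightarrow>\<^sub>0 'k) \<Rightarrow> _" by simp
    show ?thesis by (simp add: scale_sum_right)
  qed
  show "lin_map M (hpow M 2) conn"
    unfolding lin_map_def
  proof (intro conjI ballI allI)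
    fix x assume x: "x \<in> carr M"
    show "conn x \<in> carr (hpow M 2)"
      using x by (auto simp: basis_connection_def intro!: is_vs_sum[OF hpow_is_vs] is_vsD(3)[OF hpow_is_vs])
    show "conn (scl M c x) = scl (hpow M 2) c (conn x)" for c
      using x by (simp add: basis_connection_def DV_apply(3) hpow_ract_simps h sc[symmetric] vs_scale_simps(1))
    fix y assume y: "y \<in> carr M"
    show "conn (x + y) = conn x + conn y"
      using x y by (simp add: basis_connection_def DV_apply(1) hpow_ract_simps h sum.distrib[symmetric] algebra_simps)
  qed
  fix m a assume m: "m \<in> carr M"
  have "conn (m \<lhd> a) = (\<Sum>i\<in>I. hpow_ract M (hpow_ract M (E i) (f i m)) a + hpow_ract M (hten M [e i, da (f i m)]) a + hten M [e i \<lhd> f i m, da a])"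
    using m by (simp add: basis_connection_def DV_apply(2) hpow_ract_simps da_mult hten_simps hpow_ract_hten hten_moves algebra_simps)
  also have "\<dots> = (\<Sum>i\<in>I. hpow_ract M (hpow_ract M (E i) (f i m) + hten M [e i, da (f i m)]) a) + (\<Sum>i\<in>I. hten M [e i \<lhd> f i m, da a])"
    using hpow_ract_linear[of 2 a] by (simp add: sum.distrib linear_on_def)
  also have "(\<Sum>i\<in>I. hpow_ract M (hpow_ract M (E i) (f i m) + hten M [e i, da (f i m)]) a) = hpow_ract M (conn m) a"
    using m by (simp add: basis_connection_def)
      (rule linear_on_sum[OF hpow_is_vs[of M 2] hpow_ract_linear, symmetric], auto intro!: is_vsD(3)[OF hpow_is_vs])
  also have "(\<Sum>i\<in>I. hten M [e i \<lhd> f i m, da a]) = hten M [m, da a]"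
  proof -
    have "linear_on M pscale (\<lambda>x. hten M [x, da a])" by (simp add: linT)
    from linear_on_sum[OF is_vs_M this, of I "\<lambda>i. e i \<lhd> f i m"] show ?thesis
      using dual_basis[OF m] by simp
  qed
  finally show "conn (m \<lhd> a) = hpow_ract M (conn m) a + hten M [m, da a]" .
qed (simp add: basis_connection_def)

text \<open>Summand by summand the wedge product is -(de_i)f_i(m) + e_i \<and> df_i(m) =
  -d(e_if_i(m)), so the condition on \<open>E i\<close> suffices even where the connection takes
  other values at e_i.\<close>

lemma basis_connection_torsion_free:
  assumes "\<And>i. i \<in> I \<Longrightarrow> wedge C (E i) = - dd C (e i)"
  shows "torsion_free H C conn"
  unfolding torsion_free_def
proof
  fix m assume m: "m \<in> carr M"
  have wl: "wedge C (s + t) = wedge C s + wedge C t" if "s \<in> carr (hpow M 2)" "t \<in> carr (hpow M 2)" for s t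
    using wedge_linear[of 2] that by (simp add: linear_on_def)
  have dl: "linear_on M (wscl C) (dd C)"
    by (simp add: linear_on_def dd_add dd_scale carr_M)
  have "wedge C (conn m) = (\<Sum>i\<in>I. wedge C (hpow_ract M (E i) (f i m) + hten M [e i, da (f i m)]))"
    using m by (simp add: basis_connection_def)
      (rule linear_on_sum[OF hpow_is_vs[of M 2] wedge_linear], auto intro!: is_vsD(3)[OF hpow_is_vs])
  also have "\<dots> = (\<Sum>i\<in>I. - dd C (e i \<lhd> f i m))"
    using assms by (intro sum.cong refl) (simp add: wl wedge_ract wedge_hten dd_right)
  also have "\<dots> = - dd C (\<Sum>i\<in>I. e i \<lhd> f i m)"
    by (subst linear_on_sum[OF is_vs_M dl]) (simp_all add: sum_negf)
  finally show "wedge C (conn m) + dd C m = 0"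
    by (simp add: dual_basis[OF m, symmetric])
qed

end

section \<open>Levi-Civita connections\<close>

lemma pair2_hten_balanced:
  assumes "g \<in> carr (hpow (VF H C) 2)" "x \<in> carr M" "y \<in> carr M"
  shows "pair2 H C g (hten M [x, y \<lhd> a]) = pair2 H C g (hten M [x, y]) * a"
  using pair2_ract[OF assms(1), of "hten M [x, y]" a] assms by (simp add: hpow_ract_hten)

lemma pair3_linear: "linear_on (hpow M 3) (wscl C) (pair3 H C g)"
  unfolding pair3_def[abs_def] by (rule linear_on_lin_ext_arg) simp_all

lemma pair3_hten:
  assumes g: "g \<in> carr (hpow (VF H C) 2)" and c: "x \<in> carr M" "y \<in> carr M" "z \<in> carr M"
  shows "pair3 H C g (hten M [x, y, z]) = pair2 H C g (hten M [x, y]) \<rhd> z"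
proof -
  note p = pair2_linear[of g, unfolded linear_on_def scl_hpow]
  have s: "wscl C = scl M" by (simp add: Omega1_simps)
  show ?thesis
    unfolding pair3_def s
    by (subst lin_ext_hten3[of "scl M" M])
      (use c in \<open>simp_all add: linM p hten_simps hten_moves pair2_hten_balanced[OF g]\<close>)
qed

lemma pair3_closed: "t \<in> carr (hpow M 3) \<Longrightarrow> pair3 H C g t \<in> carr M"
  unfolding pair3_def
  using lin_ext_words3_closed[of M t "\<lambda>w. pair2 H C g (hten M [w ! 0, w ! 1]) \<rhd> (w ! 2)"]
  by (simp add: Omega1_simps(2))

lemma pair3_ract:
  assumes g: "g \<in> carr (hpow (VF H C) 2)" and t: "t \<in> carr (hpow M 3)"
  shows "pair3 H C g (hpow_ract M t a) = pair3 H C g t \<lhd> a"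
proof (rule hpow_eqI[OF linear_on_comp[where n = 3, OF hpow_ract_linear _ pair3_linear] _ t])
  show "linear_on (hpow M 3) (wscl C) (\<lambda>t. pair3 H C g t \<lhd> a)"
    using pair3_linear[of g] by (simp add: linear_on_def Omega1_simps distrib_right wscl_mult_left)
  fix w assume "w \<in> words M 3"
  then show "pair3 H C g (hpow_ract M (hten M w) a) = pair3 H C g (hten M w) \<lhd> a"
    by (auto simp: words_3 hpow_ract_hten pair3_hten[OF g] lact_ract)
qed simp

lemma pair3_app:
  assumes g: "g \<in> carr (hpow (VF H C) 2)" and t: "t \<in> carr (hpow M 2)" and z: "z \<in> carr M"
  shows "pair3 H C g (hsnoc t z) = pair2 H C g t \<rhd> z"
proof (rule hpow_eqI[OF linear_on_comp[where n = 3, OF hsnoc_linear _ pair3_linear] _ t])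
  show "linear_on (hpow M 2) (wscl C) (\<lambda>t. pair2 H C g t \<rhd> z)"
    using pair2_linear[of g] z by (simp add: linear_on_def Omega1_simps emb_add emb_scale distrib_right wscl_mult_left)
  fix w assume "w \<in> words M 2"
  then show "pair3 H C g (hsnoc (hten M w) z) = pair2 H C g (hten M w) \<rhd> z"
    using z by (auto simp: words_2 hsnoc_hten pair3_hten[OF g])
qed (simp add: z)

text \<open>Applying the inverse of \<open>\<^bold>g\<^sup>\<sharp>\<close> to \<open>\<^bold>g\<^sup>\<sharp>(m) = \<^bold>g\<^sup>a\<langle>\<^bold>g\<^sub>a, m\<rangle>\<close> expands \<open>m\<close>.\<close>

lemma metric_dual_basis:
  assumes g: "is_metric H C g"
  obtains e where "\<And>W. W \<in> Poly_Mapping.keys g \<Longrightarrow> e W \<in> carr M"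
    "\<And>W. W \<in> Poly_Mapping.keys g \<Longrightarrow> W ! 1 \<in> carr DV"
    "\<And>m. m \<in> carr M \<Longrightarrow> m = (\<Sum>W\<in>Poly_Mapping.keys g. e W \<lhd> (W ! 1) m)"
proof -
  let ?s = "sharp H C g" and ?K = "Poly_Mapping.keys g"
  have g2: "g \<in> carr (hpow (VF H C) 2)" using g by (simp add: is_metric_def sym_fields_def)
  have bij: "bij_betw ?s (carr M) (carr DV)" and sl: "linear_on M (scl DV) ?s"
    and sr: "\<And>x a. x \<in> carr M \<Longrightarrow> ?s (x \<lhd> a) = ract (VF H C) (?s x) a"
    using g by (auto simp: is_metric_def vs_iso_def lin_map_def linear_on_def dual_simps)
  have W: "W ! 0 \<in> carr DV" "W ! 1 \<in> carr DV" if "W \<in> ?K" for W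
    using keys_VF[OF g2 that] by (metis nth_Cons_0 nth_Cons_Suc One_nat_def)+
  \<comment> \<open>The basis is indexed by the words of the formal sum \<open>g\<close>, so the
    scalar coefficient of each word is absorbed into the preimage.\<close>
  define e where "e W = inv_into (carr M) ?s (scl DV (Poly_Mapping.lookup g W) (W ! 0))" for W
  have im: "scl DV (Poly_Mapping.lookup g W) (W ! 0) \<in> ?s ` carr M" if "W \<in> ?K" for W
    using bij is_vsD(4)[OF is_vs_DV W(1)[OF that]] by (simp add: bij_betw_def)
  have e: "e W \<in> carr M" "?s (e W) = scl DV (Poly_Mapping.lookup g W) (W ! 0)" if "W \<in> ?K" for W
    unfolding e_def using im[OF that] by (auto intro: inv_into_into f_inv_into_f)
  have "m = (\<Sum>W\<in>?K. e W \<lhd> (W ! 1) m)" if m: "m \<in> carr M" for m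
  proof -
    have "?s (\<Sum>W\<in>?K. e W \<lhd> (W ! 1) m) = (\<Sum>W\<in>?K. ?s (e W \<lhd> (W ! 1) m))"
      by (rule linear_on_sum[OF is_vs_M sl]) (simp add: e)
    also have "\<dots> = (\<Sum>W\<in>?K. scl DV (Poly_Mapping.lookup g W) (ract (VF H C) (W ! 0) ((W ! 1) m)))"
      by (intro sum.cong refl) (auto simp: sr e dual_simps fun_eq_iff vs_scale_simps)
    also have "\<dots> = ?s m" by (simp add: sharp_def lin_ext_def dual_simps)
    finally show ?thesis
      using bij_betw_imp_inj_on[OF bij] m is_vs_sum[OF is_vs_M, of ?K "\<lambda>W. e W \<lhd> (W ! 1) m"] e
      by (auto dest: inj_onD)
  qed
  with e(1) W(2) show ?thesis using that by blast
qed

section \<open>Differences of connections\<close>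

lemma map_lcoact_diff: "map_lcoact H C (\<lambda>x. \<phi> x - \<psi> x) y = map_lcoact H C \<phi> y - map_lcoact H C \<psi> y"
  by (simp add: map_lcoact_def lcoact2_def lin_ext_minus lin_ext_fun_diff split_def)

text \<open>The formula for \<open>oplus\<close> is linear in the map. As an equation of formal sums
  this applies to connections and to right linear maps alike.\<close>

lemma oplus_diff: "oplus H C (\<lambda>x. \<phi> x - \<psi> x) t = oplus H C \<phi> t - oplus H C \<psi> t"
proof -
  have a: "at_factors M i F (hcat M (s - t) u) = at_factors M i F (hcat M s u) - at_factors M i F (hcat M t u)" for i F s t u
    by (simp add: at_factors_def hcat_def lin_ext_minus)
  show ?thesis
    by (simp add: oplus_def Let_def a map_lcoact_diff lin_ext_minus split_def add_diff_add
        lin_ext_fun_diff[OF vs_pscale, symmetric])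
qed

lemma right_connectionD:
  assumes "right_connection H C D"
  shows "x \<in> carr M \<Longrightarrow> D x \<in> carr (hpow M 2)" "linear_on M pscale D"
    "x \<in> carr M \<Longrightarrow> D (x \<lhd> a) = hpow_ract M (D x) a + hten M [x, da a]"
    "x \<notin> carr M \<Longrightarrow> D x = 0"
  using assms by (auto simp: right_connection_def lin_map_def linear_on_def)

lemma Hom_form_symD:
  assumes "\<phi> \<in> carr (Hom_form_sym H C)"
  shows "x \<in> carr M \<Longrightarrow> \<phi> x \<in> sym_forms H C" "x \<in> carr M \<Longrightarrow> \<phi> x \<in> carr (hpow M 2)" "linear_on M pscale \<phi>"
    "x \<in> carr M \<Longrightarrow> \<phi> (x \<lhd> a) = hpow_ract M (\<phi> x) a" "x \<notin> carr M \<Longrightarrow> \<phi> x = 0"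
proof -
  show s: "x \<in> carr M \<Longrightarrow> \<phi> x \<in> sym_forms H C" and c: "x \<in> carr M \<Longrightarrow> \<phi> x \<in> carr (hpow M 2)"
    and r: "x \<in> carr M \<Longrightarrow> \<phi> (x \<lhd> a) = hpow_ract M (\<phi> x) a" and "x \<notin> carr M \<Longrightarrow> \<phi> x = 0" for x a
    using assms by (auto simp: Hom_form_sym_def right_hom_def dest: sym_forms_carr)
  have "\<phi> (scl M k x) = pscale k (\<phi> x)" if "x \<in> carr M" for k x
    using r[OF that, of "scl H k 1"] that by (simp add: scale_as_ract hpow_ract_simps[OF c])
  then show "linear_on M pscale \<phi>"
    using assms by (simp add: linear_on_def Hom_form_sym_def right_hom_def)
qed

lemma Hom_form_symI:
  assumes "\<And>x. x \<in> carr M \<Longrightarrow> \<phi> x \<in> sym_forms H C" "linear_on M pscale \<phi>"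
    "\<And>x a. x \<in> carr M \<Longrightarrow> \<phi> (x \<lhd> a) = hpow_ract M (\<phi> x) a" "\<And>x. x \<notin> carr M \<Longrightarrow> \<phi> x = 0"
  shows "\<phi> \<in> carr (Hom_form_sym H C)"
  using assms by (simp add: Hom_form_sym_def right_hom_def linear_on_def)

lemma wedge_diff: "s \<in> carr (hpow M 2) \<Longrightarrow> t \<in> carr (hpow M 2) \<Longrightarrow> wedge C (s - t) = wedge C s - wedge C t"
  by (rule linear_on_diff[OF hpow_is_vs wedge_linear])

lemma connection_diff:
  assumes D: "right_connection H C D" "torsion_free H C D" and D': "right_connection H C D'" "torsion_free H C D'"
  shows "(\<lambda>x. D x - D' x) \<in> carr (Hom_form_sym H C)"
proof (rule Hom_form_symI)
  note d = right_connectionD[OF D(1)] and d' = right_connectionD[OF D'(1)]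
  fix x assume x: "x \<in> carr M"
  have "wedge C (D x) + dd C x = 0" "wedge C (D' x) + dd C x = 0"
    using D(2) D'(2) x by (auto simp: torsion_free_def)
  then have "wedge C (D x) = wedge C (D' x)" by (metis add_right_cancel)
  then have "wedge C (D x - D' x) = 0"
    using x by (simp add: wedge_diff d d')
  then show "D x - D' x \<in> sym_forms H C"
    using wedge_eq_0_iff[OF is_vsD(5)[OF hpow_is_vs d(1)[OF x] d'(1)[OF x]]] by simp
  show "D (x \<lhd> a) - D' (x \<lhd> a) = hpow_ract M (D x - D' x) a" for a
    using x linear_on_diff[OF hpow_is_vs hpow_ract_linear d(1)[OF x] d'(1)[OF x], of a] by (simp add: d d')
next
  interpret vector_space "pscale :: 'k \<Rightarrow> ('w list \<Rightarrow>\<^sub>0 'k) \<Rightarrow> _" by simp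
  show "linear_on M pscale (\<lambda>x. D x - D' x)"
    using right_connectionD(2)[OF D(1)] right_connectionD(2)[OF D'(1)]
    by (simp add: linear_on_def scale_right_diff_distrib)
  show "D x - D' x = 0" if "x \<notin> carr M" for x
    using that right_connectionD(4)[OF D(1)] right_connectionD(4)[OF D'(1)] by simp
qed

lemma connection_add:
  assumes D: "right_connection H C D" "torsion_free H C D" and \<phi>: "\<phi> \<in> carr (Hom_form_sym H C)"
  shows "right_connection H C (D + \<phi>)" "torsion_free H C (D + \<phi>)"
proof -
  note d = right_connectionD[OF D(1)] and p = Hom_form_symD[OF \<phi>]
  have a: "hpow_ract M (D x + \<phi> x) a = hpow_ract M (D x) a + hpow_ract M (\<phi> x) a" if "x \<in> carr M" for x a
    using hpow_ract_linear[of 2 a] that by (simp add: linear_on_def d p)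
  show "right_connection H C (D + \<phi>)"
    unfolding right_connection_def lin_map_def
    using d(2) p(3) d(1,3,4) p(2,4,5) is_vsD(3)[OF hpow_is_vs, of _ M 2]
    by (simp add: linear_on_def a vs_scale_simps)
  show "torsion_free H C (D + \<phi>)"
    unfolding torsion_free_def
  proof
    fix x assume x: "x \<in> carr M"
    have "wedge C (\<phi> x) = 0" using wedge_eq_0_iff[of "\<phi> x"] p x by simp
    then have "wedge C ((D + \<phi>) x) = wedge C (D x)"
      using wedge_linear[of 2] x by (simp add: linear_on_def d p)
    then show "wedge C ((D + \<phi>) x) + dd C x = 0" using D(2) x by (simp add: torsion_free_def)
  qed
qed

text \<open>Diagonalisability gives the decomposition and independence of eigenspaces its
  uniqueness, which together resolve the definite description.\<close>

lemma sym_proj: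
  assumes d: "diagonalisable (hpow M 2) (braiding_inv H M)" and t: "t \<in> carr (hpow M 2)"
  shows "sym_proj H C t \<in> sym_forms H C" "t - sym_proj H C t \<in> asym_forms H C"
proof -
  interpret vector_space "pscale :: 'k \<Rightarrow> ('w list \<Rightarrow>\<^sub>0 'k) \<Rightarrow> _" by simp
  have l: "linear_on (hpow M 2) (scl (hpow M 2)) (braiding_inv H M)" by simp
  let ?P = "\<lambda>s. s \<in> sym_forms H C \<and> t - s \<in> asym_forms H C"
  obtain s where s: "?P s"
    using diagonalisable_decomp[OF hpow_is_vs l d t, of 1] by (auto simp: sym_forms_def asym_forms_def)
  have "u = s" if u: "?P u" for u
  proof -
    have "(t - u) - (t - s) \<in> asym_forms H C"
      using s u unfolding asym_forms_def by (blast intro: span_diff)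
    then have "s - u \<in> asym_forms H C" by simp
    moreover have "s - u \<in> eigenspace (hpow M 2) (braiding_inv H M) 1"
      using s u is_vsD(5)[OF hpow_is_vs, of s M 2 u] linear_on_diff[OF hpow_is_vs braiding_inv_linear, of s u]
      by (simp add: sym_forms_def eigenspace_def)
    ultimately have "s - u = 0"
      using eigenspace_independent[OF hpow_is_vs l, of "s - u" 1] by (simp add: asym_forms_def)
    then show ?thesis by simp
  qed
  with s have "?P (sym_proj H C t)" unfolding sym_proj_def by (rule theI)
  then show "sym_proj H C t \<in> sym_forms H C" "t - sym_proj H C t \<in> asym_forms H C" by auto
qed

section \<open>The metric on symmetric and antisymmetric tensors\<close>

context
  fixes g :: "('w \<Rightarrow> 'h) list \<Rightarrow>\<^sub>0 'k"
  assumes metric: "is_metric H C g" and diag: "diagonalisable (hpow M 2) (braiding_inv H M)"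
begin

lemma g_carr: "g \<in> carr (hpow (VF H C) 2)" and g_sym: "braiding H (VF H C) g = g"
  using metric by (auto simp: is_metric_def sym_fields_def)

text \<open>If the inverse braiding multiplies t by c, then t = c\<sigma>(t), and invariance of the
  metric gives (1 - c)\<langle>g, t\<rangle> = 0.\<close>

lemma pair2_asym:
  assumes "t \<in> asym_forms H C"
  shows "pair2 H C g t = 0"
proof -
  interpret vector_space "pscale :: 'k \<Rightarrow> ('w list \<Rightarrow>\<^sub>0 'k) \<Rightarrow> _" by simp
  interpret h: vector_space "scl H" by simp
  obtain e where db: "\<And>W. W \<in> Poly_Mapping.keys g \<Longrightarrow> e W \<in> carr M"
    "\<And>W. W \<in> Poly_Mapping.keys g \<Longrightarrow> W ! 1 \<in> carr DV"
    "\<And>m. m \<in> carr M \<Longrightarrow> m = (\<Sum>W\<in>Poly_Mapping.keys g. e W \<lhd> (W ! 1) m)"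
    using metric_dual_basis[OF metric] by blast
  have eig: "pair2 H C g t = 0" if c: "c \<noteq> 1" and t: "t \<in> eigenspace (hpow M 2) (braiding_inv H M) c" for c t
  proof -
    have tc: "t \<in> carr (hpow M 2)" and tb: "braiding_inv H M t = pscale c t"
      using t by (auto simp: eigenspace_def)
    have "t = pscale c (braiding H M t)"
      using braiding_braiding_inv[OF tc] braiding_linear tc by (simp add: tb linear_on_def)
    then have "pair2 H C g t = scl H c (pair2 H C g (braiding H M t))"
      using pair2_linear[of g] braiding_closed[OF tc] unfolding linear_on_def by (metis scl_hpow)
    also have "\<dots> = scl H c (pair2 H C g t)"
      using pair2_braiding[OF db g_carr g_sym tc] by simp
    finally have "scl H (1 - c) (pair2 H C g t) = 0" by (simp add: h.scale_left_diff_distrib)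
    then show ?thesis using c by simp
  qed
  have "t \<in> carr (hpow M 2) \<and> pair2 H C g t = 0"
    using assms unfolding asym_forms_def
  proof (induction rule: span_induct_alt)
    case base
    show ?case using is_vsD(2)[OF hpow_is_vs] linear_on_0[OF hpow_is_vs pair2_linear] by blast
  next
    case (step a x y)
    then obtain c where c: "c \<noteq> 1" and x: "x \<in> eigenspace (hpow M 2) (braiding_inv H M) c" by blast
    have xc: "pscale a x \<in> carr (hpow M 2)"
      using x is_vsD(4)[OF hpow_is_vs, of x M 2 a] by (simp add: eigenspace_def)
    have "pair2 H C g (pscale a x) = 0"
      using eig[OF c x] x pair2_linear[of g] by (simp add: linear_on_def eigenspace_def)
    then show ?case
      using xc step.IH is_vsD(3)[OF hpow_is_vs xc, of y] pair2_linear[of g] by (simp add: linear_on_def)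
  qed
  then show ?thesis ..
qed

lemma pair2_sym_proj:
  assumes t: "t \<in> carr (hpow M 2)"
  shows "pair2 H C g (sym_proj H C t) = pair2 H C g t"
  using pair2_asym[OF sym_proj(2)[OF diag t]] sym_proj(1)[OF diag t]
    linear_on_diff[OF hpow_is_vs pair2_linear t, of "sym_proj H C t" g]
  by (simp add: sym_forms_carr)

text \<open>On a word, the projection and the metric both act on the first two factors, and there
  the metric ignores the antisymmetric part.\<close>

lemma pair3_sym_proj:
  assumes s: "s \<in> carr (hpow M 3)"
  shows "pair3 H C g (at_factors M 0 (sym_proj H C) s) = pair3 H C g s"
proof -
  have p: "pair3 H C g (plin s F) = lin_ext (wscl C) s (\<lambda>w. pair3 H C g (F w))" for F
    by (simp add: pair3_def lin_ext_plin)
  show ?thesis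
    unfolding at_factors_def p
  proof (subst (2) pair3_def, rule lin_ext_words3_cong[OF refl s])
    fix x y z assume c: "x \<in> carr M" "y \<in> carr M" "z \<in> carr M"
    have "pair3 H C g (hsnoc (sym_proj H C (hten M [x, y])) z) = pair2 H C g (hten M [x, y]) \<rhd> z"
      using c sym_proj(1)[OF diag, of "hten M [x, y]"]
      by (simp add: pair3_app[OF g_carr] pair2_sym_proj sym_forms_carr)
    then show "pair3 H C g (plin (sym_proj H C (hten M [[x, y, z] ! 0, [x, y, z] ! Suc 0]))
         (\<lambda>v. hten M (take 0 [x, y, z] @ v @ drop (0 + 2) [x, y, z]))) =
      lact M (pair2 H C g (hten M [[x, y, z] ! 0, [x, y, z] ! 1])) ([x, y, z] ! 2)"
      by (simp add: hsnoc_def)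
  qed
qed

lemma pair3_vee:
  assumes "\<And>x. x \<in> carr M \<Longrightarrow> \<phi> x \<in> carr (hpow M 2)" "linear_on M pscale \<phi>" "t \<in> sym_forms H C"
  shows "pair3 H C g (vee H C \<phi> t) = pair3 H C g (oplus H C \<phi> t)"
  using oplus_closed[OF assms(1,2) sym_forms_carr[OF assms(3)]] assms(3)
  by (simp add: vee_def pair3_sym_proj)

lemma metric_compatible_iff:
  assumes "right_connection H C D"
  shows "metric_compatible H C g D \<longleftrightarrow> (\<forall>t\<in>sym_forms H C. pair3 H C g (oplus H C D t) = da (pair2 H C g t))"
  using right_connectionD(1,2)[OF assms] by (simp add: metric_compatible_def pair3_vee)

lemma Phi_eq:
  assumes "\<phi> \<in> carr (Hom_form_sym H C)"
  shows "Phi H C g \<phi> t = (if t \<in> sym_forms H C then pair3 H C g (oplus H C \<phi> t) else 0)"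
  using pair3_vee[OF Hom_form_symD(2,3)[OF assms]] by (simp add: Phi_def) (simp add: vee_def pair3_def)

lemma pair3_oplus_diff:
  assumes "right_connection H C D" "right_connection H C D'" "t \<in> sym_forms H C"
  shows "pair3 H C g (oplus H C (\<lambda>x. D x - D' x) t) = pair3 H C g (oplus H C D t) - pair3 H C g (oplus H C D' t)"
  by (simp add: oplus_diff pair3_def lin_ext_minus)

section \<open>Uniqueness and existence\<close>

lemma levi_civita_unique:
  assumes inj: "inj_on (Phi H C g) (carr (Hom_form_sym H C))"
    and D: "levi_civita H C g D" and D': "levi_civita H C g D'"
  shows "D = D'"
proof -
  have d: "right_connection H C D" "torsion_free H C D" "right_connection H C D'" "torsion_free H C D'"
    using D D' by (auto simp: levi_civita_def)
  \<comment> \<open>The zero map enters as the difference of \<open>D\<close> with itself.\<close>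
  have m: "(\<lambda>x. D x - D' x) \<in> carr (Hom_form_sym H C)" "(\<lambda>x. 0) \<in> carr (Hom_form_sym H C)"
    using connection_diff[OF d] connection_diff[OF d(1,2) d(1,2)] by simp_all
  have "pair3 H C g (oplus H C (\<lambda>x. 0) t) = 0" if "t \<in> sym_forms H C" for t
    using pair3_oplus_diff[OF d(1) d(1) that] by simp
  then have "Phi H C g (\<lambda>x. D x - D' x) = Phi H C g (\<lambda>x. 0)"
    using D D' unfolding Phi_eq[OF m(1), abs_def] Phi_eq[OF m(2), abs_def]
    by (auto simp: fun_eq_iff levi_civita_def metric_compatible_iff pair3_oplus_diff d)
  from inj_onD[OF inj this m] have "D x - D' x = 0" for x by meson
  then show ?thesis by (auto simp: fun_eq_iff)
qed

text \<open>The Leibniz rules of d and of \<open>oplus\<close> produce the same term \<langle>g,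
  t\<rangle>da, which cancels in the difference.\<close>

lemma metric_defect_in_Hom:
  assumes D: "right_connection H C D"
  shows "metric_defect H C g D \<in> carr (Hom_sym_form H C)"
proof -
  note d = right_connectionD[OF D]
  have oc: "t \<in> carr (hpow M 2) \<Longrightarrow> oplus H C D t \<in> carr (hpow M 3)" for t
    by (rule oplus_closed[OF d(1,2)])
  have ol: "oplus H C D (s + t) = oplus H C D s + oplus H C D t" for s t
    unfolding oplus_def Let_def by (rule lin_ext_add) simp
  have p3: "pair3 H C g (s + t) = pair3 H C g s + pair3 H C g t" for s t
    unfolding pair3_def by (rule lin_ext_add) simp
  have sa: "s + t \<in> sym_forms H C" if "s \<in> sym_forms H C" "t \<in> sym_forms H C" for s t
    unfolding sym_forms_def
    by (rule eigenspace_closed(3)[OF hpow_is_vs, of M 2]) (use that in \<open>simp_all add: sym_forms_def\<close>)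
  have p2: "pair2 H C g (s + t) = pair2 H C g s + pair2 H C g t" if "s \<in> sym_forms H C" "t \<in> sym_forms H C" for s t
    using pair2_linear[of g] that by (simp add: linear_on_def sym_forms_carr)
  have cl: "da (pair2 H C g t) - pair3 H C g (oplus H C D t) \<in> carr M" if "t \<in> sym_forms H C" for t
    using that by (intro closedM(4) da_closed pair3_closed oc sym_forms_carr)
  have r: "da (pair2 H C g (hpow_ract M t a)) - pair3 H C g (oplus H C D (hpow_ract M t a)) =
     (da (pair2 H C g t) - pair3 H C g (oplus H C D t)) \<lhd> a" if t: "t \<in> sym_forms H C" for t a
  proof -
    note tc = sym_forms_carr[OF t]
    have "pair3 H C g (oplus H C D (hpow_ract M t a)) = pair3 H C g (oplus H C D t) \<lhd> a + pair2 H C g t \<rhd> da a"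
      by (simp add: oplus_Leibniz[OF d(1-3) tc] p3 pair3_ract[OF g_carr oc[OF tc]] pair3_app[OF g_carr tc])
    then show ?thesis
      by (simp add: pair2_ract[OF g_carr tc] da_mult) (simp add: Omega1_simps left_diff_distrib)
  qed
  show ?thesis
    using cl r sa sym_forms_ract
    by (simp add: Hom_sym_form_def right_hom_def metric_defect_def ol p2 p3 da_add)
qed

lemma levi_civita_construct:
  assumes D: "right_connection H C D" "torsion_free H C D" and \<phi>: "\<phi> \<in> carr (Hom_form_sym H C)"
    and P: "Phi H C g \<phi> = metric_defect H C g D"
  shows "levi_civita H C g (D + \<phi>)"
proof -
  note c = connection_add[OF D \<phi>]
  have "pair3 H C g (oplus H C (D + \<phi>) t) = da (pair2 H C g t)" if t: "t \<in> sym_forms H C" for t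
  proof -
    have "(\<lambda>x. (D + \<phi>) x - D x) = \<phi>" by auto
    then have "pair3 H C g (oplus H C \<phi> t) = pair3 H C g (oplus H C (D + \<phi>) t) - pair3 H C g (oplus H C D t)"
      using pair3_oplus_diff[OF c(1) D(1) t] by simp
    moreover have "pair3 H C g (oplus H C \<phi> t) = da (pair2 H C g t) - pair3 H C g (oplus H C D t)"
      using fun_cong[OF P, of t] t by (simp add: Phi_eq[OF \<phi>] metric_defect_def)
    ultimately show ?thesis by simp
  qed
  with c show ?thesis by (simp add: levi_civita_def metric_compatible_iff)
qed

lemma torsion_free_connection_ex: "\<exists>D. right_connection H C D \<and> torsion_free H C D"
proof -
  obtain e where db: "\<And>W. W \<in> Poly_Mapping.keys g \<Longrightarrow> e W \<in> carr M"
    "\<And>W. W \<in> Poly_Mapping.keys g \<Longrightarrow> W ! 1 \<in> carr DV"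
    "\<And>m. m \<in> carr M \<Longrightarrow> m = (\<Sum>W\<in>Poly_Mapping.keys g. e W \<lhd> (W ! 1) m)"
    using metric_dual_basis[OF metric] by blast
  have "\<exists>t\<in>carr (hpow M 2). wedge C t = - dd C (e W)" if "W \<in> Poly_Mapping.keys g" for W
  proof (rule wedge_surj)
    have "- e W \<in> carr M" using db(1)[OF that] by simp
    then have "dd C (- e W) \<in> grade C 2"
      using dd_grade[of "- e W" 1] by (simp add: Omega1_simps numeral_2_eq_2)
    moreover have "dd C (- e W) = - dd C (e W)"
      using dd_add[of "e W" "- e W"] dd_add[of 0 0] by (simp add: eq_neg_iff_add_eq_0 add.commute)
    ultimately show "- dd C (e W) \<in> grade C 2" by simp
  qed
  then obtain E where E: "\<And>W. W \<in> Poly_Mapping.keys g \<Longrightarrow> E W \<in> carr (hpow M 2)"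
    "\<And>W. W \<in> Poly_Mapping.keys g \<Longrightarrow> wedge C (E W) = - dd C (e W)"
    by metis
  have "right_connection H C (basis_connection (Poly_Mapping.keys g) e (\<lambda>W. W ! 1) E)"
    by (rule basis_connection) (rule db E; assumption)+
  moreover have "torsion_free H C (basis_connection (Poly_Mapping.keys g) e (\<lambda>W. W ! 1) E)"
    by (rule basis_connection_torsion_free) (rule db E; assumption)+
  ultimately show ?thesis by blast
qed

end

section \<open>The structure constants connection\<close>

context
  fixes n :: nat and \<omega> :: "nat \<Rightarrow> 'w" and \<chi> :: "nat \<Rightarrow> 'h \<Rightarrow> 'k" and x :: "nat \<Rightarrow> 'h"
  assumes sd: "structure_data H C n \<omega> \<chi> x"
begin

lemma omega_coL: "i < n \<Longrightarrow> \<omega> i \<in> coL"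
proof -
  interpret vector_space "wscl C" by simp
  show "i < n \<Longrightarrow> \<omega> i \<in> coL"
    using sd span_superset[of "\<omega> ` {..<n}"] by (auto simp: structure_data_def coL_def)
qed

lemma omega_carr [simp]: "i < n \<Longrightarrow> \<omega> i \<in> carr M"
  by (simp add: omega_coL)

lemma chi_linear [simp]:
  assumes "i < n"
  shows "\<chi> i (a + b) = \<chi> i a + \<chi> i b" "\<chi> i (scl H c a) = c * \<chi> i a"
proof -
  interpret Vector_Spaces.linear "scl H" "(*)" "\<chi> i" using sd assms by (simp add: structure_data_def)
  show "\<chi> i (a + b) = \<chi> i a + \<chi> i b" "\<chi> i (scl H c a) = c * \<chi> i a" by (simp_all add: add scale)
qed

lemma omega_dual_basis:
  obtains f where "\<And>i. i < n \<Longrightarrow> f i \<in> carr DV" "\<And>m. m \<in> carr M \<Longrightarrow> m = (\<Sum>i<n. \<omega> i \<lhd> f i m)"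
    "\<And>i j. i < n \<Longrightarrow> j < n \<Longrightarrow> f i (\<omega> j) = (if i = j then 1 else 0)"
proof -
  interpret vector_space_pair "wscl C" "(*) :: 'k \<Rightarrow> 'k \<Rightarrow> 'k"
    unfolding vector_space_pair_def
    by (intro conjI vs_C, unfold_locales) (simp_all add: algebra_simps)
  have inj: "inj_on \<omega> {..<n}" and ind: "vs1.independent (\<omega> ` {..<n})"
    and sp: "vs1.span (\<omega> ` {..<n}) = coL"
    using sd by (simp_all add: structure_data_def coL_def)
  \<comment> \<open>The coordinate functionals are extended from the basis to the whole type
    \<open>'w\<close>, so that they are linear without membership conditions.\<close>
  have "\<exists>c. Vector_Spaces.linear (wscl C) (*) c \<and> (\<forall>y\<in>\<omega> ` {..<n}. c y = (if y = \<omega> i then 1 else 0))" for i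
    using linear_independent_extend[OF ind, of "\<lambda>y. if y = \<omega> i then 1 else 0"] by blast
  then obtain c where c: "\<And>i. Vector_Spaces.linear (wscl C) (*) (c i)"
    "\<And>i y. y \<in> \<omega> ` {..<n} \<Longrightarrow> c i y = (if y = \<omega> i then 1 else 0)" by metis
  have cl: "c i (y + z) = c i y + c i z" "c i (wscl C a y) = a * c i y" for i y z a
  proof -
    interpret l: Vector_Spaces.linear "wscl C" "(*)" "c i" by (rule c)
    show "c i (y + z) = c i y + c i z" "c i (wscl C a y) = a * c i y" by (simp_all add: l.add l.scale)
  qed
  have c0: "c i 0 = 0" for i using cl(2)[of i 0 0] by simp
  have cw: "c i (\<omega> j) = (if i = j then 1 else 0)" if "i < n" "j < n" for i j
    using c(2)[of "\<omega> j" i] that inj by (auto dest: inj_onD)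
  have expand: "w = (\<Sum>i<n. wscl C (c i w) (\<omega> i))" if "w \<in> coL" for w
    using that unfolding sp[symmetric]
  proof (induction rule: vs1.span_induct_alt)
    case base
    show ?case by (simp add: c0)
  next
    case (step a y z)
    then obtain j where j: "j < n" "y = \<omega> j" by auto
    have "(\<Sum>i<n. wscl C (c i (\<omega> j)) (\<omega> i)) = (\<Sum>i<n. if i = j then \<omega> i else 0)"
      using j(1) by (intro sum.cong refl) (simp add: cw)
    then have y: "(\<Sum>i<n. wscl C (c i y) (\<omega> i)) = y"
      using j by simp
    have "(\<Sum>i<n. wscl C (c i (wscl C a y + z)) (\<omega> i)) =
      wscl C a (\<Sum>i<n. wscl C (c i y) (\<omega> i)) + (\<Sum>i<n. wscl C (c i z) (\<omega> i))"
      by (simp add: cl vs1.scale_left_distrib sum.distrib vs1.scale_sum_right)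
    then show ?case using y step.IH by simp
  qed
  \<comment> \<open>The coefficient of \<open>\<omega> i\<close> in m = PL(m_0)m_{-1}.\<close>
  define f where "f i m = (if m \<in> carr M then lsum (scl H) m (\<lambda>h m0. scl H (c i (PL m0)) h) else 0)" for i m
  have s: "scl M = wscl C" by (simp add: Omega1_simps)
  note pl = PL_linear[unfolded linear_on_def s]
  have f: "f i \<in> carr DV" for i
    unfolding carr_DV
  proof (intro conjI ballI allI impI)
    show "f i (y + z) = f i y + f i z" if "y \<in> carr M" "z \<in> carr M" for y z
      using that by (simp add: f_def lsum_arg)
    fix m a assume m: "m \<in> carr M"
    have "f i (m \<lhd> a) = lsum (scl H) m (\<lambda>h m0. csum (scl H) a (\<lambda>a1 a2. scl H (c i (PL (m0 \<lhd> a2))) (h * a1)))"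
      using m pl by (simp add: f_def) (rule lsum_act, simp_all add: linM cl s[symmetric], simp_all add: s cl mult.commute)
    also have "\<dots> = lsum (scl H) m (\<lambda>h m0. scl H (c i (PL m0)) h * a)"
    proof (intro lsum_cong refl m)
      fix h m0 assume m0: "m0 \<in> carr M"
      \<comment> \<open>As PL(m_0a_2) = \<epsilon>(a_2)PL(m_0), the counit absorbs a_2 and the
        remaining leg is a.\<close>
      have "csum (scl H) a (\<lambda>a1 a2. scl H (c i (PL (m0 \<lhd> a2))) (h * a1)) =
        csum (scl H) a (\<lambda>a1 a2. scl H (eps a2) (scl H (c i (PL m0)) (h * a1)))"
        using m0 by (simp add: PL_ract s cl linM)
      also have "\<dots> = scl H (c i (PL m0)) (h * a)"
        by (rule csum_counit_right) (simp add: linM mult.commute)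
      finally show "csum (scl H) a (\<lambda>a1 a2. scl H (c i (PL (m0 \<lhd> a2))) (h * a1)) = scl H (c i (PL m0)) h * a"
        by (simp add: scl_mult_left)
    qed
    also have "\<dots> = f i m * a"
      using linear_on_lsum[OF is_vs_H, of "scl H" "\<lambda>z. z * a" m "\<lambda>h m0. scl H (c i (PL m0)) h"] m
      by (simp add: f_def linear_on_H distrib_right scl_mult_left)
    finally show "f i (m \<lhd> a) = f i m * a" .
  qed (simp add: f_def)
  have fw: "f i (\<omega> j) = (if i = j then 1 else 0)" if ij: "i < n" "j < n" for i j
  proof -
    have "f i (\<omega> j) = scl H (c i (PL (\<omega> j))) 1"
      using ij pl unfolding f_def
      by simp (subst lsum_coL, simp_all add: omega_coL linM cl s mult.commute)
    then show ?thesis using ij by (simp add: PL_id omega_coL cw linM)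
  qed
  have db: "m = (\<Sum>i<n. \<omega> i \<lhd> f i m)" if m: "m \<in> carr M" for m
  proof -
    have "\<omega> i \<lhd> f i m = lsum (scl M) m (\<lambda>h m0. \<omega> i \<lhd> scl H (c i (PL m0)) h)" if "i < n" for i
      unfolding f_def using m that
      by (simp add: linear_on_lsum[OF is_vs_H, of "scl M" "\<lambda>z. \<omega> i \<lhd> z"] linear_on_H ract_add ract_scale)
    then have "(\<Sum>i<n. \<omega> i \<lhd> f i m) = lsum (scl M) m (\<lambda>h m0. \<Sum>i<n. \<omega> i \<lhd> scl H (c i (PL m0)) h)"
      by (simp add: lsum_fun_sum)
    also have "\<dots> = lsum (scl M) m (\<lambda>h m0. PL m0 \<lhd> h)"
    proof (intro lsum_cong refl m)
      fix h m0 assume m0: "m0 \<in> carr M"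
      have "(\<Sum>i<n. \<omega> i \<lhd> scl H (c i (PL m0)) h) = (\<Sum>i<n. wscl C (c i (PL m0)) (\<omega> i)) * emb C h"
        unfolding sum_distrib_right by (intro sum.cong refl) (simp add: Omega1_simps emb_scale wscl_mult_left wscl_mult_right)
      then show "(\<Sum>i<n. \<omega> i \<lhd> scl H (c i (PL m0)) h) = PL m0 \<lhd> h"
        using expand[OF PL_coL[OF m0]] by (simp add: Omega1_simps)
    qed
    finally show ?thesis by (simp add: PL_expand m)
  qed
  show ?thesis using that f db fw by blast
qed

text \<open>Apply \<open>d\<close> to \<open>da = \<omega>\<^sup>i a\<^sub>1\<chi>\<^sub>i(a\<^sub>2)\<close>, replace \<open>a\<close> by \<open>a\<^sub>2\<close> and multiply by \<open>S\<^sup>-\<^sup>1(a\<^sub>1)\<close> from the right.\<close>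

lemma maurer_cartan_functional:
  "(\<Sum>i<n. wscl C (\<chi> i a) (dd C (\<omega> i))) =
   (\<Sum>i<n. \<Sum>k<n. csum (wscl C) a (\<lambda>a1 a2. wscl C (\<chi> i a2) (wscl C (\<chi> k a1) (\<omega> i * \<omega> k))))"
proof -
  note w = csum_lin[OF vs_C] wscl_mult_left wscl_mult_right emb_add emb_scale emb_mult
  have da: "da a = (\<Sum>i<n. csum (wscl C) a (\<lambda>a1 a2. wscl C (\<chi> i a2) (\<omega> i * emb C a1)))" for a
    using sd by (simp add: structure_data_def csum_def Omega1_simps)
  have csum_map: "g (csum (wscl C) a F) = csum (wscl C) a (\<lambda>u v. g (F u v))"
    if "\<And>y z. g (y + z) = g y + g z" "\<And>c y. g (wscl C c y) = wscl C c (g y)" for g :: "'w \<Rightarrow> 'w" and a F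
  proof -
    have "g 0 = 0" using that(1)[of 0 0] by simp
    then have gs: "g (\<Sum>i\<in>A. y i) = (\<Sum>i\<in>A. g (y i))" for A :: "('h \<times> 'h) set" and y
      by (induction A rule: infinite_finite_induct) (simp_all add: that)
    show ?thesis by (simp add: csum_def lin_ext_def gs that split_def)
  qed
  have dsum: "dd C (\<Sum>i\<in>A. y i) = (\<Sum>i\<in>A. dd C (y i))" for A :: "nat set" and y
    using dd_add[of 0 0] by (induction A rule: infinite_finite_induct) (simp_all add: dd_add)
  have dw: "dd C (\<omega> i * emb C b) = dd C (\<omega> i) * emb C b - \<omega> i * da b" if "i < n" for i b
    using dd_right[OF omega_carr[OF that], of b] by (simp add: Omega1_simps)
  \<comment> \<open>\<open>L\<close> and \<open>R\<close> are the two terms of d(\<omega>^i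
    b_1)\<chi>_i(b_2), up to sign: the first contains d\<omega>^i, the second \<omega>^i \<and> db_1
    with db_1 expanded again.\<close>
  define L where "L i b = csum (wscl C) b (\<lambda>a1 a2. wscl C (\<chi> i a2) (dd C (\<omega> i) * emb C a1))" for i b
  define R where "R i k b = csum (wscl C) b (\<lambda>a1 a2. csum (wscl C) a1 (\<lambda>b1 b2.
     wscl C (\<chi> i a2) (wscl C (\<chi> k b2) (\<omega> i * \<omega> k * emb C b1))))" for i k b
  have Z: "(\<Sum>i<n. L i b) = (\<Sum>i<n. \<Sum>k<n. R i k b)" for b
  proof -
    have "0 = dd C (da b)" by (simp add: dd_dd)
    also have "\<dots> = (\<Sum>i<n. csum (wscl C) b (\<lambda>a1 a2. wscl C (\<chi> i a2) (dd C (\<omega> i) * emb C a1 - \<omega> i * da a1)))"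
      unfolding da[of b] dsum
      by (intro sum.cong refl) (simp add: csum_map[of "dd C"] dd_add dd_scale dw)
    also have "\<dots> = (\<Sum>i<n. L i b - csum (wscl C) b (\<lambda>a1 a2. wscl C (\<chi> i a2) (\<omega> i * da a1)))"
    proof (intro sum.cong refl)
      fix i
      interpret vector_space "wscl C" by simp
      show "csum (wscl C) b (\<lambda>a1 a2. wscl C (\<chi> i a2) (dd C (\<omega> i) * emb C a1 - \<omega> i * da a1)) =
         L i b - csum (wscl C) b (\<lambda>a1 a2. wscl C (\<chi> i a2) (\<omega> i * da a1))"
        by (simp add: L_def scale_right_diff_distrib csum_def split_def lin_ext_fun_diff)
    qed
    also have "(\<lambda>i. csum (wscl C) b (\<lambda>a1 a2. wscl C (\<chi> i a2) (\<omega> i * da a1))) = (\<lambda>i. \<Sum>k<n. R i k b)"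
    proof
      fix i
      interpret vector_space "wscl C" by simp
      show "csum (wscl C) b (\<lambda>a1 a2. wscl C (\<chi> i a2) (\<omega> i * da a1)) = (\<Sum>k<n. R i k b)"
        unfolding da R_def
        by (simp add: sum_distrib_left scale_sum_right csum_map[of "\<lambda>z. \<omega> i * z"] csum_map[of "wscl C c" for c]
           distrib_left wscl_mult_right mult.assoc scale_right_distrib mult.commute csum_fun_sum[OF vs_C])
    qed
    finally have "0 = (\<Sum>i<n. L i b - (\<Sum>k<n. R i k b))" .
    then show ?thesis by (simp add: sum_subtractf)
  qed
  have "(\<Sum>i<n. csum (wscl C) a (\<lambda>u v. L i v * emb C (Si u))) =
    (\<Sum>i<n. \<Sum>k<n. csum (wscl C) a (\<lambda>u v. R i k v * emb C (Si u)))"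
    by (simp add: csum_fun_sum[OF vs_C, symmetric] sum_distrib_right[symmetric] Z)
  moreover have "csum (wscl C) a (\<lambda>u v. L i v * emb C (Si u)) = wscl C (\<chi> i a) (dd C (\<omega> i))" if i: "i < n" for i
  proof -
    have "csum (wscl C) a (\<lambda>u v. L i v * emb C (Si u)) =
      csum (wscl C) a (\<lambda>u v. csum (wscl C) v (\<lambda>a1 a2. wscl C (\<chi> i a2) (dd C (\<omega> i) * emb C (a1 * Si u))))"
      unfolding L_def by (simp add: csum_map[of "\<lambda>z. z * y" for y] distrib_right wscl_mult_left emb_mult mult.assoc)
    also have "\<dots> = wscl C (\<chi> i a) (dd C (\<omega> i) * emb C 1)"
      by (rule csum_cancel_Si_right(1)[where F = "\<lambda>z a2. wscl C (\<chi> i a2) (dd C (\<omega> i) * emb C z)"])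
        (simp_all add: linear_on_H w i distrib_left mult.commute)
    finally show ?thesis by (simp add: emb_one)
  qed
  moreover have "csum (wscl C) a (\<lambda>u v. R i k v * emb C (Si u)) =
    csum (wscl C) a (\<lambda>a1 a2. wscl C (\<chi> i a2) (wscl C (\<chi> k a1) (\<omega> i * \<omega> k)))" if i: "i < n" and k: "k < n" for i k
  proof -
    have lin: "linear_on H (wscl C) (\<lambda>z. csum (wscl C) v (\<lambda>b2 a2. wscl C (\<chi> i a2) (wscl C (\<chi> k b2) (\<omega> i * \<omega> k * emb C z))))" for v
    proof -
      have "csum (wscl C) v (\<lambda>b2 a2. wscl C (\<chi> i a2) (wscl C (\<chi> k b2) (\<omega> i * \<omega> k * emb C z))) =
        csum (wscl C) v (\<lambda>b2 a2. wscl C (\<chi> i a2) (wscl C (\<chi> k b2) (\<omega> i * \<omega> k))) * emb C z" for z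
        by (simp only: csum_map[of "\<lambda>y. y * emb C z"] distrib_right wscl_mult_left)
      then show ?thesis by (simp add: linear_on_H emb_add emb_scale distrib_left wscl_mult_right)
    qed
    have "csum (wscl C) a (\<lambda>u v. R i k v * emb C (Si u)) =
      csum (wscl C) a (\<lambda>u v. csum (wscl C) v (\<lambda>a1 a2. csum (wscl C) a1 (\<lambda>b1 b2.
         wscl C (\<chi> i a2) (wscl C (\<chi> k b2) (\<omega> i * \<omega> k * emb C (b1 * Si u))))))"
      unfolding R_def by (simp add: csum_map[of "\<lambda>z. z * y" for y] distrib_right wscl_mult_left emb_mult mult.assoc)
    \<comment> \<open>Regrouped so that b_1, which multiplies from the right, is adjacent to u and
      cancels against \<open>Si u\<close>, while the legs under \<chi> stay together.\<close>
    also have "\<dots> = csum (wscl C) a (\<lambda>u v. csum (wscl C) v (\<lambda>b1 r. csum (wscl C) r (\<lambda>b2 a2.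
         wscl C (\<chi> i a2) (wscl C (\<chi> k b2) (\<omega> i * \<omega> k * emb C (b1 * Si u))))))"
      by (subst csum_coassoc[of "wscl C" "\<lambda>b1 b2 a2. wscl C (\<chi> i a2) (wscl C (\<chi> k b2) (\<omega> i * \<omega> k * emb C (b1 * Si u)))" for u])
        (simp_all add: linear_on_H w i k distrib_left distrib_right mult_ac)
    also have "\<dots> = csum (wscl C) a (\<lambda>b2 a2. wscl C (\<chi> i a2) (wscl C (\<chi> k b2) (\<omega> i * \<omega> k * emb C 1)))"
      by (rule csum_cancel_Si_right(1)[where F = "\<lambda>z r. csum (wscl C) r (\<lambda>b2 a2. wscl C (\<chi> i a2) (wscl C (\<chi> k b2) (\<omega> i * \<omega> k * emb C z)))"])
        (simp_all only: lin vs_C, simp_all add: linear_on_H w)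
    finally show ?thesis by (simp add: emb_one)
  qed
  ultimately show ?thesis by simp
qed

text \<open>Evaluating at \<open>x l\<close> isolates d\<omega>^l, because \<chi>_i(x^l) is the
  Kronecker symbol; the coefficients on the right are then structure constants by
  definition.\<close>

lemma maurer_cartan:
  assumes l: "l < n"
  shows "dd C (\<omega> l) = (\<Sum>j<n. \<Sum>k<n. wscl C (structure_const H \<chi> x l k j) (\<omega> j * \<omega> k))"
proof -
  interpret vector_space "wscl C" by simp
  have "(\<Sum>i<n. wscl C (\<chi> i (x l)) (dd C (\<omega> i))) = (\<Sum>i<n. if i = l then dd C (\<omega> i) else 0)"
    using sd l by (intro sum.cong refl) (auto simp: structure_data_def)
  then have "dd C (\<omega> l) = (\<Sum>i<n. wscl C (\<chi> i (x l)) (dd C (\<omega> i)))"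
    using l by simp
  also have "\<dots> = (\<Sum>j<n. \<Sum>k<n. wscl C (structure_const H \<chi> x l k j) (\<omega> j * \<omega> k))"
    unfolding maurer_cartan_functional
    by (intro sum.cong refl)
      (simp add: csum_def structure_const_def lin_ext_def scale_sum_left split_def mult_ac)
  finally show ?thesis .
qed

text \<open>The connection built from the dual basis meets the specification and the Leibniz rule
  leaves no other, so it is the one described. Its torsion vanishes by the Maurer-Cartan
  equation.\<close>

lemma structure_connection:
  "right_connection H C (structure_connection H C n \<omega> \<chi> x)"
  "torsion_free H C (structure_connection H C n \<omega> \<chi> x)"
proof -
  obtain f where f: "\<And>i. i < n \<Longrightarrow> f i \<in> carr DV" and db: "\<And>m. m \<in> carr M \<Longrightarrow> m = (\<Sum>i<n. \<omega> i \<lhd> f i m)"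
    and fw: "\<And>i j. i < n \<Longrightarrow> j < n \<Longrightarrow> f i (\<omega> j) = (if i = j then 1 else 0)"
    by (rule omega_dual_basis) blast
  define E where "E i = - (\<Sum>j<n. \<Sum>k<n. hten M [\<omega> j, wscl C (structure_const H \<chi> x i k j) (\<omega> k)])" for i
  have ws: "wscl C c (\<omega> k) \<in> carr M" if "k < n" for k c
    using is_vsD(4)[OF is_vs_M, of "\<omega> k" c] that by (simp add: Omega1_simps(2))
  have E: "E i \<in> carr (hpow M 2)" if "i < n" for i
    unfolding E_def by (intro is_vsD(6)[OF hpow_is_vs] is_vs_sum[OF hpow_is_vs]) (simp add: ws)
  have "wedge C (E i) = - dd C (\<omega> i)" if i: "i < n" for i
  proof -
    have "wedge C (E i) = - (\<Sum>j<n. \<Sum>k<n. wedge C (hten M [\<omega> j, wscl C (structure_const H \<chi> x i k j) (\<omega> k)]))"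
      by (simp add: E_def wedge_def lin_ext_uminus lin_ext_sum)
    also have "\<dots> = - (\<Sum>j<n. \<Sum>k<n. wscl C (structure_const H \<chi> x i k j) (\<omega> j * \<omega> k))"
      by (simp add: wedge_hten ws wscl_mult_right)
    finally show ?thesis by (simp add: maurer_cartan[OF i])
  qed
  note wE = this
  let ?D = "basis_connection {..<n} \<omega> f E"
  have rc: "right_connection H C ?D"
    by (rule basis_connection) (use f E in auto, rule db)
  have tf: "torsion_free H C ?D"
    by (rule basis_connection_torsion_free) (use f E wE in auto, rule db)
  \<comment> \<open>At a basis element the coefficients are the constants 0 and 1, whose
    differentials vanish; hence the values \<open>E i\<close> are attained here.\<close>
  have da01: "da 1 = 0" "da 0 = 0"
    using da_mult[of 1 1] da_add[of 0 0] by (simp_all add: Omega1_simps emb_one)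
  have h0: "hten M [y, 0] = 0" if "y \<in> carr M" for y
    using hten_simps(3)[of y M 0 0] that is_vsD(2)[OF is_vs_M] by simp
  have DE: "?D (\<omega> i) = E i" if i: "i < n" for i
  proof -
    have "hpow_ract M (E j) (f j (\<omega> i)) + hten M [\<omega> j, da (f j (\<omega> i))] = (if j = i then E j else 0)"
      if "j < n" for j
      using i that by (auto simp: fw E hpow_ract_simps da01 h0)
    then show ?thesis using i by (simp add: basis_connection_def)
  qed
  have "structure_connection H C n \<omega> \<chi> x = ?D"
    unfolding structure_connection_def
  proof (rule the_equality)
    show "right_connection H C ?D \<and> (\<forall>i<n. ?D (\<omega> i) = - (\<Sum>j<n. \<Sum>k<n. hten M [\<omega> j, wscl C (structure_const H \<chi> x i k j) (\<omega> k)]))"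
      using rc DE by (simp add: E_def)
    fix D assume D: "right_connection H C D \<and> (\<forall>i<n. D (\<omega> i) = - (\<Sum>j<n. \<Sum>k<n. hten M [\<omega> j, wscl C (structure_const H \<chi> x i k j) (\<omega> k)]))"
    have ex: "G m = (\<Sum>i<n. hpow_ract M (E i) (f i m) + hten M [\<omega> i, da (f i m)])"
      if G: "right_connection H C G" and GE: "\<And>i. i < n \<Longrightarrow> G (\<omega> i) = E i" and m: "m \<in> carr M" for G m
    proof -
      have "G m = G (\<Sum>i<n. \<omega> i \<lhd> f i m)" using db[OF m] by simp
      also have "\<dots> = (\<Sum>i<n. G (\<omega> i \<lhd> f i m))"
        by (rule linear_on_sum[OF is_vs_M right_connectionD(2)[OF G]]) simp
      also have "\<dots> = (\<Sum>i<n. hpow_ract M (E i) (f i m) + hten M [\<omega> i, da (f i m)])"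
        by (intro sum.cong refl) (simp add: right_connectionD(3)[OF G] GE)
      finally show ?thesis .
    qed
    show "D = ?D"
    proof
      fix m
      show "D m = ?D m"
        using ex[of D m] D right_connectionD(4)[of D m] by (cases "m \<in> carr M") (simp_all add: basis_connection_def E_def)
    qed
  qed
  then show "right_connection H C (structure_connection H C n \<omega> \<chi> x)"
    "torsion_free H C (structure_connection H C n \<omega> \<chi> x)" using rc tf by simp_all
qed

end

end

theorem theorem5p7:
  fixes H :: "('k::field, 'h::ring_1) hopf"
    and C :: "('k, 'h, 'w::ring_1) calculus"
    and g :: "('w \<Rightarrow> 'h) list \<Rightarrow>\<^sub>0 'k"
  assumes "hopf_algebra H"
    and "bij (antipode H)"
    and "woronowicz_calculus H C"
    and "fin_gen_right (Omega1 C)"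
    and "diagonalisable (Omega2T C) (braiding_inv H (Omega1 C))"
    and "\<exists>t\<in>carr (Omega2T C). t \<noteq> 0 \<and> braiding_inv H (Omega1 C) t = t"
    and "is_metric H C g"
  shows "(vs_iso (Hom_form_sym H C) (Hom_sym_form H C) (Phi H C g) \<longrightarrow>
           (\<forall>n \<omega> \<chi> x. structure_data H C n \<omega> \<chi> x \<longrightarrow>
             (let Dc = structure_connection H C n \<omega> \<chi> x;
                  DLC = Dc + inv_into (carr (Hom_form_sym H C)) (Phi H C g) (metric_defect H C g Dc)
              in levi_civita H C g DLC \<and> (\<forall>D. levi_civita H C g D \<longrightarrow> D = DLC))))
       \<and> (Phi H C g ` carr (Hom_form_sym H C) = carr (Hom_sym_form H C) \<longrightarrow>
           (\<exists>D. levi_civita H C g D))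
       \<and> (inj_on (Phi H C g) (carr (Hom_form_sym H C)) \<longrightarrow>
           (\<forall>D D'. levi_civita H C g D \<longrightarrow> levi_civita H C g D' \<longrightarrow> D = D'))"
proof -
  interpret woronowicz_calculus_bij H C
    using assms(1-3) by (simp add: woronowicz_calculus_bij_def hopf_algebra_bij_def hopf_algebra_bij_axioms_def)
  note m = \<open>is_metric H C g\<close> \<open>diagonalisable (Omega2T C) (braiding_inv H (Omega1 C))\<close>
  \<comment> \<open>When \<open>Phi\<close> is onto, \<open>inv_into\<close> picks a preimage of the
    defect. This serves both the explicit formula, where \<open>D\<close> is the structure constants
    connection, and bare existence, where \<open>D\<close> is any torsion-free connection.\<close>
  have construct: "levi_civita H C g (D + inv_into (carr (Hom_form_sym H C)) (Phi H C g) (metric_defect H C g D))"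
    if "Phi H C g ` carr (Hom_form_sym H C) = carr (Hom_sym_form H C)"
      and D: "right_connection H C D" "torsion_free H C D" for D
  proof -
    have "metric_defect H C g D \<in> Phi H C g ` carr (Hom_form_sym H C)"
      using metric_defect_in_Hom[OF m D(1)] that(1) by simp
    then show ?thesis
      using levi_civita_construct[OF m D] by (simp add: inv_into_into f_inv_into_f)
  qed
  show ?thesis
  proof (intro conjI impI allI)
    fix n \<omega> \<chi> x assume iso: "vs_iso (Hom_form_sym H C) (Hom_sym_form H C) (Phi H C g)"
      and sd: "structure_data H C n \<omega> \<chi> x"
    then have "bij_betw (Phi H C g) (carr (Hom_form_sym H C)) (carr (Hom_sym_form H C))"
      by (simp add: vs_iso_def)
    then show "let Dc = structure_connection H C n \<omega> \<chi> x;
                  DLC = Dc + inv_into (carr (Hom_form_sym H C)) (Phi H C g) (metric_defect H C g Dc)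
              in levi_civita H C g DLC \<and> (\<forall>D. levi_civita H C g D \<longrightarrow> D = DLC)"
      using construct[OF _ structure_connection[OF sd]] levi_civita_unique[OF m]
      unfolding bij_betw_def Let_def by blast
  next
    assume "Phi H C g ` carr (Hom_form_sym H C) = carr (Hom_sym_form H C)"
    then show "\<exists>D. levi_civita H C g D"
      using torsion_free_connection_ex[OF m] construct by blast
  next
    fix D D' assume "inj_on (Phi H C g) (carr (Hom_form_sym H C))" "levi_civita H C g D" "levi_civita H C g D'"
    then show "D = D'" by (rule levi_civita_unique[OF m])
  qed
qed

end
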